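(* For every integer $d\ge 9$, the number of $(3;4,d)$-cages (up to isomorphism) equals $$\begin{cases}1 & \text{for } d\equiv 1 \pmod 4,\\ 4 & \text{for } d\equiv 2\pmod 4,\\ 17+\left\lfloor\frac{d}{8}\right\rfloor & \text{for } d\equiv 3\pmod 4,\\ 27+d+\left\lfloor\frac{d-4}{8}\right\rfloor & \text{for } d\equiv 0\pmod 4.\end{cases}$$
   Context: All graphs are finite and simple. A $(3;4,d)$-graph is a $3$-regular graph of girth $4$ and diameter exactly $d$; a $(3;4,d)$-cage is a $(3;4,d)$-graph of smallest order. *)

theory Defs
  imports
    "Graph_Theory.Pair_Digraph"
    "Graph_Theory.Digraph_Isomorphism"
    "Graph_Theory.Shortest_Path"
    "HOL-Library.Extended_Nat"
begin

text \<open>A finite simple graph is a \<^locale>\<open>pair_graph\<close>: each undirected edge is the pair of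
  opposite arcs \<open>(u,v)\<close>, \<open>(v,u)\<close>; there are no loops. Hence the degree of a vertex is its out-degree.\<close>

definition regular :: "nat \<Rightarrow> 'a pair_pre_digraph \<Rightarrow> bool" where
  "regular k G \<longleftrightarrow> (\<forall>v \<in> pverts G. out_degree (with_proj G) v = k)"

text \<open>The bound \<open>3 \<le> length c\<close> excludes the directed 2-cycles \<open>[(u,v), (v,u)]\<close>, which traverse
  a single undirected edge back and forth. The girth of a forest is \<open>\<infinity>\<close>.\<close>

definition girth :: "'a pair_pre_digraph \<Rightarrow> enat" where
  "girth G = (INF c \<in> {c. pre_digraph.cycle (with_proj G) c \<and> 3 \<le> length c}. enat (length c))"

text \<open>Distances are those of \<^const>\<open>wf_digraph.\<mu>\<close> with unit arc costs, so the diameter of a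
  disconnected graph is \<open>\<infinity>\<close>.\<close>

definition distance :: "'a pair_pre_digraph \<Rightarrow> 'a \<Rightarrow> 'a \<Rightarrow> ereal" where
  "distance G u v = wf_digraph.\<mu> (with_proj G) (\<lambda>_. 1) u v"

definition diameter :: "'a pair_pre_digraph \<Rightarrow> ereal" where
  "diameter G = (SUP u \<in> pverts G. SUP v \<in> pverts G. distance G u v)"

definition kgd_graph :: "nat \<Rightarrow> nat \<Rightarrow> nat \<Rightarrow> 'a pair_pre_digraph \<Rightarrow> bool" where
  "kgd_graph k g d G \<longleftrightarrow>
     pair_graph G \<and> regular k G \<and> girth G = enat g \<and> diameter G = ereal (real d)"

text \<open>Every finite graph is isomorphic to one whose vertices are natural numbers
  (\<open>pair_graph_iso_nat\<close> below), so minimality of the order and the number of isomorphism classes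
  may be computed among graphs on \<^typ>\<open>nat\<close>.\<close>

definition kgd_cage :: "nat \<Rightarrow> nat \<Rightarrow> nat \<Rightarrow> nat pair_pre_digraph \<Rightarrow> bool" where
  "kgd_cage k g d G \<longleftrightarrow> kgd_graph k g d G \<and>
     (\<forall>H :: nat pair_pre_digraph. kgd_graph k g d H \<longrightarrow> card (pverts G) \<le> card (pverts H))"

definition graph_iso_on :: "'a pair_pre_digraph set \<Rightarrow> 'a pair_pre_digraph rel" where
  "graph_iso_on \<G> = {(G, H). G \<in> \<G> \<and> H \<in> \<G> \<and> digraph_iso (with_proj G) (with_proj H)}"

definition num_kgd_cages :: "nat \<Rightarrow> nat \<Rightarrow> nat \<Rightarrow> nat" where
  "num_kgd_cages k g d = card ({G. kgd_cage k g d G} // graph_iso_on {G. kgd_cage k g d G})"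

lemma digraph_iso_pair_iff:
  assumes "pair_wf_digraph G"
  shows "digraph_iso (with_proj G) (with_proj H) \<longleftrightarrow>
    (\<exists>f. inj_on f (pverts G) \<and> pverts H = f ` pverts G \<and> parcs H = map_prod f f ` parcs G)"
    (is "?L \<longleftrightarrow> ?R")
proof
  interpret pair_wf_digraph G by fact
  {
    assume ?L
    then obtain h where h: "pre_digraph.digraph_isomorphism (with_proj G) h"
      and H: "with_proj H = app_iso h (with_proj G)"
      unfolding digraph_iso_def by blast
    have t: "iso_tail h = fst" "iso_head h = snd"
      and vs: "pverts H = iso_verts h ` pverts G" and as: "parcs H = iso_arcs h ` parcs G"
      using arg_cong[OF H, of tail] arg_cong[OF H, of head]
        arg_cong[OF H, of verts] arg_cong[OF H, of arcs] by simp_all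
    have "iso_arcs h a = map_prod (iso_verts h) (iso_verts h) a" if "a \<in> parcs G" for a
      using h that by (cases a) (auto simp: pre_digraph.digraph_isomorphism_def t prod_eq_iff)
    with as have "parcs H = map_prod (iso_verts h) (iso_verts h) ` parcs G" by auto
    with h vs show ?R by (auto simp: pre_digraph.digraph_isomorphism_def)
  next
    assume ?R
    then obtain f where f: "inj_on f (pverts G)" "pverts H = f ` pverts G"
      "parcs H = map_prod f f ` parcs G" by blast
    let ?h = "\<lparr>iso_verts = f, iso_arcs = map_prod f f, iso_head = snd, iso_tail = fst\<rparr>"
    have "inj_on (map_prod f f) (parcs G)"
    proof (rule inj_onI)
      fix a b assume "a \<in> parcs G" "b \<in> parcs G" "map_prod f f a = map_prod f f b"
      with f(1) show "a = b"
        using arc_fst_in_verts arc_snd_in_verts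
        by (metis fst_map_prod inj_onD prod.expand snd_map_prod)
    qed
    then have "pre_digraph.digraph_isomorphism (with_proj G) ?h"
      using f(1) wf_digraph_axioms by (simp add: pre_digraph.digraph_isomorphism_def)
    moreover have "with_proj H = app_iso ?h (with_proj G)"
      using f by (simp add: with_proj_def app_iso_def)
    ultimately show ?L unfolding digraph_iso_def by blast
  }
qed

lemma pair_graph_iso_nat:
  assumes "pair_graph G"
  shows "\<exists>H :: nat pair_pre_digraph. pair_graph H \<and> digraph_iso (with_proj G) (with_proj H)"
proof -
  interpret pair_graph G by fact
  from finite_verts obtain f :: "'a \<Rightarrow> nat" where f: "inj_on f (pverts G)"
    using finite_imp_inj_to_nat_seg by metis
  define H where "H = \<lparr>pverts = f ` pverts G, parcs = map_prod f f ` parcs G\<rparr>"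
  have iso: "digraph_iso (with_proj G) (with_proj H)"
    using f by (subst digraph_iso_pair_iff[OF pair_wf_digraph]) (auto simp: H_def)
  have "pair_graph H"
  proof (unfold_locales)
    show "finite (pverts H)" "finite (parcs H)"
      by (simp_all add: H_def)
    show "fst e \<in> pverts H" "snd e \<in> pverts H" if "e \<in> parcs H" for e
      using that by (auto simp: H_def dest: wellformed')
    show "fst e \<noteq> snd e" if "e \<in> parcs H" for e
    proof -
      from that obtain x y where xy: "(x, y) \<in> parcs G" "e = (f x, f y)" by (auto simp: H_def)
      then have "x \<noteq> y" "x \<in> pverts G" "y \<in> pverts G" 
        by (simp_all add: no_loops' in_arcsD1 in_arcsD2)
      with xy f show ?thesis by (auto dest: inj_onD)
    qed
    show "symmetric (with_proj H)"
      by (auto simp: symmetric_def sym_def H_def intro: rev_image_eqI arcs_symmetric)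
  qed
  with iso show ?thesis by blast
qed

lemma equiv_graph_iso_on:
  assumes "\<And>G. G \<in> \<G> \<Longrightarrow> pair_wf_digraph G"
  shows "equiv \<G> (graph_iso_on \<G>)"
proof (rule equivI)
  show "graph_iso_on \<G> \<subseteq> \<G> \<times> \<G>" by (auto simp: graph_iso_on_def)
  show "refl_on \<G> (graph_iso_on \<G>)"
  proof (rule refl_onI)
    fix G assume G: "G \<in> \<G>"
    have "digraph_iso (with_proj G) (with_proj G)"
      by (subst digraph_iso_pair_iff[OF assms[OF G]], rule exI[of _ id]) (simp add: map_prod.id)
    with G show "(G, G) \<in> graph_iso_on \<G>" by (simp add: graph_iso_on_def)
  qed
  have "digraph_iso (with_proj H) (with_proj G)"
    if G: "G \<in> \<G>" and H: "H \<in> \<G>" and iso: "digraph_iso (with_proj G) (with_proj H)" for G H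
  proof -
    interpret pair_wf_digraph G by (rule assms) fact
    obtain f where f: "inj_on f (pverts G)" "pverts H = f ` pverts G"
      "parcs H = map_prod f f ` parcs G"
      using iffD1[OF digraph_iso_pair_iff[OF assms[OF G]] iso] by (elim exE conjE)
    define g where "g = the_inv_into (pverts G) f"
    have gf: "g (f x) = x" if "x \<in> pverts G" for x
      using that f(1) by (simp add: g_def the_inv_into_f_f)
    have gf': "map_prod g g (map_prod f f a) = a" if "a \<in> parcs G" for a
      using that by (cases a) (simp add: gf in_arcsD1 in_arcsD2)
    have "map_prod g g ` parcs H = (\<lambda>a. a) ` parcs G"
      unfolding f(3) image_image by (rule image_cong[OF refl gf'])
    then have as: "parcs G = map_prod g g ` parcs H" by simp
    have "g ` pverts H = (\<lambda>x. x) ` pverts G"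
      unfolding f(2) image_image by (rule image_cong[OF refl gf])
    then have vs: "pverts G = g ` pverts H" by simp
    have "inj_on g (pverts H)"
      unfolding f(2) g_def by (rule inj_on_the_inv_into[OF f(1)])
    with vs as have "inj_on g (pverts H) \<and> pverts G = g ` pverts H \<and> parcs G = map_prod g g ` parcs H"
      by (intro conjI)
    then show ?thesis
      unfolding digraph_iso_pair_iff[OF assms[OF H]] by (rule exI[of _ g])
  qed
  then show "sym (graph_iso_on \<G>)" unfolding graph_iso_on_def by (intro symI) blast
  have "digraph_iso (with_proj G) (with_proj K)"
    if G: "G \<in> \<G>" and H: "H \<in> \<G>" and iso1: "digraph_iso (with_proj G) (with_proj H)"
      and iso2: "digraph_iso (with_proj H) (with_proj K)" for G H K
  proof -
    obtain f where f: "inj_on f (pverts G)" "pverts H = f ` pverts G"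
      "parcs H = map_prod f f ` parcs G"
      using iffD1[OF digraph_iso_pair_iff[OF assms[OF G]] iso1] by (elim exE conjE)
    obtain g where g: "inj_on g (pverts H)" "pverts K = g ` pverts H"
      "parcs K = map_prod g g ` parcs H"
      using iffD1[OF digraph_iso_pair_iff[OF assms[OF H]] iso2] by (elim exE conjE)
    have "inj_on (g \<circ> f) (pverts G)"
      using f(1) g(1) unfolding f(2) by (rule comp_inj_on)
    moreover have "pverts K = (g \<circ> f) ` pverts G"
      unfolding g(2) f(2) by (rule image_comp)
    moreover have "parcs K = map_prod (g \<circ> f) (g \<circ> f) ` parcs G"
      unfolding g(3) f(3) image_comp map_prod.comp ..
    ultimately have "inj_on (g \<circ> f) (pverts G) \<and> pverts K = (g \<circ> f) ` pverts G
        \<and> parcs K = map_prod (g \<circ> f) (g \<circ> f) ` parcs G"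
      by (intro conjI)
    then show ?thesis
      unfolding digraph_iso_pair_iff[OF assms[OF G]] by (rule exI[of _ "g \<circ> f"])
  qed
  then show "trans (graph_iso_on \<G>)" unfolding graph_iso_on_def by (intro transI) (simp, blast)
qed

end

(*
A graph of diameter d with few vertices is thin: seen from a vertex u of eccentricity d, the three
distance levels at either end have at least 7 vertices together, so if every level in between had at
least two vertices there would be at least 2d + 4 vertices, too many for d >= 9. A level with a single
vertex gives a bridge, and removing the bridge leaves two pieces, each with one root of degree 2.

A piece is decomposed in the same way. Let its excess be 2 * order - 3 * (eccentricity of the root + 1).
The first singleton level of a piece splits off a block between two bridges, and blocks of small excess
are found by an exhaustive search over breadth-first labellings. The search leaves only: K_{3,3} minus
an edge (excess 0), one block each of excess 2 and 3, and end blocks of excess 5, 6, 7, 8, of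
which there are 1, 4, 7 and 7. The order bound leaves room for 3 units above the
minimal total 10 = 5 + 5, and d mod 4 determines how many of them are used.

So the cages correspond to words of blocks. Bridges and the components left after their removal are
isomorphism invariants, hence a word is determined by its graph up to reversal, and the number of
words up to reversal is half the sum of the numbers of words and of palindromic words. The same
uniqueness shows that the diameter of the graph of a word is not larger than it should be.
*)

theory Submission
  imports Defs
begin

text \<open>The excess is additive when a bridge is cut: orders add up, and so do the numbers of
  levels. The rate of 3/2 vertices per level is that of K_{3,3} minus an edge (6 vertices on 4
  levels), so this block costs nothing and may be repeated. A level with two vertices costs 4 - 3 =
  1; hence a block without singleton levels and with bounded excess has bounded length, and finite
  searches suffice. Lower bound and classification go together: since an end costs at least 5, a
  total of at most 13 leaves at most 8 for the piece on either side of a bridge, and within such a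
  piece at most 3 for a block in front of an end. Cubic graphs have even order, so the total
  \<open>2 * n - 3 * (d + 1)\<close> is congruent to \<open>d + 1\<close> modulo 4; the range from
  10 to 13 then fixes it. The bridge at a singleton level may lie on either side of it. If it enters
  the level from below, its lower end need not be alone on its level; within a piece this costs too
  much, by a search of its own. The searches are only proved complete: their results are compared
  with explicit lists, whose properties are checked by evaluation.\<close>

section \<open>Exhaustive search over breadth-first labellings\<close>

text \<open>A graph on \<open>0, 1, \<dots>\<close> is encoded by its back lists: entry \<open>j\<close> lists the neighbours of \<open>j\<close> that
  are smaller than \<open>j\<close>. In \<open>forward_choices n i a bs\<close>, vertex \<open>i\<close> with back list \<open>a\<close> still needs \<open>n\<close>
  neighbours. Each result attaches it to some of the labelled but unprocessed vertices, whose back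
  lists are \<open>bs\<close>, and returns the number of neighbours that must be new vertices.\<close>

fun forward_choices :: "nat \<Rightarrow> nat \<Rightarrow> nat list \<Rightarrow> nat list list \<Rightarrow> (nat list list \<times> nat) list" where
  "forward_choices n i a [] = [([], n)]"
| "forward_choices n i a (b # bs) = map (\<lambda>(r, m). (b # r, m)) (forward_choices n i a bs) @
     (if 0 < n \<and> length b < 3 \<and> list_all (\<lambda>x. \<not> List.member b x) a
      then map (\<lambda>(r, m). ((i # b) # r, m)) (forward_choices (n - 1) i a bs) else [])"

text \<open>The default 0 stands for the level after the last one: there \<open>layer_search\<close>
  may not create new vertices.\<close>

definition next_size :: "(nat \<times> nat) list \<Rightarrow> nat" where
  "next_size ps = (case ps of [] \<Rightarrow> 0 | p # _ \<Rightarrow> fst p)"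

text \<open>The vertices below \<open>i\<close> are processed and have the back lists \<open>rev dn\<close>; \<open>todo\<close> contains the back
  lists of the other labelled vertices, the first \<open>k\<close> of which are on the current level, where all
  degrees are \<open>c\<close>. The list \<open>ps\<close> prescribes size and degree for the following levels.\<close>

function layer_search ::
  "nat \<Rightarrow> nat list list \<Rightarrow> nat \<Rightarrow> nat list list \<Rightarrow> nat \<Rightarrow> (nat \<times> nat) list \<Rightarrow> nat list list list"
where
  "layer_search i dn 0 todo c [] = (if todo = [] then [rev dn] else [])"
| "layer_search i dn 0 todo c (p # ps) =
     (if length todo = fst p then layer_search i dn (fst p) todo (snd p) ps else [])"
| "layer_search i dn (Suc k) [] c ps = []"
| "layer_search i dn (Suc k) (b # bs) c ps = (if length b \<le> c then
     concat (map (\<lambda>(r, n). if length r + n \<le> k + next_size ps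
        then layer_search (Suc i) (b # dn) k (r @ replicate n [i]) c ps else [])
       (forward_choices (c - length b) i b bs)) else [])"
  by pat_completeness auto
termination
  by (relation "measures [\<lambda>(i, dn, k, todo, c, ps). length ps, \<lambda>(i, dn, k, todo, c, ps). k]") auto

definition bk_adj :: "nat list list \<Rightarrow> nat \<Rightarrow> nat \<Rightarrow> bool" where
  "bk_adj bk a b \<longleftrightarrow> a < length bk \<and> b < length bk \<and> (a \<in> set (bk ! b) \<or> b \<in> set (bk ! a))"

lemma forward_choices_complete:
  assumes "J \<subseteq> {..<length bs}" "card J \<le> n"
    "\<And>j. j \<in> J \<Longrightarrow> length (bs ! j) < 3 \<and> set (bs ! j) \<inter> set a = {}"
  shows "(map (\<lambda>j. if j \<in> J then i # bs ! j else bs ! j) [0..<length bs], n - card J)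
    \<in> set (forward_choices n i a bs)"
  using assms
proof (induction bs arbitrary: J n)
  case Nil
  then show ?case by simp
next
  case (Cons b bs)
  define J' where "J' = {j. Suc j \<in> J}"
  have finJ: "finite J" using Cons.prems(1) finite_subset by blast
  have J: "J = (if 0 \<in> J then insert 0 (Suc ` J') else Suc ` J')"
    unfolding J'_def by (auto simp: image_iff) (metis not0_implies_Suc)+
  have cJ: "card J = (if 0 \<in> J then Suc (card J') else card J')"
  proof -
    have "finite (Suc ` J')" using finJ J by (metis finite_insert)
    then have f': "finite J'" by (simp add: finite_image_iff)
    have "card J = card (if 0 \<in> J then insert 0 (Suc ` J') else Suc ` J')" using J by simp
    then show ?thesis using f' by (auto simp: card_image)
  qed
  have sub: "J' \<subseteq> {..<length bs}" using Cons.prems(1) by (auto simp: J'_def)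
  have P: "length (bs ! j) < 3 \<and> set (bs ! j) \<inter> set a = {}" if "j \<in> J'" for j
    using Cons.prems(3)[of "Suc j"] that by (auto simp: J'_def)
  have m: "map (\<lambda>j. if j \<in> J then i # (b # bs) ! j else (b # bs) ! j) [0..<length (b # bs)]
    = (if 0 \<in> J then i # b else b) # map (\<lambda>j. if j \<in> J' then i # bs ! j else bs ! j) [0..<length bs]"
    by (rule nth_equalityI) (auto simp: nth_Cons' J'_def simp del: upt_Suc)
  show ?case
  proof (cases "0 \<in> J")
    case True
    then have n: "0 < n" using Cons.prems(2) cJ by simp
    have "card J' \<le> n - 1" using True cJ Cons.prems(2) by simp
    from Cons.IH[OF sub this P] True cJ n Cons.prems(3)[OF True] show ?thesis
      unfolding m by (force simp: list_all_iff List.member_iff image_iff)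
  next
    case False
    have "card J' \<le> n" using False cJ Cons.prems(2) by simp
    from Cons.IH[OF sub this P] False cJ show ?thesis
      unfolding m by (force simp: image_iff)
  qed
qed

text \<open>By \<open>parent\<close> and \<open>lev_step\<close>, \<open>lev\<close> is the distance
  from \<open>w\<close> inside \<open>A\<close>. It is a parameter because pieces inherit shifted
  levels from a larger graph. Edges of \<open>E\<close> that leave \<open>A\<close> do not count in
  \<open>deg\<close>. Degrees can be prescribed by level because a vertex that has lost a bridge
  will be alone on its level.\<close>

locale layered =
  fixes E :: "('v \<times> 'v) set" and A :: "'v set" and w :: 'v and lev :: "'v \<Rightarrow> nat" and c :: "nat \<Rightarrow> nat"
  assumes fin: "finite A" and root: "w \<in> A" "lev w = 0"
    and root_unique: "\<And>x. x \<in> A \<Longrightarrow> lev x = 0 \<Longrightarrow> x = w"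
    and parent: "\<And>x l. x \<in> A \<Longrightarrow> lev x = Suc l \<Longrightarrow> \<exists>y\<in>A. lev y = l \<and> (y, x) \<in> E"
    and lev_step: "\<And>x y. x \<in> A \<Longrightarrow> y \<in> A \<Longrightarrow> (x, y) \<in> E \<Longrightarrow> lev y \<le> Suc (lev x)"
    and adj_sym: "\<And>x y. (x, y) \<in> E \<Longrightarrow> (y, x) \<in> E"
    and adj_irrefl: "\<And>x. (x, x) \<notin> E"
    and triangle_free: "\<And>x y z. (x, y) \<in> E \<Longrightarrow> (y, z) \<in> E \<Longrightarrow> (x, z) \<notin> E"
    and deg: "\<And>x. x \<in> A \<Longrightarrow> card {y \<in> A. (x, y) \<in> E} = c (lev x)"
    and cap_le: "\<And>l. c l \<le> 3"
begin

text \<open>The invariant of the search: the vertices in \<open>dn\<close> are processed, and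
  \<open>k\<close> vertices of level \<open>l\<close> are not. Back lists record processed
  neighbours only, hence \<open>a < i\<close>. By the last conjunct processed vertices have no
  unlabelled neighbours, so a vertex labelled later is not adjacent to them.\<close>

definition partial_labelling ::
  "(nat \<Rightarrow> 'v) \<Rightarrow> nat list list \<Rightarrow> nat \<Rightarrow> nat list list \<Rightarrow> nat \<Rightarrow> bool" where
  "partial_labelling f dn k todo l \<longleftrightarrow> (let i = length dn; bk = rev dn @ todo; t = length bk in
     k \<le> length todo \<and> inj_on f {..<t} \<and> f ` {..<t} \<subseteq> A \<and> f 0 = w \<and>
     {x \<in> A. lev x \<le> l} = f ` {..<i + k} \<and>
     (\<forall>j. i \<le> j \<and> j < i + k \<longrightarrow> lev (f j) = l) \<and>
     (\<forall>j. i + k \<le> j \<and> j < t \<longrightarrow> lev (f j) = Suc l) \<and>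
     (\<forall>a b. a \<le> b \<and> b < t \<longrightarrow> lev (f a) \<le> lev (f b)) \<and>
     (\<forall>j<t. distinct (bk ! j) \<and> set (bk ! j) = {a. a < i \<and> a < j \<and> (f a, f j) \<in> E}) \<and>
     (\<forall>a<i. \<forall>y\<in>A. (f a, y) \<in> E \<longrightarrow> y \<in> f ` {..<t}))"

definition labelling :: "(nat \<Rightarrow> 'v) \<Rightarrow> nat list list \<Rightarrow> bool" where
  "labelling g bk \<longleftrightarrow> bij_betw g {..<length bk} A \<and> g 0 = w \<and>
     (\<forall>a<length bk. \<forall>b<length bk. (g a, g b) \<in> E \<longleftrightarrow> bk_adj bk a b) \<and>
     (\<forall>a b. a \<le> b \<and> b < length bk \<longrightarrow> lev (g a) \<le> lev (g b))"

definition profile :: "nat \<Rightarrow> nat \<Rightarrow> (nat \<times> nat) list" where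
  "profile l e = map (\<lambda>j. (card {x \<in> A. lev x = j}, c j)) [l..<Suc e]"

lemma partial_labelling_finished:
  assumes "partial_labelling f dn 0 [] e" "\<And>x. x \<in> A \<Longrightarrow> lev x \<le> e"
  shows "labelling f (rev dn)"
proof -
  from assms(1) have *: "inj_on f {..<length dn}" "f 0 = w" "{x \<in> A. lev x \<le> e} = f ` {..<length dn}"
    "\<And>a b. a \<le> b \<Longrightarrow> b < length dn \<Longrightarrow> lev (f a) \<le> lev (f b)"
    and s: "\<And>j. j < length dn \<Longrightarrow> set (rev dn ! j) = {a. a < j \<and> (f a, f j) \<in> E}"
    by (auto simp: partial_labelling_def Let_def)
  have "bij_betw f {..<length dn} A"
    using * assms(2) by (auto simp: bij_betw_def)
  moreover have "(f a, f b) \<in> E \<longleftrightarrow> bk_adj (rev dn) a b" if "a < length dn" "b < length dn" for a b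
    using that s[of a] s[of b] adj_sym adj_irrefl by (auto simp: bk_adj_def)
  ultimately show ?thesis using * by (simp add: labelling_def)
qed

text \<open>A vertex of level \<open>Suc l\<close> has a parent on level \<open>l\<close>. All of
  that level is processed, so the vertex is labelled already.\<close>

lemma partial_labelling_next_level:
  assumes P: "partial_labelling f dn 0 todo l"
  shows "length todo = card {x \<in> A. lev x = Suc l}"
    and "partial_labelling f dn (length todo) todo (Suc l)"
proof -
  let ?i = "length dn" and ?t = "length dn + length todo"
  from P have inj: "inj_on f {..<?t}" and sub: "f ` {..<?t} \<subseteq> A"
    and le: "{x \<in> A. lev x \<le> l} = f ` {..<?i}"
    and nl: "\<And>j. ?i \<le> j \<Longrightarrow> j < ?t \<Longrightarrow> lev (f j) = Suc l"
    and cl: "\<And>a y. a < ?i \<Longrightarrow> y \<in> A \<Longrightarrow> (f a, y) \<in> E \<Longrightarrow> y \<in> f ` {..<?t}"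
    by (auto simp: partial_labelling_def Let_def)
  have eq: "{x \<in> A. lev x = Suc l} = f ` {?i..<?t}"
  proof (intro equalityI subsetI)
    fix x assume "x \<in> {x \<in> A. lev x = Suc l}"
    then have x: "x \<in> A" "lev x = Suc l" by auto
    from parent[OF this] obtain y where y: "y \<in> A" "lev y = l" "(y, x) \<in> E" by blast
    with le obtain a where "a < ?i" "y = f a" by force
    with cl x y obtain b where b: "b < ?t" "x = f b" by blast
    have "\<not> b < ?i" using le b x by (metis (mono_tags, lifting) imageI lessThan_iff mem_Collect_eq not_less_eq_eq order_refl)
    with b show "x \<in> f ` {?i..<?t}" by auto
  qed (use sub nl in auto)
  have inj2: "inj_on f {?i..<?t}" using inj by (rule inj_on_subset) auto
  show "length todo = card {x \<in> A. lev x = Suc l}"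
    unfolding eq card_image[OF inj2] by simp
  have "{x \<in> A. lev x \<le> Suc l} = {x \<in> A. lev x \<le> l} \<union> {x \<in> A. lev x = Suc l}" by auto
  also have "\<dots> = f ` {..<?t}" unfolding le eq image_Un[symmetric] by (rule arg_cong[of _ _ "(`) f"]) auto
  finally show "partial_labelling f dn (length todo) todo (Suc l)"
    using P nl by (auto simp: partial_labelling_def Let_def)
qed

text \<open>The neighbours of the vertex to be processed are the processed ones (\<open>Bk\<close>),
  the other labelled ones (\<open>F\<close>) and the unlabelled ones (\<open>Nw\<close>).
  \<open>F\<close> selects a result of \<open>forward_choices\<close>; \<open>Nw\<close> is appended
  to the labelling in an arbitrary order.\<close>

lemma partial_labelling_step:
  assumes P: "partial_labelling f dn (Suc k) (b # bs) l"
  shows "length b \<le> c l \<and> (\<exists>r n g. (r, n) \<in> set (forward_choices (c l - length b) (length dn) b bs) \<and>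
    length r + n \<le> k + card {x \<in> A. lev x = Suc l} \<and>
    partial_labelling g (b # dn) k (r @ replicate n [length dn]) l)"
proof -
  define i where "i = length dn"
  define t where "t = i + Suc (length bs)"
  define bk where "bk = rev dn @ b # bs"
  have P': "k \<le> length bs \<and> inj_on f {..<t} \<and> f ` {..<t} \<subseteq> A \<and> f 0 = w \<and>
     {x \<in> A. lev x \<le> l} = f ` {..<i + Suc k} \<and>
     (\<forall>j. i \<le> j \<and> j < i + Suc k \<longrightarrow> lev (f j) = l) \<and>
     (\<forall>j. i + Suc k \<le> j \<and> j < t \<longrightarrow> lev (f j) = Suc l) \<and>
     (\<forall>a b. a \<le> b \<and> b < t \<longrightarrow> lev (f a) \<le> lev (f b)) \<and>
     (\<forall>j<t. distinct (bk ! j) \<and> set (bk ! j) = {a. a < i \<and> a < j \<and> (f a, f j) \<in> E}) \<and>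
     (\<forall>a<i. \<forall>y\<in>A. (f a, y) \<in> E \<longrightarrow> y \<in> f ` {..<t})"
    using P by (simp add: partial_labelling_def Let_def i_def t_def bk_def)
  then have kle: "k \<le> length bs" and inj: "inj_on f {..<t}" and sub: "f ` {..<t} \<subseteq> A" and f0: "f 0 = w"
    and le: "{x \<in> A. lev x \<le> l} = f ` {..<i + Suc k}"
    by simp_all
  from P' have cur: "\<And>j. i \<le> j \<Longrightarrow> j < i + Suc k \<Longrightarrow> lev (f j) = l"
    and nl: "\<And>j. i + Suc k \<le> j \<Longrightarrow> j < t \<Longrightarrow> lev (f j) = Suc l"
    and mono: "\<And>a b. a \<le> b \<Longrightarrow> b < t \<Longrightarrow> lev (f a) \<le> lev (f b)"
    by blast+
  from P' have dist: "\<And>j. j < t \<Longrightarrow> distinct (bk ! j)"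
    and bck: "\<And>j. j < t \<Longrightarrow> set (bk ! j) = {a. a < i \<and> a < j \<and> (f a, f j) \<in> E}"
    and cl: "\<And>a y. a < i \<Longrightarrow> y \<in> A \<Longrightarrow> (f a, y) \<in> E \<Longrightarrow> y \<in> f ` {..<t}"
    by blast+
  have bki: "bk ! i = b" by (simp add: bk_def i_def nth_append)
  have bkr: "bk ! (Suc i + j) = bs ! j" for j by (simp add: bk_def i_def nth_append)
  have it: "i < t" by (simp add: t_def)
  define v where "v = f i"
  have vA: "v \<in> A" and vl: "lev v = l" using sub it cur[of i] by (auto simp: v_def)
  define N where "N = {y \<in> A. (v, y) \<in> E}"
  have finN: "finite N" using fin by (simp add: N_def)
  have cN: "card N = c l" using deg[OF vA] vl by (simp add: N_def)
  define Bk where "Bk = f ` set b"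
  define J where "J = {j. j < length bs \<and> (v, f (Suc i + j)) \<in> E}"
  define F where "F = (\<lambda>j. f (Suc i + j)) ` J"
  define Nw where "Nw = N - f ` {..<t}"
  have setb: "set b = {a. a < i \<and> (f a, v) \<in> E}" using bck[OF it] bki by (auto simp: v_def)
  have cB: "card Bk = length b"
  proof -
    have "set b \<subseteq> {..<t}" unfolding setb using it by (simp add: subset_iff)
    with inj have "inj_on f (set b)" by (rule inj_on_subset)
    then show ?thesis using dist[OF it] bki by (simp add: Bk_def card_image distinct_card)
  qed
  have finJ: "finite J" by (simp add: J_def)
  have cF: "card F = card J"
    unfolding F_def
  proof (rule card_image, rule inj_onI)
    fix x y assume "x \<in> J" "y \<in> J" "f (Suc i + x) = f (Suc i + y)"
    then show "x = y" using inj_onD[OF inj, of "Suc i + x" "Suc i + y"] by (simp add: J_def t_def)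
  qed
  have Nun: "N = Bk \<union> F \<union> Nw"
  proof (intro equalityI subsetI)
    fix y assume y: "y \<in> N"
    show "y \<in> Bk \<union> F \<union> Nw"
    proof (cases "y \<in> f ` {..<t}")
      case True
      then obtain a where a: "a < t" "y = f a" by auto
      have "a \<noteq> i" using y a adj_irrefl by (auto simp: N_def v_def)
      then consider "a < i" | "i < a" by linarith
      then show ?thesis
      proof cases
        case 1
        then show ?thesis using y a adj_sym by (auto simp: N_def Bk_def setb)
      next
        case 2
        then obtain j where "a = Suc i + j" by (metis less_iff_Suc_add add_Suc)
        then show ?thesis using y a by (auto simp: N_def F_def J_def t_def)
      qed
    qed (use y in \<open>auto simp: Nw_def\<close>)
  next
    fix y assume "y \<in> Bk \<union> F \<union> Nw"
    then show "y \<in> N" using sub adj_sym it by (auto simp: Nw_def N_def Bk_def setb F_def J_def t_def image_subset_iff)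
  qed
  have d1: "Bk \<inter> F = {}"
  proof -
    have False if "a < i" "j < length bs" "f a = f (Suc i + j)" for a j
      using inj_onD[OF inj that(3)] that by (simp add: t_def)
    then show ?thesis by (auto simp: Bk_def F_def J_def setb)
  qed
  have d2: "(Bk \<union> F) \<inter> Nw = {}" by (auto simp: Nw_def Bk_def setb F_def J_def t_def)
  have finBk: "finite Bk" "finite F" "finite Nw" using finJ finN by (auto simp: Bk_def F_def Nw_def)
  have card: "c l = length b + card J + card Nw"
    using cN cB cF Nun d1 d2 finBk by (metis card_Un_disjoint finite_UnI)
  define n where "n = card Nw"
  obtain h where h: "bij_betw h {t..<t + n} Nw"
    using finBk(3) by (metis card_atLeastLessThan diff_add_inverse finite_atLeastLessThan finite_same_card_bij n_def)
  define g where "g a = (if a < t then f a else h a)" for a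
  define r where "r = map (\<lambda>j. if j \<in> J then i # bs ! j else bs ! j) [0..<length bs]"
  have Jprop: "length (bs ! j) < 3 \<and> set (bs ! j) \<inter> set b = {}" if j: "j \<in> J" for j
  proof -
    let ?a = "Suc i + j"
    have a: "?a < t" "(v, f ?a) \<in> E" using j by (auto simp: J_def t_def)
    have s: "set (bs ! j) = {x. x < i \<and> (f x, f ?a) \<in> E}" using bck[OF a(1)] bkr by auto
    have "set (bs ! j) \<inter> set b = {}"
      using setb s a(2) triangle_free adj_sym by blast
    moreover have "length (bs ! j) < 3"
    proof -
      let ?M = "{y \<in> A. (f ?a, y) \<in> E}"
      have "insert v (f ` set (bs ! j)) \<subseteq> ?M"
        using vA a(2) adj_sym sub s it by (auto simp: t_def)
      then have "card (insert v (f ` set (bs ! j))) \<le> card ?M" using fin by (intro card_mono) auto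
      moreover have "v \<notin> f ` set (bs ! j)"
      proof
        assume "v \<in> f ` set (bs ! j)"
        then obtain x where x: "x < i" "f i = f x" unfolding v_def s by blast
        with inj_onD[OF inj x(2)] it show False by simp
      qed
      moreover have "card (f ` set (bs ! j)) = length (bs ! j)"
      proof -
        have "set (bs ! j) \<subseteq> {..<t}" unfolding s using it by (simp add: subset_iff)
        with inj have "inj_on f (set (bs ! j))" by (rule inj_on_subset)
        then show ?thesis using dist[OF a(1)] bkr by (simp add: card_image distinct_card)
      qed
      moreover have "card ?M \<le> 3" using deg[of "f ?a"] sub a cap_le by auto
      ultimately show ?thesis by simp
    qed
    ultimately show ?thesis by simp
  qed
  have ch: "(r, n) \<in> set (forward_choices (c l - length b) i b bs)"
  proof -
    have "(r, (c l - length b) - card J) \<in> set (forward_choices (c l - length b) i b bs)"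
      unfolding r_def by (rule forward_choices_complete) (use Jprop card in \<open>auto simp: J_def\<close>)
    then show ?thesis using card by (simp add: n_def)
  qed
  have NwA: "Nw \<subseteq> A" by (auto simp: Nw_def N_def)
  have Nwl: "lev y = Suc l" if "y \<in> Nw" for y
  proof -
    have "y \<in> A" "(v, y) \<in> E" "y \<notin> f ` {..<t}" using that by (auto simp: Nw_def N_def)
    with lev_step[OF vA, of y] vl have "lev y \<le> Suc l" by simp
    moreover have "\<not> lev y \<le> l"
    proof
      assume "lev y \<le> l"
      with le \<open>y \<in> A\<close> obtain a where "a < i + Suc k" "y = f a" by blast
      with \<open>y \<notin> f ` {..<t}\<close> kle show False by (auto simp: t_def)
    qed
    ultimately show ?thesis by simp
  qed
  have hN: "h a \<in> Nw" if "t \<le> a" "a < t + n" for a using h that by (auto simp: bij_betw_def)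
  have ginj: "inj_on g {..<t + n}"
  proof (rule inj_onI)
    fix x y assume xy: "x \<in> {..<t + n}" "y \<in> {..<t + n}" "g x = g y"
    have *: "f a \<noteq> h a'" if "a < t" "t \<le> a'" "a' < t + n" for a a'
    proof -
      have "h a' \<notin> f ` {..<t}" using hN[OF that(2,3)] by (simp add: Nw_def)
      moreover have "f a \<in> f ` {..<t}" using that(1) by simp
      ultimately show ?thesis by metis
    qed
    from xy show "x = y"
      using inj_onD[OF inj, of x y] bij_betw_imp_inj_on[OF h, THEN inj_onD, of x y] *[of x y] *[of y x]
      by (auto simp: g_def split: if_splits)
  qed
  have gsub: "g ` {..<t + n} \<subseteq> A"
    using sub hN NwA by (auto simp: g_def)
  have tk: "i + Suc k \<le> t" using kle by (simp add: t_def)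
  have gl: "lev (g j) = Suc l" if "i + Suc k \<le> j" "j < t + n" for j
    using that nl[of j] Nwl[OF hN[of j]] by (auto simp: g_def)
  have lele: "lev (f a) \<le> Suc l" if "a < t" for a
    using mono[of a "t - 1"] that nl[of "t - 1"] cur[of "t - 1"] tk it
    by (cases "i + Suc k \<le> t - 1") (simp, fastforce)
  have gmono: "lev (g a) \<le> lev (g b)" if "a \<le> b" "b < t + n" for a b
    using that mono[of a b] gl[of b] gl[of a] lele[of a] tk
    by (cases "b < t"; cases "a < t") (auto simp: g_def)
  \<comment> \<open>All labels from \<open>i + Suc k\<close> on belong to level
    \<open>Suc l\<close>. This justifies the pruning test of \<open>layer_search\<close>.\<close>
  have bound: "length bs + n \<le> k + card {x \<in> A. lev x = Suc l}"
  proof -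
    have "g ` {i + Suc k..<t + n} \<subseteq> {x \<in> A. lev x = Suc l}" using gsub gl tk by auto
    then have "card (g ` {i + Suc k..<t + n}) \<le> card {x \<in> A. lev x = Suc l}"
      using fin by (intro card_mono) auto
    moreover have "inj_on g {i + Suc k..<t + n}" using ginj by (rule inj_on_subset) auto
    ultimately have "t + n - (i + Suc k) \<le> card {x \<in> A. lev x = Suc l}" by (simp add: card_image)
    then show ?thesis by (simp add: t_def)
  qed
  define bk' where "bk' = rev (b # dn) @ r @ replicate n [i]"
  have lr: "length r = length bs" by (simp add: r_def)
  have lbk': "length bk' = t + n" by (simp add: bk'_def t_def i_def lr)
  \<comment> \<open>A new vertex is not adjacent to a vertex processed earlier, because those have
    all their neighbours among the old labels.\<close>
  have adj_new: "(g a, g j) \<in> E \<longleftrightarrow> a = i" if "a \<le> i" "t \<le> j" "j < t + n" for a j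
  proof -
    have g: "g j \<in> Nw" "g a = f a" using hN that it by (auto simp: g_def)
    have "(f a, g j) \<notin> E" if "a < i" using cl[OF that, of "g j"] g(1) NwA by (auto simp: Nw_def)
    moreover have "(f i, g j) \<in> E" using g(1) by (auto simp: Nw_def N_def v_def)
    ultimately show ?thesis using that g(2) by (cases "a = i") auto
  qed
  have back': "distinct (bk' ! j) \<and> set (bk' ! j) = {a. a < Suc i \<and> a < j \<and> (g a, g j) \<in> E}"
    if j: "j < t + n" for j
  proof -
    consider "j \<le> i" | "i < j" "j < t" | "t \<le> j" by linarith
    then show ?thesis
    proof cases
      case 1
      then have "bk' ! j = bk ! j" by (auto simp: bk'_def bk_def i_def nth_append)
      moreover have "{a. a < Suc i \<and> a < j \<and> (g a, g j) \<in> E} = {a. a < i \<and> a < j \<and> (f a, f j) \<in> E}"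
        using 1 it by (intro Collect_cong) (auto simp: g_def)
      ultimately show ?thesis using 1 it dist[of j] bck[of j] by simp
    next
      case 2
      then obtain m where m: "j = Suc i + m" "m < length bs" by (metis less_iff_Suc_add add_Suc t_def add_less_cancel_left add_Suc_right not_less_eq)
      have "bk' ! j = r ! m" using m by (simp add: bk'_def i_def nth_append lr)
      also have "\<dots> = (if m \<in> J then i # bk ! j else bk ! j)" using m bkr by (simp add: r_def)
      finally have e: "bk' ! j = (if m \<in> J then i # bk ! j else bk ! j)" .
      have J: "m \<in> J \<longleftrightarrow> (f i, f j) \<in> E" using m by (simp add: J_def v_def)
      have "i \<notin> set (bk ! j)" using bck[of j] 2 by simp
      moreover have "{a. a < Suc i \<and> a < j \<and> (g a, g j) \<in> E} = {a. a < Suc i \<and> a < j \<and> (f a, f j) \<in> E}"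
        using 2 it by (auto simp: g_def)
      moreover have "\<dots> = {a. a < i \<and> a < j \<and> (f a, f j) \<in> E} \<union> (if m \<in> J then {i} else {})"
        using 2 J by (auto simp: less_Suc_eq)
      ultimately show ?thesis using e dist[of j] bck[of j] 2 by auto
    next
      case 3
      have "bk' = (rev (b # dn) @ r) @ replicate n [i]" by (simp add: bk'_def)
      moreover have "length (rev (b # dn) @ r) = t" by (simp add: t_def i_def lr)
      ultimately have "bk' ! j = replicate n [i] ! (j - t)" using 3 by (simp only: nth_append) simp
      then have "bk' ! j = [i]" using 3 j by simp
      moreover have "{a. a < Suc i \<and> a < j \<and> (g a, g j) \<in> E} = {i}"
        using adj_new[OF _ 3 j] 3 it by auto
      ultimately show ?thesis by simp
    qed
  qed
  have cl': "y \<in> g ` {..<t + n}" if "a < Suc i" "y \<in> A" "(g a, y) \<in> E" for a y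
  proof -
    have ga: "g a = f a" using that it by (simp add: g_def)
    have fsub: "f ` {..<t} \<subseteq> g ` {..<t + n}"
    proof (rule image_subsetI)
      fix x assume "x \<in> {..<t}"
      then show "f x \<in> g ` {..<t + n}" by (intro image_eqI[of _ _ x]) (auto simp: g_def)
    qed
    show ?thesis
    proof (cases "y \<in> f ` {..<t}")
      case False
      then have "a = i" using cl[of a y] that ga by (metis less_Suc_eq)
      then have "y \<in> Nw" using that False ga by (auto simp: Nw_def N_def v_def)
      then obtain x where "x \<in> {t..<t + n}" "y = h x" using h by (auto simp: bij_betw_def)
      then show ?thesis by (intro image_eqI[of _ _ x]) (auto simp: g_def)
    qed (use fsub in auto)
  qed
  have le': "{x \<in> A. lev x \<le> l} = g ` {..<Suc i + k}"
    unfolding le by (rule image_cong) (use tk in \<open>auto simp: g_def\<close>)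
  have "partial_labelling g (b # dn) k (r @ replicate n [i]) l"
    unfolding partial_labelling_def Let_def bk'_def[symmetric] lbk'
    using kle lr ginj gsub f0 le' gl gmono back' cl' cur tk it
    by (auto simp: g_def i_def[symmetric])
  moreover have "length r + n \<le> k + card {x \<in> A. lev x = Suc l}" using bound lr by simp
  moreover have "length b \<le> c l" using card by simp
  ultimately show ?thesis using ch unfolding i_def[symmetric] by blast
qed

theorem layer_search_complete:
  assumes "partial_labelling f dn k todo l" "\<And>x. x \<in> A \<Longrightarrow> lev x \<le> e" "l \<le> e"
  shows "\<exists>bk \<in> set (layer_search (length dn) dn k todo (c l) (profile (Suc l) e)). \<exists>g. labelling g bk"
  using assms
proof (induction "length dn" dn k todo "c l" "profile (Suc l) e" arbitrary: f l rule: layer_search.induct)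
  case (1 dn todo)
  have "length (profile (Suc l) e) = 0" by (simp only: \<open>[] = _\<close>[symmetric] list.size)
  then have l: "l = e" using "1.prems"(3) by (simp add: profile_def del: upt_Suc)
  have "todo = []"
  proof -
    have none: "{x \<in> A. lev x = Suc l} = {}" using "1.prems"(2) l by fastforce
    show ?thesis using partial_labelling_next_level(1)[OF "1.prems"(1)]
      by (simp only: none card.empty length_0_conv)
  qed
  then show ?case using partial_labelling_finished[of f dn e] 1 l by auto
next
  case (2 dn todo p ps)
  have le: "l < e" and p: "p = (card {x \<in> A. lev x = Suc l}, c (Suc l))" and ps: "ps = profile (Suc (Suc l)) e"
    using \<open>p # ps = _\<close> by (auto simp: profile_def upt_rec[of "Suc l"] simp del: upt_Suc split: if_splits)
  note nl = partial_labelling_next_level[OF "2.prems"(1)]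
  have *: "\<exists>bk\<in>set (layer_search (length dn) dn (fst p) todo (snd p) ps). \<exists>g. labelling g bk"
    using "2.hyps"(1)[of "Suc l" f] nl p ps "2.prems"(2) le by auto
  then show ?case using nl(1) p unfolding \<open>p # ps = _\<close>[symmetric] by simp
next
  case (3 dn k)
  then show ?case by (simp add: partial_labelling_def Let_def)
next
  case (4 dn k b bs)
  from partial_labelling_step[OF "4.prems"(1)] obtain r n g where
    st: "length b \<le> c l" "(r, n) \<in> set (forward_choices (c l - length b) (length dn) b bs)"
    "length r + n \<le> k + card {x \<in> A. lev x = Suc l}"
    "partial_labelling g (b # dn) k (r @ replicate n [length dn]) l" by blast
  have ns: "length r + n \<le> k + next_size (profile (Suc l) e)"
  proof (cases "l = e")
    case True
    then have "{x \<in> A. lev x = Suc l} = {}" using "4.prems"(2) by fastforce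
    then have "card {x \<in> A. lev x = Suc l} = 0" by (simp only: card.empty)
    then show ?thesis using st(3) by linarith
  next
    case False
    then show ?thesis using st(3) "4.prems"(3)
      by (simp add: profile_def next_size_def upt_rec[of "Suc l"] del: upt_Suc)
  qed
  have "\<exists>bk\<in>set (layer_search (Suc (length dn)) (b # dn) k (r @ replicate n [length dn]) (c l) (profile (Suc l) e)).
     \<exists>g. labelling g bk"
    using "4.hyps"(1)[OF st(1,2) refl ns, of l g] st(4) "4.prems" by simp
  then obtain bk where bk: "bk \<in> set (layer_search (Suc (length dn)) (b # dn) k (r @ replicate n [length dn]) (c l) (profile (Suc l) e))"
    "\<exists>g. labelling g bk" by blast
  then have "bk \<in> set (layer_search (length dn) dn (Suc k) (b # bs) (c l) (profile (Suc l) e))"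
    using st(1,2) ns by force
  then show ?case using bk(2) by blast
qed

corollary layer_search_labelling:
  assumes "\<And>x. x \<in> A \<Longrightarrow> lev x \<le> e"
  shows "\<exists>bk \<in> set (layer_search 0 [] 1 [[]] (c 0) (profile 1 e)). \<exists>g. labelling g bk"
proof -
  have "{x \<in> A. lev x = 0} = {w}" using root root_unique by blast
  then have "partial_labelling (\<lambda>_. w) [] 1 [[]] 0"
    using root by (auto simp: partial_labelling_def Let_def inj_on_def)
  from layer_search_complete[OF this assms] show ?thesis
    by (simp only: list.size le0 One_nat_def)
qed

end

section \<open>The blocks\<close>

text \<open>A block is placed between two bridges (\<open>Mid\<close>) or at an end of the graph (\<open>End\<close>). Its first
  argument \<open>t\<close> is the excess over the smallest possible one, so that twice the size minus three
  times the length is \<open>t\<close> for \<open>Mid t\<close> and \<open>5 + t\<close> for \<open>End t i\<close>. The vertices incident with the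
  bridges are \<open>0\<close> and the out-port; only \<open>Mid 0\<close>, \<open>Mid 2\<close> and \<open>Mid 3\<close> exist.\<close>

datatype block = Mid nat | End nat nat

text \<open>Entry \<open>t\<close> contains representatives of the results of
  \<open>end_search\<close> for eccentricity \<open>t + 2\<close>. That every result is isomorphic
  to one of them is checked with \<open>end_table\<close>, that they are pairwise non-isomorphic
  with \<open>end_walk_counts\<close>.\<close>

definition end_lists :: "nat list list list list" where
  "end_lists =
  [[[[],[0],[0],[1],[1],[4,3,2],[4,3,2]]],
   [[[],[0],[0],[1],[2,1],[2],[5,3],[5,3],[7,6,4]],
    [[],[0],[0],[1],[1],[2],[4,2],[6,5,3],[5,4,3]],
    [[],[0],[0],[1],[1],[4,2],[3,2],[5,3],[7,6,4]],
    [[],[0],[0],[1],[1],[4,2],[3,2],[4,3],[7,6,5]]],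
   [[[],[0],[0],[2,1],[2,1],[3],[4],[5],[5],[8,7,6],[8,7,6]],
    [[],[0],[0],[1],[2,1],[3,2],[3],[4],[5],[8,7,6],[8,7,6]],
    [[],[0],[0],[1],[2,1],[2],[3],[3],[5,4],[7,6,5],[8,7,6]],
    [[],[0],[0],[1],[2,1],[2],[3],[5,3],[4],[8,6,5],[8,7,6]],
    [[],[0],[0],[1],[2,1],[2],[3],[5,3],[6,4],[8,5],[9,7,6]],
    [[],[0],[0],[1],[1],[2],[4,2],[6,3],[5,3],[5,4],[9,8,7]],
    [[],[0],[0],[1],[1],[2],[4,2],[5,3],[4,3],[6,5],[9,8,7]]],
   [[[],[0],[0],[2,1],[2,1],[3],[5,4],[5],[6],[7],[7],[10,9,8],[10,9,8]],
    [[],[0],[0],[2,1],[2,1],[3],[4],[5],[6,5],[6],[9,7],[9,7],[11,10,8]],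
    [[],[0],[0],[2,1],[2,1],[3],[4],[5],[5],[6],[8,6],[10,9,7],[9,8,7]],
    [[],[0],[0],[2,1],[2,1],[3],[4],[5],[5],[8,6],[7,6],[9,7],[11,10,8]],
    [[],[0],[0],[2,1],[2,1],[3],[4],[5],[5],[8,6],[7,6],[8,7],[11,10,9]],
    [[],[0],[0],[1],[2,1],[3,2],[3],[5,4],[6],[6],[7],[10,9,8],[10,9,8]],
    [[],[0],[0],[1],[2,1],[3,2],[3],[4],[5],[8,6],[7,6],[8,7],[11,10,9]]]]"

fun back_lists :: "block \<Rightarrow> nat list list" where
  "back_lists (Mid t) =
     (if t = 0 then [[], [0], [0], [2,1], [2,1], [4,3]]
      else if t = 2 then [[], [0], [0], [2,1], [2,1], [3], [4], [6,5], [6,5], [8,7]]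
      else [[], [0], [0], [2,1], [2,1], [3], [5,4], [5], [6], [8,7], [8,7], [10,9]])"
| "back_lists (End t i) = end_lists ! t ! i"

fun block_size :: "block \<Rightarrow> nat" where
  "block_size (Mid t) = 6 + 2 * t"
| "block_size (End t i) = 7 + 2 * t"

fun block_len :: "block \<Rightarrow> nat" where
  "block_len (Mid t) = 4 + t"
| "block_len (End t i) = 3 + t"

text \<open>In a middle block the out-port is alone on the last level and so has the largest label.
  An end block has one port only; as it serves as in-port and as out-port, the block can stand at
  either end of a word.\<close>

fun out_port :: "block \<Rightarrow> nat" where
  "out_port (Mid t) = 5 + 2 * t"
| "out_port (End t i) = 0"

definition end_count :: "nat \<Rightarrow> nat" where
  "end_count t = [1, 4, 7, 7] ! t"

definition mid_blocks :: "block list" where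
  "mid_blocks = [Mid 0, Mid 2, Mid 3]"

definition end_blocks :: "block list" where
  "end_blocks = concat (map (\<lambda>t. map (End t) [0..<end_count t]) [0..<4])"

section \<open>Executable checks of the blocks\<close>

definition nbr_lists :: "nat list list \<Rightarrow> nat list list" where
  "nbr_lists bk = map (\<lambda>j. bk ! j @ filter (\<lambda>k. List.member (bk ! k) j) [0..<length bk]) [0..<length bk]"

text \<open>For \<open>x = a\<close>, this shows that the edge \<open>ab\<close> is not a bridge.\<close>

fun detour :: "nat list list \<Rightarrow> nat \<Rightarrow> nat \<Rightarrow> nat \<Rightarrow> nat \<Rightarrow> bool" where
  "detour N a b 0 x \<longleftrightarrow> x = b"
| "detour N a b (Suc k) x \<longleftrightarrow> x = b \<or>
     list_ex (\<lambda>y. \<not> (x = a \<and> y = b) \<and> \<not> (x = b \<and> y = a) \<and> detour N a b k y) (N ! x)"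

text \<open>The back lists are decreasing, as the search prepends neighbours, so
  \<open>last b\<close> is the parent in the breadth-first tree. Later arguments use the step bound
  \<open>heights_ok\<close> and the values at the two ends of a block.\<close>

definition heights :: "nat list list \<Rightarrow> nat list" where
  "heights bk = foldl (\<lambda>h b. h @ [if b = [] then 0 else Suc (h ! last b)]) [] bk"

definition back_lists_ok :: "nat list list \<Rightarrow> bool" where
  "back_lists_ok bk \<longleftrightarrow> list_all (\<lambda>j. list_all (\<lambda>a. a < j) (bk ! j) \<and> (j = 0 \<or> bk ! j \<noteq> []))
     [0..<length bk]"

text \<open>The ports are the vertices whose third edge is a bridge outside the block. With fuel 6,
  the test \<open>detour\<close> asks for a walk of at most 6 steps around the edge; every edge of
  every block has one.\<close>

definition nbrs_ok :: "nat list list \<Rightarrow> nat list \<Rightarrow> bool" where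
  "nbrs_ok N ports \<longleftrightarrow> list_all (\<lambda>j. distinct (N ! j) \<and>
     length (N ! j) = (if List.member ports j then 2 else 3) \<and>
     list_all (\<lambda>x. list_all (\<lambda>y. \<not> List.member (N ! j) y) (N ! x) \<and> detour N j x 6 j) (N ! j))
     [0..<length N]"

definition heights_ok :: "nat list list \<Rightarrow> nat list \<Rightarrow> bool" where
  "heights_ok N h \<longleftrightarrow> length h = length N \<and>
     list_all (\<lambda>j. list_all (\<lambda>x. h ! x \<le> Suc (h ! j)) (N ! j)) [0..<length N]"

lemma mid_blocks_ok:
  "list_all (\<lambda>b. let bk = back_lists b; n = length bk; N = nbr_lists bk; h = heights bk in
     n = block_size b \<and> back_lists_ok bk \<and> nbrs_ok N [0, n - 1] \<and> heights_ok N h \<and>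
     h ! 0 = 0 \<and> Suc (h ! (n - 1)) = block_len b) mid_blocks"
  by code_simp

lemma end_blocks_ok:
  "list_all (\<lambda>b. let bk = back_lists b; n = length bk; N = nbr_lists bk; h = heights bk in
     n = block_size b \<and> back_lists_ok bk \<and> nbrs_ok N [0] \<and> heights_ok N h \<and>
     h ! 0 = 0 \<and> list_ex (\<lambda>x. Suc x = block_len b) h) end_blocks"
  by code_simp

text \<open>Reversing the labels is an automorphism that exchanges the two ports. Hence no mirror
  images of middle blocks are needed when a word is read backwards.\<close>

lemma mid_blocks_symmetric:
  "list_all (\<lambda>b. let bk = back_lists b; n = length bk; N = nbr_lists bk in
     list_all (\<lambda>j. list_all (\<lambda>x. List.member (N ! (n - 1 - j)) (n - 1 - x)) (N ! j)) [0..<n]) mid_blocks"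
  by code_simp

definition walk_step :: "nat list list \<Rightarrow> nat list \<Rightarrow> nat list" where
  "walk_step N v = map (\<lambda>l. sum_list (map ((!) v) l)) N"

text \<open>Each summand is the squared norm of a column of the third power of the adjacency matrix,
  so for a symmetric matrix the total is the trace of its sixth power. This is the executable form
  of \<open>closed_walks\<close>.\<close>

definition closed_walk_count :: "nat list list \<Rightarrow> nat" where
  "closed_walk_count N = sum_list (map (\<lambda>y. sum_list (map (\<lambda>m. m * m)
     (walk_step N (walk_step N (walk_step N (map (\<lambda>x. if x = y then 1 else 0) [0..<length N]))))))
     [0..<length N])"

definition end_walk_counts :: "nat list list" where
  "end_walk_counts = map (\<lambda>t. map (\<lambda>i. closed_walk_count (nbr_lists (back_lists (End t i)))) [0..<end_count t]) [0..<4]"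

lemma end_walk_counts_distinct: "list_all distinct end_walk_counts"
  by code_simp

text \<open>Entries start at 2 because pieces and blocks are searched only up to their first
  singleton level. The last level may be a singleton, so the last entry starts at 1.\<close>

fun size_seqs :: "nat \<Rightarrow> nat \<Rightarrow> nat list list" where
  "size_seqs 0 r = map (\<lambda>m. [m]) [1..<Suc r]"
| "size_seqs (Suc k) r = concat (map (\<lambda>m. map ((#) m) (size_seqs k (r - m))) [2..<Suc r])"

text \<open>Levels 0 and 1 of a piece are its root and the two neighbours of the root. The other \<open>k + 1\<close>
  levels have at most \<open>r\<close> vertices; below, \<open>r\<close> is the largest value allowed by the bound
  \<open>2 * n \<le> 3 * (k + 3) + 8\<close> on the order \<open>n\<close> of a piece, or by the corresponding bound for blocks.\<close>

definition end_search :: "nat \<Rightarrow> nat \<Rightarrow> nat list list list" where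
  "end_search k r = concat (map (\<lambda>ms. layer_search 0 [] 1 [[]] 2 ((2, 3) # map (\<lambda>m. (m, 3)) ms)) (size_seqs k r))"

text \<open>The last level is a single vertex with \<open>c\<close> neighbours in the block: 2 for
  an out-port, 1 for the far end of a bridge that enters this level.\<close>

definition mid_search :: "nat \<Rightarrow> nat \<Rightarrow> nat \<Rightarrow> nat list list list" where
  "mid_search c k r = concat (map (\<lambda>ms. layer_search 0 [] 1 [[]] 2 ((2, 3) # map (\<lambda>m. (m, 3)) (butlast ms) @ [(1, c)]))
     (filter (\<lambda>ms. last ms = 1) (size_seqs k r)))"

definition relabels :: "nat list list \<Rightarrow> nat list list \<Rightarrow> nat list \<Rightarrow> bool" where
  "relabels bk bk' \<sigma> \<longleftrightarrow> length bk = length bk' \<and> length \<sigma> = length bk \<and> distinct \<sigma> \<and>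
     list_all (\<lambda>x. x < length bk) \<sigma> \<and> \<sigma> ! 0 = 0 \<and>
     list_all (\<lambda>a. list_all (\<lambda>b. (List.member (bk ! a) b \<or> List.member (bk ! b) a) =
       (List.member (bk' ! (\<sigma> ! a)) (\<sigma> ! b) \<or> List.member (bk' ! (\<sigma> ! b)) (\<sigma> ! a))) [0..<length bk]) [0..<length bk]"

text \<open>For each result of the search, in order: the index of the end block to which it is isomorphic,
  and the relabelling.\<close>

definition end_table :: "nat \<Rightarrow> (nat \<times> nat list) list" where
  "end_table t = [
   [(0,[0,1,2,3,4,5,6])],
   [(0,[0,1,2,3,4,5,6,7,8]), (0,[0,1,2,4,3,5,8,6,7]), (1,[0,1,2,3,4,5,6,7,8]),
    (1,[0,1,2,3,4,5,6,8,7]), (1,[0,1,2,3,4,6,5,7,8]), (1,[0,1,2,3,4,6,5,8,7]),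
    (1,[0,1,2,4,3,5,6,8,7]), (2,[0,1,2,3,4,5,6,7,8]), (3,[0,1,2,3,4,5,6,7,8]),
    (1,[0,1,2,4,3,6,5,8,7]), (2,[0,1,2,3,4,6,5,7,8]), (3,[0,1,2,3,4,6,5,7,8])],
   [(0,[0,1,2,3,4,5,6,7,8,9,10]), (1,[0,1,2,3,4,5,6,7,8,9,10]), (1,[0,1,2,4,3,5,7,6,8,9,10]),
    (2,[0,1,2,3,4,5,6,7,8,9,10]), (3,[0,1,2,3,4,5,6,7,8,9,10]), (4,[0,1,2,3,4,5,6,7,8,9,10]),
    (3,[0,2,1,5,4,3,9,7,8,6,10]), (3,[0,1,2,3,4,5,7,6,8,9,10]), (4,[0,1,2,3,4,5,7,6,8,9,10]),
    (3,[0,2,1,5,4,3,7,9,8,6,10]), (2,[0,2,1,5,4,3,9,8,6,7,10]), (2,[0,2,1,5,4,3,8,9,6,7,10]),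
    (3,[0,1,2,4,3,5,8,6,7,9,10]), (3,[0,2,1,4,5,3,8,9,7,6,10]), (4,[0,1,2,4,3,5,8,6,7,9,10]),
    (3,[0,1,2,4,3,5,8,7,6,9,10]), (3,[0,2,1,4,5,3,8,7,9,6,10]), (4,[0,1,2,4,3,5,8,7,6,9,10]),
    (2,[0,1,2,4,3,5,8,6,7,9,10]), (2,[0,2,1,4,5,3,8,9,6,7,10]), (5,[0,1,2,3,4,5,6,7,8,9,10]),
    (5,[0,1,2,3,4,5,6,8,7,9,10]), (6,[0,1,2,3,4,5,6,7,8,9,10]), (6,[0,1,2,3,4,5,6,8,7,9,10]),
    (5,[0,1,2,3,4,6,5,8,7,9,10]), (5,[0,1,2,3,4,6,5,7,8,9,10]), (6,[0,1,2,3,4,6,5,7,8,9,10]),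
    (6,[0,1,2,3,4,6,5,8,7,9,10]), (5,[0,1,2,4,3,5,6,9,7,8,10]), (5,[0,1,2,4,3,5,6,9,8,7,10]),
    (6,[0,1,2,4,3,5,6,8,7,9,10]), (5,[0,1,2,4,3,6,5,9,8,7,10]), (5,[0,1,2,4,3,6,5,9,7,8,10]),
    (6,[0,1,2,4,3,6,5,8,7,9,10])],
   [(0,[0,1,2,3,4,5,6,7,8,9,10,11,12]), (1,[0,1,2,3,4,5,6,7,8,9,10,11,12]),
    (1,[0,1,2,3,4,5,6,8,7,9,12,10,11]), (2,[0,1,2,3,4,5,6,7,8,9,10,11,12]),
    (2,[0,1,2,3,4,5,6,7,8,9,10,12,11]), (2,[0,1,2,3,4,5,6,7,8,10,9,11,12]),
    (2,[0,1,2,3,4,5,6,7,8,10,9,12,11]), (2,[0,1,2,3,4,5,6,8,7,9,10,12,11]),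
    (3,[0,1,2,3,4,5,6,7,8,9,10,11,12]), (4,[0,1,2,3,4,5,6,7,8,9,10,11,12]),
    (2,[0,1,2,3,4,5,6,8,7,10,9,12,11]), (3,[0,1,2,3,4,5,6,7,8,10,9,11,12]),
    (4,[0,1,2,3,4,5,6,7,8,10,9,11,12]), (5,[0,1,2,3,4,5,6,7,8,9,10,11,12]),
    (5,[0,2,1,5,4,3,7,6,10,8,9,11,12]), (5,[0,1,2,4,3,5,7,6,10,8,9,11,12]),
    (5,[0,2,1,4,5,3,7,6,10,8,9,11,12]), (6,[0,1,2,3,4,5,6,7,8,9,10,11,12]),
    (6,[0,1,2,3,4,5,6,7,8,10,9,11,12]), (6,[0,1,2,4,3,5,7,6,8,11,10,9,12]),
    (6,[0,1,2,4,3,5,7,6,8,10,11,9,12])]] ! t"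

definition end_search_ok :: "nat \<Rightarrow> nat \<Rightarrow> bool" where
  "end_search_ok t r \<longleftrightarrow> list_all2 (\<lambda>bk (i, \<sigma>). i < end_count t \<and> relabels bk (back_lists (End t i)) \<sigma>)
     (end_search t r) (end_table t)"

lemma end_search_0: "end_search_ok 0 5" by code_simp
lemma end_search_1: "end_search_ok 1 7" by code_simp
lemma end_search_2: "end_search_ok 2 8" by code_simp
lemma end_search_3: "end_search_ok 3 10" by code_simp

lemma end_search_long:
  "end_search 4 11 = []" "end_search 5 13 = []" "end_search 6 14 = []"
  "end_search 7 16 = []" "end_search 8 17 = []" "end_search 9 19 = []"
  by code_simp+

text \<open>The bound is \<open>2 * n \<le> 3 * (k + 3) + 3\<close> with \<open>n = r + 3\<close>:
  excess at most 3 on \<open>k + 3\<close> levels.\<close>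

lemma mid_search_2:
  "mid_search 2 0 3 = []" "mid_search 2 1 4 = [back_lists (Mid 0)]" "mid_search 2 2 6 = []"
  "mid_search 2 3 7 = [back_lists (Mid 2)]" "mid_search 2 4 9 = [back_lists (Mid 3)]"
  by code_simp+

text \<open>The bound is \<open>2 * n \<le> 3 * (k + 2) + 5\<close> with \<open>n = r + 3\<close>,
  as in \<open>no_dead_end\<close>.\<close>

lemma mid_search_1:
  "mid_search 1 0 2 = []" "mid_search 1 1 4 = []" "mid_search 1 2 5 = []" "mid_search 1 3 7 = []"
  by code_simp+

text \<open>There are no pieces of eccentricity 0 or 1, so \<open>end_search\<close> may start with
  eccentricity 2.\<close>

lemma short_search:
  "layer_search 0 [] 1 [[]] 2 [] = []" "layer_search 0 [] 1 [[]] 2 [(2, 3)] = []"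
  by code_simp+

section \<open>Adjacency, ports and heights inside a block\<close>

abbreviation badj :: "block \<Rightarrow> nat \<Rightarrow> nat \<Rightarrow> bool" where
  "badj b \<equiv> bk_adj (back_lists b)"

definition height :: "block \<Rightarrow> nat \<Rightarrow> nat" where
  "height b x = heights (back_lists b) ! x"

lemma bk_adj_sym: "bk_adj bk x y \<longleftrightarrow> bk_adj bk y x"
  by (auto simp: bk_adj_def)

lemma length_nbr_lists [simp]: "length (nbr_lists bk) = length bk"
  by (simp add: nbr_lists_def)

lemma set_nbr_lists:
  assumes "back_lists_ok bk" "x < length bk"
  shows "set (nbr_lists bk ! x) = {y. bk_adj bk x y}"
proof -
  have "a < length bk" if "a \<in> set (bk ! x)" for a
    using assms that by (fastforce simp: back_lists_ok_def list_all_iff)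
  then show ?thesis using assms(2)
    by (auto simp: nbr_lists_def bk_adj_def List.member_iff)
qed

lemma mid_blocks_facts:
  assumes "b \<in> set mid_blocks"
  shows "length (back_lists b) = block_size b" "back_lists_ok (back_lists b)"
    "nbrs_ok (nbr_lists (back_lists b)) [0, block_size b - 1]"
    "heights_ok (nbr_lists (back_lists b)) (heights (back_lists b))"
    "height b 0 = 0" "Suc (height b (block_size b - 1)) = block_len b"
    "Suc (out_port b) = block_size b"
  using mid_blocks_ok assms
  by (auto simp: list_all_iff Let_def height_def mid_blocks_def simp del: back_lists.simps)

lemma end_blocks_facts:
  assumes "b \<in> set end_blocks"
  shows "length (back_lists b) = block_size b" "back_lists_ok (back_lists b)"
    "nbrs_ok (nbr_lists (back_lists b)) [0]"
    "heights_ok (nbr_lists (back_lists b)) (heights (back_lists b))"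
    "height b 0 = 0" "\<exists>x<block_size b. Suc (height b x) = block_len b"
    "out_port b = 0"
proof -
  have *: "length (back_lists b) = block_size b \<and> back_lists_ok (back_lists b) \<and>
    nbrs_ok (nbr_lists (back_lists b)) [0] \<and>
    heights_ok (nbr_lists (back_lists b)) (heights (back_lists b)) \<and>
    heights (back_lists b) ! 0 = 0 \<and> list_ex (\<lambda>x. Suc x = block_len b) (heights (back_lists b))"
    using end_blocks_ok assms unfolding list_all_iff Let_def by blast
  then show "length (back_lists b) = block_size b" "back_lists_ok (back_lists b)"
    "nbrs_ok (nbr_lists (back_lists b)) [0]"
    "heights_ok (nbr_lists (back_lists b)) (heights (back_lists b))"
    "height b 0 = 0"
    by (simp_all add: height_def)
  have "length (heights (back_lists b)) = block_size b" using * by (simp add: heights_ok_def)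
  then show "\<exists>x<block_size b. Suc (height b x) = block_len b"
    using * by (auto simp: list_ex_iff in_set_conv_nth height_def)
  show "out_port b = 0" using assms by (auto simp: end_blocks_def)
qed

definition is_block :: "block \<Rightarrow> bool" where
  "is_block b \<longleftrightarrow> b \<in> set mid_blocks \<or> b \<in> set end_blocks"

lemma is_block_Mid: "is_block (Mid t) \<longleftrightarrow> t \<in> {0, 2, 3}"
  by (auto simp: is_block_def mid_blocks_def end_blocks_def)

lemma is_block_End: "is_block (End t i) \<longleftrightarrow> t < 4 \<and> i < end_count t"
  by (force simp: is_block_def mid_blocks_def end_blocks_def)

lemma block_size_pos [simp]: "0 < block_size b"
  by (cases b) auto

lemma out_port_less [simp]: "out_port b < block_size b"
  by (cases b) auto

context
  fixes b assumes b: "is_block b"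
begin

lemma length_back_lists: "length (back_lists b) = block_size b"
  and back_ok: "back_lists_ok (back_lists b)"
  using b mid_blocks_facts end_blocks_facts by (auto simp: is_block_def)

lemma nbrs_okE:
  assumes "x < block_size b"
  shows "distinct (nbr_lists (back_lists b) ! x)"
    "length (nbr_lists (back_lists b) ! x) = (if x = 0 \<or> x = out_port b then 2 else 3)"
    "\<And>y z. badj b x y \<Longrightarrow> badj b y z \<Longrightarrow> \<not> badj b x z"
    "\<And>y. badj b x y \<Longrightarrow> detour (nbr_lists (back_lists b)) x y 6 x"
proof -
  let ?N = "nbr_lists (back_lists b)"
  \<comment> \<open>For an end block the list \<open>[0]\<close> has this set too, because its
    out-port is \<open>0\<close>.\<close>
  have ok: "\<exists>ports. nbrs_ok ?N ports \<and> set ports = {0, out_port b}"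
    using b mid_blocks_facts(3,7) end_blocks_facts(3,7) unfolding is_block_def
    by (metis Suc_diff_1 block_size_pos diff_Suc_1 empty_set insert_absorb2 list.simps(15))
  then obtain ports where p: "nbrs_ok ?N ports" "set ports = {0, out_port b}" by blast
  have lx: "x < length (back_lists b)" using assms length_back_lists by simp
  have *: "distinct (?N ! x) \<and> length (?N ! x) = (if List.member ports x then 2 else 3) \<and>
     list_all (\<lambda>y. list_all (\<lambda>z. \<not> List.member (?N ! x) z) (?N ! y) \<and> detour ?N x y 6 x) (?N ! x)"
    using p(1) lx unfolding nbrs_ok_def list_all_iff by simp
  show "distinct (?N ! x)" "length (?N ! x) = (if x = 0 \<or> x = out_port b then 2 else 3)"
    using * p(2) by (auto simp: List.member_iff)
  note s = set_nbr_lists[OF back_ok]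
  fix y assume xy: "badj b x y"
  then have ly: "y < length (back_lists b)" by (simp add: bk_adj_def)
  show "detour ?N x y 6 x" using * xy s[OF lx] by (simp add: list_all_iff)
  show "\<not> badj b x z" if "badj b y z" for z
    using * xy that s[OF lx] s[OF ly] by (auto simp: list_all_iff List.member_iff)
qed

lemma badj_less: "badj b x y \<Longrightarrow> x < block_size b \<and> y < block_size b"
  using length_back_lists by (simp add: bk_adj_def)

lemma badj_triangle_free: "badj b x y \<Longrightarrow> badj b y z \<Longrightarrow> \<not> badj b x z"
  using nbrs_okE(3) badj_less by blast

lemma badj_irrefl: "\<not> badj b x x"
  using badj_triangle_free by blast

lemma badj_degree:
  assumes "x < block_size b"
  shows "card {y. badj b x y} = (if x = 0 \<or> x = out_port b then 2 else 3)"
  using nbrs_okE(1,2)[OF assms] set_nbr_lists[OF back_ok, of x] assms length_back_lists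
  by (metis distinct_card)

lemma detour_rtrancl:
  assumes "detour (nbr_lists (back_lists b)) x y k u" "u < block_size b"
  shows "(u, y) \<in> ({(u, v). badj b u v} - {(x, y), (y, x)})\<^sup>*"
  using assms
proof (induction k arbitrary: u)
  case (Suc k)
  show ?case
  proof (cases "u = y")
    case False
    with Suc.prems obtain v where v: "v \<in> set (nbr_lists (back_lists b) ! u)"
      "\<not> (u = x \<and> v = y)" "\<not> (u = y \<and> v = x)" "detour (nbr_lists (back_lists b)) x y k v"
      by (auto simp: list_ex_iff)
    then have uv: "badj b u v" using set_nbr_lists[OF back_ok] Suc.prems(2) length_back_lists by simp
    then have "(v, y) \<in> ({(u, v). badj b u v} - {(x, y), (y, x)})\<^sup>*" using Suc.IH v badj_less by blast
    moreover have "(u, v) \<in> {(u, v). badj b u v} - {(x, y), (y, x)}" using uv v by auto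
    ultimately show ?thesis by (rule converse_rtrancl_into_rtrancl[rotated])
  qed simp
qed simp

text \<open>Blocks contain no bridges; hence the bridges of a word will be exactly the edges between
  its blocks.\<close>

lemma badj_not_bridge:
  assumes "badj b x y"
  shows "(x, y) \<in> ({(u, v). badj b u v} - {(x, y), (y, x)})\<^sup>*"
  using detour_rtrancl[OF nbrs_okE(4)] assms badj_less by blast

lemma badj_connected:
  assumes "x < block_size b"
  shows "(x, 0) \<in> {(u, v). badj b u v}\<^sup>*"
  using assms
proof (induction x rule: less_induct)
  case (less x)
  show ?case
  proof (cases "x = 0")
    case False
    have "\<forall>j<block_size b. (\<forall>a\<in>set (back_lists b ! j). a < j) \<and> (j = 0 \<or> back_lists b ! j \<noteq> [])"
      using back_ok length_back_lists by (simp add: back_lists_ok_def list_all_iff)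
    with False less.prems have "back_lists b ! x \<noteq> []" "\<forall>a\<in>set (back_lists b ! x). a < x"
      by blast+
    then obtain a where a: "a \<in> set (back_lists b ! x)" "a < x" by (metis list.set_intros(1) neq_Nil_conv)
    then have "badj b x a" using less.prems length_back_lists by (auto simp: bk_adj_def)
    then show ?thesis using less.IH[OF a(2)] a(2) less.prems
      by (auto intro: converse_rtrancl_into_rtrancl)
  qed simp
qed

lemma height_0: "height b 0 = 0"
  using b mid_blocks_facts(5) end_blocks_facts(5) by (auto simp: is_block_def)

lemma height_step:
  assumes "badj b x y"
  shows "height b y \<le> Suc (height b x)"
proof -
  have "heights_ok (nbr_lists (back_lists b)) (heights (back_lists b))"
    using b mid_blocks_facts(4) end_blocks_facts(4) by (auto simp: is_block_def)
  moreover have "x < length (back_lists b)" using assms by (simp add: bk_adj_def)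
  ultimately show ?thesis
    using set_nbr_lists[OF back_ok, of x] assms by (simp add: heights_ok_def list_all_iff height_def)
qed

end

text \<open>Crossing a middle block takes \<open>block_len - 1\<close> steps and the bridge behind
  it one more, so each middle block contributes \<open>block_len\<close> to the distance between the
  ends.\<close>

lemma height_out_port:
  assumes "is_block (Mid t)"
  shows "Suc (height (Mid t) (out_port (Mid t))) = block_len (Mid t)"
proof -
  have "Mid t \<in> set mid_blocks" using assms by (auto simp: is_block_Mid mid_blocks_def)
  from mid_blocks_facts(6,7)[OF this] show ?thesis by (metis diff_Suc_1)
qed

lemma height_End:
  assumes "is_block (End t i)"
  shows "\<exists>x<block_size (End t i). Suc (height (End t i) x) = block_len (End t i)"
proof -
  have "End t i \<in> set end_blocks" using assms by (auto simp: is_block_def mid_blocks_def)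
  from end_blocks_facts(6)[OF this] show ?thesis .
qed

text \<open>The relabelling of a block when its word is reversed. A middle block is turned round,
  while an end block has only one port and keeps its labels.\<close>

fun flip :: "block \<Rightarrow> nat \<Rightarrow> nat" where
  "flip (Mid t) x = 5 + 2 * t - x"
| "flip (End t i) x = x"

lemma flip_less: "x < block_size b \<Longrightarrow> flip b x < block_size b"
  by (cases b) auto

lemma flip_flip: "x < block_size b \<Longrightarrow> flip b (flip b x) = x"
  by (cases b) auto

lemma flip_0 [simp]: "flip b 0 = out_port b"
  by (cases b) auto

lemma flip_out_port [simp]: "flip b (out_port b) = 0"
  by (cases b) auto

lemma badj_flip:
  assumes b: "is_block b" and xy: "badj b x y"
  shows "badj b (flip b x) (flip b y)"
proof (cases b)
  case (Mid t)
  then have bm: "b \<in> set mid_blocks" using b by (auto simp: is_block_Mid mid_blocks_def)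
  let ?n = "length (back_lists b)" and ?N = "nbr_lists (back_lists b)"
  have n: "?n = 6 + 2 * t" using length_back_lists[OF b] Mid by simp
  have lx: "x < ?n" using xy by (auto simp: bk_adj_def)
  have "list_all (\<lambda>j. list_all (\<lambda>x. List.member (?N ! (?n - 1 - j)) (?n - 1 - x)) (?N ! j)) [0..<?n]"
    using mid_blocks_symmetric bm unfolding list_all_iff Let_def by blast
  then have "?n - 1 - y \<in> set (?N ! (?n - 1 - x))"
    using lx xy set_nbr_lists[OF back_ok[OF b] lx] by (auto simp: list_all_iff List.member_iff)
  then have "badj b (?n - 1 - x) (?n - 1 - y)"
    using set_nbr_lists[OF back_ok[OF b], of "?n - 1 - x"] lx by auto
  then show ?thesis using n Mid by simp
qed (use xy in simp)

text \<open>The first five back lists of the three middle blocks coincide. The cycle shows that the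
  girth of a word with a middle block is at most 4.\<close>

lemma Mid_four_cycle:
  assumes "is_block (Mid t)"
  shows "badj (Mid t) 1 3" "badj (Mid t) 3 2" "badj (Mid t) 2 4" "badj (Mid t) 4 1"
  using assms by (auto simp: is_block_Mid bk_adj_def nth_Cons' numeral_eq_Suc)

section \<open>Closed walks as an isomorphism invariant\<close>

definition nb_sum :: "('a \<Rightarrow> 'a \<Rightarrow> bool) \<Rightarrow> 'a set \<Rightarrow> ('a \<Rightarrow> nat) \<Rightarrow> 'a \<Rightarrow> nat" where
  "nb_sum R V g x = (\<Sum>z \<in> {z \<in> V. R x z}. g z)"

text \<open>For a symmetric \<open>R\<close>, this is the number of closed walks of length 6.\<close>

definition closed_walks :: "('a \<Rightarrow> 'a \<Rightarrow> bool) \<Rightarrow> 'a set \<Rightarrow> nat" where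
  "closed_walks R V = (\<Sum>y\<in>V. \<Sum>x\<in>V. (nb_sum R V (nb_sum R V (nb_sum R V (\<lambda>z. of_bool (z = y)))) x)\<^sup>2)"

lemma nb_sum_iso:
  assumes f: "bij_betw f V V'" and R: "\<And>x y. x \<in> V \<Longrightarrow> y \<in> V \<Longrightarrow> R' (f x) (f y) = R x y"
    and g: "\<And>x. x \<in> V \<Longrightarrow> g' (f x) = g x" and x: "x \<in> V"
  shows "nb_sum R' V' g' (f x) = nb_sum R V g x"
proof -
  have "bij_betw f {z \<in> V. R x z} {z \<in> V'. R' (f x) z}"
    using f x R unfolding bij_betw_def by (auto intro: inj_on_subset)
  then have "nb_sum R' V' g' (f x) = (\<Sum>z \<in> {z \<in> V. R x z}. g' (f z))"
    unfolding nb_sum_def by (rule sum.reindex_bij_betw[symmetric])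
  also have "\<dots> = nb_sum R V g x" unfolding nb_sum_def by (rule sum.cong) (auto simp: g)
  finally show ?thesis .
qed

lemma closed_walks_iso:
  assumes f: "bij_betw f V V'" and R: "\<And>x y. x \<in> V \<Longrightarrow> y \<in> V \<Longrightarrow> R' (f x) (f y) = R x y"
  shows "closed_walks R' V' = closed_walks R V"
proof -
  let ?W = "\<lambda>R V y. nb_sum R V (nb_sum R V (nb_sum R V (\<lambda>z. of_bool (z = y))))"
  have W: "?W R' V' (f y) (f x) = ?W R V y x" if "x \<in> V" "y \<in> V" for x y
    using that by (intro nb_sum_iso[where R = R and R' = R' and f = f, OF f R]) (use f in \<open>auto simp: bij_betw_def inj_on_eq_iff\<close>)
  have "closed_walks R' V' = (\<Sum>y\<in>V. \<Sum>x\<in>V'. (?W R' V' (f y) x)\<^sup>2)"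
    unfolding closed_walks_def by (rule sum.reindex_bij_betw[OF f, symmetric])
  also have "\<dots> = (\<Sum>y\<in>V. \<Sum>x\<in>V. (?W R' V' (f y) (f x))\<^sup>2)"
    by (rule sum.cong[OF refl], rule sum.reindex_bij_betw[OF f, symmetric])
  also have "\<dots> = closed_walks R V"
    unfolding closed_walks_def by (intro sum.cong refl) (simp add: W)
  finally show ?thesis .
qed

lemma walk_step_nth:
  assumes b: "is_block b" and x: "x < block_size b"
    and v: "\<And>z. z < block_size b \<Longrightarrow> v ! z = g z"
  shows "walk_step (nbr_lists (back_lists b)) v ! x = nb_sum (badj b) {..<block_size b} g x"
proof -
  let ?N = "nbr_lists (back_lists b)"
  have lx: "x < length (back_lists b)" using x length_back_lists[OF b] by simp
  have s: "{z \<in> {..<block_size b}. badj b x z} = set (?N ! x)"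
    using set_nbr_lists[OF back_ok[OF b] lx] badj_less[OF b] by auto
  have "nb_sum (badj b) {..<block_size b} g x = sum_list (map g (?N ! x))"
    unfolding nb_sum_def s by (rule sum_list_distinct_conv_sum_set[symmetric, OF nbrs_okE(1)[OF b x]])
  also have "map g (?N ! x) = map ((!) v) (?N ! x)"
    using v set_nbr_lists[OF back_ok[OF b] lx] badj_less[OF b] by (intro map_cong refl) auto
  finally show ?thesis using lx by (simp add: walk_step_def)
qed

lemma closed_walk_count:
  assumes b: "is_block b"
  shows "closed_walk_count (nbr_lists (back_lists b)) = closed_walks (badj b) {..<block_size b}"
proof -
  let ?N = "nbr_lists (back_lists b)" and ?n = "block_size b"
  have n: "length ?N = ?n" using length_back_lists[OF b] by simp
  let ?v = "\<lambda>y. map (\<lambda>x. if x = y then 1 else 0) [0..<?n] :: nat list"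
  let ?g = "\<lambda>y z. of_bool (z = y) :: nat"
  let ?S = "nb_sum (badj b) {..<?n}"
  have lw: "length (walk_step ?N v) = ?n" for v using n by (simp add: walk_step_def)
  have W: "map (\<lambda>m. m * m) (walk_step ?N (walk_step ?N (walk_step ?N (?v y))))
      = map (\<lambda>x. (?S (?S (?S (?g y))) x)\<^sup>2) [0..<?n]" for y
  proof (rule nth_equalityI)
    fix x assume "x < length (map (\<lambda>m. m * m) (walk_step ?N (walk_step ?N (walk_step ?N (?v y)))))"
    then have x: "x < ?n" by (simp add: lw)
    have "walk_step ?N (walk_step ?N (walk_step ?N (?v y))) ! x = ?S (?S (?S (?g y))) x"
      by (intro walk_step_nth[OF b] x) auto
    then show "map (\<lambda>m. m * m) (walk_step ?N (walk_step ?N (walk_step ?N (?v y)))) ! x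
        = map (\<lambda>x. (?S (?S (?S (?g y))) x)\<^sup>2) [0..<?n] ! x"
      using x by (simp add: lw power2_eq_square)
  qed (simp add: lw)
  show ?thesis
    unfolding closed_walk_count_def n W closed_walks_def
    by (simp only: interv_sum_list_conv_sum_set_nat set_upt atLeast0LessThan)
qed

text \<open>The parity of the size tells middle blocks from end blocks, and the size gives
  \<open>t\<close>. End blocks of equal size differ in their numbers of closed walks of length
  6.\<close>

lemma block_iso_eq:
  assumes b: "is_block b" and b': "is_block b'"
    and f: "bij_betw f {..<block_size b} {..<block_size b'}"
    and R: "\<And>x y. x < block_size b \<Longrightarrow> y < block_size b \<Longrightarrow> badj b' (f x) (f y) = badj b x y"
  shows "b = b'"
proof -
  have sz: "block_size b = block_size b'" using bij_betw_same_card[OF f] by simp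
  show ?thesis
  proof (cases b)
    case (Mid t)
    then obtain t' where t': "b' = Mid t'" using sz by (cases b') (simp_all, presburger)
    then show ?thesis using sz Mid by simp
  next
    case (End t i)
    then obtain i' where i': "b' = End t i'" using sz by (cases b') (simp_all, presburger)
    have "closed_walk_count (nbr_lists (back_lists b')) = closed_walk_count (nbr_lists (back_lists b))"
      unfolding closed_walk_count[OF b] closed_walk_count[OF b']
      by (rule closed_walks_iso[OF f]) (simp add: R)
    moreover have t: "t < 4" "i < end_count t" "i' < end_count t"
      using b b' End i' by (auto simp: is_block_End)
    moreover have "distinct (end_walk_counts ! t)"
      using end_walk_counts_distinct t(1) by (simp add: list_all_length end_walk_counts_def)
    ultimately have "i = i'"
      using End i' by (auto simp: end_walk_counts_def distinct_conv_nth)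
    then show ?thesis using End i' by simp
  qed
qed

section \<open>Classification of the blocks of small excess\<close>

lemma size_seqs_complete:
  assumes "length ms = Suc k" "\<And>i. i < k \<Longrightarrow> 2 \<le> ms ! i" "1 \<le> ms ! k" "sum_list ms \<le> r"
  shows "ms \<in> set (size_seqs k r)"
  using assms
proof (induction k arbitrary: ms r)
  case 0
  then obtain m where "ms = [m]" by (auto simp: length_Suc_conv)
  with 0 show ?case by auto
next
  case (Suc k)
  then obtain m ms' where ms: "ms = m # ms'" "length ms' = Suc k" by (auto simp: length_Suc_conv)
  have "ms' \<in> set (size_seqs k (r - m))"
  proof (rule Suc.IH[OF ms(2)])
    show "2 \<le> ms' ! i" if "i < k" for i using Suc.prems(2)[of "Suc i"] that ms by simp
    show "1 \<le> ms' ! k" using Suc.prems(3) ms by simp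
    show "sum_list ms' \<le> r - m" using Suc.prems(4) ms by simp
  qed
  moreover have "2 \<le> m" "m \<le> r" using Suc.prems(2)[of 0] Suc.prems(4) ms by auto
  ultimately show ?case unfolding ms by force
qed

lemma sum_list_map_upt_Suc: "sum_list (map f [a..<b]) = (\<Sum>j\<in>{a..<b}. f j :: nat)"
  by (simp add: interv_sum_list_conv_sum_set_nat)

definition labels :: "('v \<times> 'v) set \<Rightarrow> 'v set \<Rightarrow> 'v \<Rightarrow> block \<Rightarrow> (nat \<Rightarrow> 'v) \<Rightarrow> bool" where
  "labels E A w b g \<longleftrightarrow> bij_betw g {..<block_size b} A \<and> g 0 = w \<and>
     (\<forall>x<block_size b. \<forall>y<block_size b. (g x, g y) \<in> E \<longleftrightarrow> badj b x y)"

context layered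
begin

abbreviation level_size :: "nat \<Rightarrow> nat" where
  "level_size l \<equiv> card {x \<in> A. lev x = l}"

lemma level_size_0: "level_size 0 = 1"
proof -
  have "{x \<in> A. lev x = 0} = {w}" using root root_unique by blast
  then show ?thesis by simp
qed

lemma level_size_1: "level_size 1 = c 0"
proof -
  have "{x \<in> A. lev x = 1} = {y \<in> A. (w, y) \<in> E}"
  proof (intro equalityI subsetI)
    fix x assume "x \<in> {x \<in> A. lev x = 1}"
    then show "x \<in> {y \<in> A. (w, y) \<in> E}" using parent[of x 0] root_unique by auto
  next
    fix x assume x: "x \<in> {y \<in> A. (w, y) \<in> E}"
    then have "lev x \<noteq> 0" using root_unique[of x] adj_irrefl by auto
    moreover have "lev x \<le> 1" using lev_step[OF root(1), of x] x root by simp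
    ultimately show "x \<in> {x \<in> A. lev x = 1}" using x by simp
  qed
  then show ?thesis using deg[OF root(1)] root(2) by simp
qed

lemma card_levels:
  assumes "\<And>x. x \<in> A \<Longrightarrow> lev x \<le> e"
  shows "card A = (\<Sum>l\<in>{0..<Suc e}. level_size l)"
proof -
  have "A = (\<Union>l\<in>{0..<Suc e}. {x \<in> A. lev x = l})" using assms by auto (metis le_imp_less_Suc)
  then have "card A = card (\<Union>l\<in>{0..<Suc e}. {x \<in> A. lev x = l})" by simp
  also have "\<dots> = (\<Sum>l\<in>{0..<Suc e}. level_size l)"
    by (rule card_UN_disjoint) (use fin in auto)
  finally show ?thesis .
qed

lemma card_levels_2:
  assumes "\<And>x. x \<in> A \<Longrightarrow> lev x \<le> e" "2 \<le> e" "c 0 = 2"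
  shows "card A = 3 + (\<Sum>l\<in>{2..<Suc e}. level_size l)"
proof -
  have "{0..<Suc e} = {0, 1} \<union> {2..<Suc e}" using assms(2) by auto
  then have "(\<Sum>l\<in>{0..<Suc e}. level_size l) = (\<Sum>l\<in>{0, 1}. level_size l) + (\<Sum>l\<in>{2..<Suc e}. level_size l)"
    by (simp add: sum.union_disjoint[of "{0, 1}"])
  then show ?thesis using card_levels[OF assms(1)] level_size_0 level_size_1 assms(3) by simp
qed

lemma level_size_pos:
  assumes "x \<in> A" "l \<le> lev x"
  shows "1 \<le> level_size l"
proof -
  have "\<exists>y\<in>A. lev y = l"
    using assms
  proof (induction "lev x" arbitrary: x)
    case (Suc k)
    from parent[OF Suc.prems(1) Suc.hyps(2)[symmetric]] obtain y where "y \<in> A" "lev y = k" by blast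
    then show ?case using Suc by (cases "l = lev x") auto
  qed auto
  then have "{x \<in> A. lev x = l} \<noteq> {}" by blast
  then show ?thesis using fin by (simp add: Suc_le_eq card_gt_0_iff)
qed

lemma labelling_relabels:
  assumes g: "labelling g bk" and r: "relabels bk (back_lists b) \<sigma>" and b: "is_block b"
  shows "\<exists>h. labels E A w b h"
proof -
  let ?n = "block_size b"
  have n: "length bk = ?n" "length \<sigma> = ?n" "distinct \<sigma>" "set \<sigma> \<subseteq> {..<?n}" "\<sigma> ! 0 = 0"
    using r length_back_lists[OF b] by (auto simp: relabels_def list_all_iff)
  have bij: "bij_betw ((!) \<sigma>) {..<?n} {..<?n}"
  proof -
    have "bij_betw ((!) \<sigma>) {..<?n} (set \<sigma>)" using bij_betw_nth[OF n(3), of "{..<?n}" "set \<sigma>"] n by simp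
    moreover have "set \<sigma> = {..<?n}"
      using n by (intro card_subset_eq) (auto simp: distinct_card)
    ultimately show ?thesis by simp
  qed
  have adj: "bk_adj bk x y \<longleftrightarrow> badj b (\<sigma> ! x) (\<sigma> ! y)" if "x < ?n" "y < ?n" for x y
  proof -
    have "\<sigma> ! x < ?n" "\<sigma> ! y < ?n" using bij that by (auto simp: bij_betw_def)
    moreover have "(y \<in> set (bk ! x) \<or> x \<in> set (bk ! y)) =
       (\<sigma> ! y \<in> set (back_lists b ! (\<sigma> ! x)) \<or> \<sigma> ! x \<in> set (back_lists b ! (\<sigma> ! y)))"
      using r that n(1) by (simp add: relabels_def list_all_iff List.member_iff)
    ultimately show ?thesis using that n(1) length_back_lists[OF b] by (auto simp: bk_adj_def)
  qed
  define \<tau> where "\<tau> = inv_into {..<?n} ((!) \<sigma>)"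
  have bt: "bij_betw \<tau> {..<?n} {..<?n}" unfolding \<tau>_def by (rule bij_betw_inv_into[OF bij])
  have st: "\<sigma> ! \<tau> x = x" if "x < ?n" for x
    using bij_betw_inv_into_right[OF bij, of x] that by (simp add: \<tau>_def)
  have t0: "\<tau> 0 = 0" using bij_betw_inv_into_left[OF bij, of 0] n(5) by (simp add: \<tau>_def)
  have tl: "\<tau> x < ?n" if "x < ?n" for x using bt that by (auto simp: bij_betw_def)
  have "labels E A w b (g \<circ> \<tau>)"
    unfolding labels_def
  proof (intro conjI allI impI)
    show "bij_betw (g \<circ> \<tau>) {..<?n} A" using bt g n(1) bij_betw_trans by (auto simp: labelling_def)
    show "(g \<circ> \<tau>) 0 = w" using g t0 by (simp add: labelling_def)
    fix x y assume "x < ?n" "y < ?n"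
    then show "((g \<circ> \<tau>) x, (g \<circ> \<tau>) y) \<in> E \<longleftrightarrow> badj b x y"
      using g adj[of "\<tau> x" "\<tau> y"] st tl n(1) by (simp add: labelling_def)
  qed
  then show ?thesis by blast
qed

lemma profile_from_1:
  assumes "2 \<le> e" "c 0 = 2" "c 1 = 3"
  shows "profile 1 e = (2, 3) # map (\<lambda>l. (level_size l, c l)) [2..<Suc e]"
proof -
  have "[1..<Suc e] = 1 # [2..<Suc e]" using assms(1) by (simp add: upt_conv_Cons numeral_2_eq_2)
  then show ?thesis using assms level_size_1 by (simp add: profile_def del: upt_Suc)
qed

definition tail_sizes :: "nat \<Rightarrow> nat list" where
  "tail_sizes e = map level_size [2..<Suc e]"

lemma tail_sizes:
  assumes le: "\<And>x. x \<in> A \<Longrightarrow> lev x \<le> e" and e: "e = k + 2" and c0: "c 0 = 2"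
  shows "length (tail_sizes e) = Suc k" "\<And>i. i \<le> k \<Longrightarrow> tail_sizes e ! i = level_size (i + 2)"
    "card A = 3 + sum_list (tail_sizes e)"
proof -
  show "length (tail_sizes e) = Suc k" by (simp add: tail_sizes_def e del: upt_Suc)
  show "tail_sizes e ! i = level_size (i + 2)" if "i \<le> k" for i
  proof -
    have i: "2 + i < Suc e" using that e by simp
    have "tail_sizes e ! i = level_size ([2..<Suc e] ! i)"
      unfolding tail_sizes_def by (rule nth_map) (use i in simp)
    then show ?thesis by (simp only: nth_upt[OF i] add.commute)
  qed
  show "card A = 3 + sum_list (tail_sizes e)"
    unfolding tail_sizes_def sum_list_map_upt_Suc by (rule card_levels_2[OF le _ c0]) (use e in auto)
qed

text \<open>Without singleton levels between the root and the last level, the eccentricity is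
  bounded: with \<open>k = e - 2\<close>, the sizes of the levels from 2 on have a sum of at least
  \<open>2 * k + 1\<close>, while \<open>small\<close> allows at most half of
  \<open>3 * k + 11\<close>. Hence \<open>k < 10\<close>, and these ten cases have been
  searched.\<close>

lemma classify_end:
  assumes c: "c = (\<lambda>l. if l = 0 then 2 else 3)"
    and le: "\<And>x. x \<in> A \<Longrightarrow> lev x \<le> e" and ex: "\<exists>x\<in>A. lev x = e"
    and two: "\<And>l. 1 \<le> l \<Longrightarrow> l < e \<Longrightarrow> 2 \<le> level_size l"
    and small: "2 * card A \<le> 3 * (e + 1) + 8"
  shows "\<exists>t i g. t < 4 \<and> i < end_count t \<and> e = t + 2 \<and> labels E A w (End t i) g"
proof -
  have c0: "c 0 = 2" "c 1 = 3" using c by auto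
  obtain bk g where bk: "bk \<in> set (layer_search 0 [] 1 [[]] 2 (profile 1 e))" "labelling g bk"
    using layer_search_labelling[OF le] c0 by auto
  have e2: "2 \<le> e"
  proof (rule ccontr)
    assume "\<not> 2 \<le> e"
    then have "e = 0 \<or> e = 1" by linarith
    then have "profile 1 e = [] \<or> profile 1 e = [(2, 3)]"
      using level_size_1 c0 by (auto simp: profile_def)
    then show False using bk(1) short_search by (metis empty_iff empty_set)
  qed
  define k where "k = e - 2"
  have ek: "e = k + 2" using e2 by (simp add: k_def)
  define ms where "ms = tail_sizes e"
  have prof: "profile 1 e = (2, 3) # map (\<lambda>m. (m, 3)) ms"
    unfolding profile_from_1[OF e2 c0] using c by (auto simp: ms_def tail_sizes_def)
  note ts = tail_sizes[OF le ek c0(1), folded ms_def]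
  note lm = ts(1) and nth = ts(2) and sum = ts(3)
  have ge2: "2 \<le> ms ! i" if "i < k" for i using that two[of "i + 2"] nth[of i] ek by simp
  have ge1: "1 \<le> ms ! k" using ex nth[of k] level_size_pos[of _ e] ek by auto
  have mem: "bk \<in> set (end_search k r)" if "sum_list ms \<le> r" for r
    using size_seqs_complete[OF lm ge2 ge1 that] bk(1) prof by (auto simp: end_search_def)
  have sl: "2 * (3 + sum_list ms) \<le> 3 * k + 17" using small sum ek by simp
  have "2 * k + 1 \<le> sum_list ms"
  proof -
    have "(\<Sum>l\<in>{2..<e}. 2) \<le> (\<Sum>l\<in>{2..<e}. level_size l)" by (rule sum_mono) (use two in auto)
    moreover have "(\<Sum>l\<in>{2..<Suc e}. level_size l) = (\<Sum>l\<in>{2..<e}. level_size l) + level_size e"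
      using e2 by simp
    ultimately show ?thesis using ge1 nth[of k] ek unfolding ms_def tail_sizes_def sum_list_map_upt_Suc by simp
  qed
  moreover have "2 * sum_list ms \<le> 3 * k + 11" using sl by simp
  ultimately have "k < 10" by linarith
  then consider "k < 4" | "k \<in> {4, 5, 6, 7, 8, 9}" by fastforce
  then show ?thesis
  proof cases
    case 2
    then have False using mem[of 11] mem[of 13] mem[of 14] mem[of 16] mem[of 17] mem[of 19] sl end_search_long
      by auto
    then show ?thesis ..
  next
    case 1
    then consider "k = 0" | "k = 1" | "k = 2" | "k = 3" by linarith
    then have "\<exists>r. end_search_ok k r \<and> sum_list ms \<le> r"
    proof cases
      case 1
      then show ?thesis using end_search_0 sl by (intro exI[of _ 5]) simp
    next
      case 2
      then show ?thesis using end_search_1 sl by (intro exI[of _ 7]) simp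
    next
      case 3
      then show ?thesis using end_search_2 sl by (intro exI[of _ 8]) simp
    next
      case 4
      then show ?thesis using end_search_3 sl by (intro exI[of _ 10]) simp
    qed
    then obtain r where "end_search_ok k r" "bk \<in> set (end_search k r)" using mem by blast
    then obtain i \<sigma> where i: "i < end_count k" "relabels bk (back_lists (End k i)) \<sigma>"
      unfolding end_search_ok_def by (auto simp: list_all2_conv_all_nth in_set_conv_nth split: prod.splits)
         (metis old.prod.exhaust)
    then have "\<exists>h. labels E A w (End k i) h"
      using labelling_relabels[OF bk(2)] 1 by (simp add: is_block_End)
    then show ?thesis using 1 i ek by blast
  qed
qed

text \<open>Common preparation for both values of \<open>q\<close>. The second claim bounds the
  eccentricity; it counts 1 + 2 vertices on the first two levels, at least two on each of the
  \<open>e - 2\<close> next ones, and one on the last.\<close>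

lemma mid_search_mem:
  assumes c: "c = (\<lambda>l. if l = 0 then 2 else if l = e then q else 3)" and e2: "2 \<le> e"
    and le: "\<And>x. x \<in> A \<Longrightarrow> lev x \<le> e" and last: "level_size e = 1"
    and two: "\<And>l. 1 \<le> l \<Longrightarrow> l < e \<Longrightarrow> 2 \<le> level_size l"
    and card: "card A \<le> r + 3"
  shows "\<exists>bk \<in> set (mid_search q (e - 2) r). \<exists>g. labelling g bk"
    and "2 * e \<le> card A"
proof -
  have c0: "c 0 = 2" "c 1 = 3" using c e2 by auto
  define k where "k = e - 2"
  have ek: "e = k + 2" using e2 by (simp add: k_def)
  define ms where "ms = tail_sizes e"
  have ms: "ms = map level_size [2..<e] @ [1]" using last e2 by (simp add: ms_def tail_sizes_def)
  have prof: "profile 1 e = (2, 3) # map (\<lambda>m. (m, 3)) (butlast ms) @ [(1, q)]"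
    unfolding profile_from_1[OF e2 c0] using c e2 last by (auto simp: ms)
  note ts = tail_sizes[OF le ek c0(1), folded ms_def]
  note lm = ts(1) and nth = ts(2) and sum = ts(3)
  have "ms \<in> set (size_seqs k r)"
    by (rule size_seqs_complete[OF lm]) (use nth two ek last sum card in auto)
  moreover have "last ms = 1" by (simp add: ms)
  moreover obtain bk where bk: "bk \<in> set (layer_search 0 [] 1 [[]] 2 (profile 1 e))" "\<exists>g. labelling g bk"
    using layer_search_labelling[OF le] c0 by auto
  ultimately show "\<exists>bk \<in> set (mid_search q (e - 2) r). \<exists>g. labelling g bk"
    unfolding mid_search_def k_def[symmetric] using prof by auto
  have "(\<Sum>l\<in>{2..<e}. 2) \<le> (\<Sum>l\<in>{2..<e}. level_size l)" by (rule sum_mono) (use two in auto)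
  then have "2 * (e - 2) \<le> (\<Sum>l\<in>{2..<e}. level_size l)" by simp
  moreover have "sum_list ms = (\<Sum>l\<in>{2..<e}. level_size l) + 1"
    unfolding ms by (simp only: sum_list_append sum_list_map_upt_Suc sum_list.Cons sum_list.Nil add_0_right)
  ultimately show "2 * e \<le> card A" using sum e2 by simp
qed

text \<open>The bounds \<open>2 * e \<le> card A\<close> and \<open>small\<close> give
  \<open>e \<le> 6\<close>. Excess 3 is what an end of excess at least 5 leaves to a block in a
  piece of excess at most 8.\<close>

lemma classify_mid:
  assumes c: "c = (\<lambda>l. if l = 0 then 2 else if l = e then 2 else 3)" and e2: "2 \<le> e"
    and le: "\<And>x. x \<in> A \<Longrightarrow> lev x \<le> e" and last: "{x \<in> A. lev x = e} = {q}"
    and two: "\<And>l. 1 \<le> l \<Longrightarrow> l < e \<Longrightarrow> 2 \<le> level_size l"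
    and small: "2 * card A \<le> 3 * (e + 1) + 3"
  shows "\<exists>t g. t \<in> {0, 2, 3} \<and> e = t + 3 \<and> labels E A w (Mid t) g \<and> g (out_port (Mid t)) = q"
proof -
  have last': "level_size e = 1" using last by simp
  have mem: "\<exists>bk \<in> set (mid_search 2 (e - 2) r). \<exists>g. labelling g bk" if "card A \<le> r + 3" for r
    by (rule mid_search_mem(1)[OF c e2 le last' two that])
  have "2 * e \<le> card A" by (rule mid_search_mem(2)[OF c e2 le last' two, of "card A"]) auto
  moreover have "2 * card A \<le> 3 * e + 6" using small by simp
  ultimately have e6: "e \<le> 6" by linarith
  have "\<exists>t bk g. t \<in> {0, 2, 3} \<and> e = t + 3 \<and> bk = back_lists (Mid t) \<and> labelling g bk"
  proof -
    consider "e = 2" | "e = 3" | "e = 4" | "e = 5" | "e = 6" using e2 e6 by linarith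
    then show ?thesis
    proof cases
      case 1
      then show ?thesis using mem[of 3] small mid_search_2(1) by simp
    next
      case 2
      then show ?thesis using mem[of 4] small mid_search_2(2) by (intro exI[of _ 0]) auto
    next
      case 3
      then show ?thesis using mem[of 6] small mid_search_2(3) by simp
    next
      case 4
      then show ?thesis using mem[of 7] small mid_search_2(4) by (intro exI[of _ 2]) auto
    next
      case 5
      then show ?thesis using mem[of 9] small mid_search_2(5) by (intro exI[of _ 3]) auto
    qed
  qed
  then obtain t g where t: "t \<in> {0, 2, 3}" "e = t + 3" and g: "labelling g (back_lists (Mid t))" by blast
  have b: "is_block (Mid t)" using t by (simp add: is_block_Mid)
  note n = length_back_lists[OF b]
  have L: "labels E A w (Mid t) g" using g n by (auto simp: labels_def labelling_def)
  have "q \<in> A" "lev q = e" using last by auto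
  then obtain y where y: "y < block_size (Mid t)" "g y = q"
    using L by (auto simp: labels_def bij_betw_def)
  \<comment> \<open>Labels increase with the level, so the largest label lies on the last level,
    which contains only \<open>q\<close>.\<close>
  have "lev (g y) \<le> lev (g (out_port (Mid t)))" using g n y by (auto simp: labelling_def)
  moreover have gA: "g (out_port (Mid t)) \<in> A" using L out_port_less by (auto simp: labels_def bij_betw_def)
  ultimately have "lev (g (out_port (Mid t))) = e" using le y \<open>lev q = e\<close> by (metis le_antisym)
  then have "g (out_port (Mid t)) = q" using gA last by blast
  then show ?thesis using t L by blast
qed

text \<open>The vertex on level \<open>e\<close> hangs on a bridge. Without it a block with
  \<open>e\<close> levels is left, and the claim is that its excess is at least 4. Together with an
  end of excess at least 5 this exceeds 8.\<close>

lemma no_dead_end: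
  assumes c: "c = (\<lambda>l. if l = 0 then 2 else if l = e then 1 else 3)" and e2: "2 \<le> e"
    and le: "\<And>x. x \<in> A \<Longrightarrow> lev x \<le> e" and last: "level_size e = 1"
    and two: "\<And>l. 1 \<le> l \<Longrightarrow> l < e \<Longrightarrow> 2 \<le> level_size l"
    and small: "2 * card A \<le> 3 * e + 5"
  shows False
proof -
  have mem: "\<exists>bk \<in> set (mid_search 1 (e - 2) r). \<exists>g. labelling g bk" if "card A \<le> r + 3" for r
    by (rule mid_search_mem(1)[OF c e2 le last two that])
  have "2 * e \<le> card A" by (rule mid_search_mem(2)[OF c e2 le last two, of "card A"]) auto
  with small have "e \<le> 5" by linarith
  then consider "e = 2" | "e = 3" | "e = 4" | "e = 5" using e2 by linarith
  then show False
    by cases (use mem[of 2] mem[of 4] mem[of 5] mem[of 7] small mid_search_1 in auto)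
qed

end

section \<open>Words of blocks\<close>

definition word_verts :: "block list \<Rightarrow> (nat \<times> nat) set" where
  "word_verts bs = {(i, x). i < length bs \<and> x < block_size (bs ! i)}"

definition chain_edge :: "block list \<Rightarrow> nat \<times> nat \<Rightarrow> nat \<times> nat \<Rightarrow> bool" where
  "chain_edge bs p q \<longleftrightarrow> fst q = Suc (fst p) \<and> snd p = out_port (bs ! fst p) \<and> snd q = 0"

definition word_adj :: "block list \<Rightarrow> nat \<times> nat \<Rightarrow> nat \<times> nat \<Rightarrow> bool" where
  "word_adj bs p q \<longleftrightarrow> p \<in> word_verts bs \<and> q \<in> word_verts bs \<and>
     (fst p = fst q \<and> badj (bs ! fst p) (snd p) (snd q) \<or> chain_edge bs p q \<or> chain_edge bs q p)"

definition word_iso :: "('v \<times> 'v) set \<Rightarrow> 'v set \<Rightarrow> block list \<Rightarrow> (nat \<times> nat \<Rightarrow> 'v) \<Rightarrow> bool" where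
  "word_iso E A bs f \<longleftrightarrow> bij_betw f (word_verts bs) A \<and>
     (\<forall>p\<in>word_verts bs. \<forall>q\<in>word_verts bs. (f p, f q) \<in> E \<longleftrightarrow> word_adj bs p q)"

definition word_size :: "block list \<Rightarrow> nat" where
  "word_size bs = sum_list (map block_size bs)"

definition word_len :: "block list \<Rightarrow> nat" where
  "word_len bs = sum_list (map block_len bs)"

lemma word_verts_Sigma: "word_verts bs = (SIGMA i:{..<length bs}. {..<block_size (bs ! i)})"
  by (auto simp: word_verts_def)

lemma finite_word_verts [simp]: "finite (word_verts bs)"
  by (simp add: word_verts_Sigma)

lemma card_word_verts: "card (word_verts bs) = word_size bs"
  by (simp add: word_verts_Sigma word_size_def sum_list_sum_nth atLeast0LessThan)

lemma word_iso_card: "word_iso E A bs f \<Longrightarrow> card A = word_size bs"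
  using card_word_verts bij_betw_same_card by (fastforce simp: word_iso_def)

lemma word_adj_sym: "word_adj bs p q \<longleftrightarrow> word_adj bs q p"
  by (auto simp: word_adj_def bk_adj_sym)

lemma word_iso_single:
  assumes "labels E A w b g"
  shows "word_iso E A [b] (\<lambda>p. g (snd p))"
proof -
  have "bij_betw snd (word_verts [b]) {..<block_size b}"
    by (rule bij_betwI[where g = "\<lambda>x. (0, x)"]) (auto simp: word_verts_def)
  then have "bij_betw (g \<circ> snd) (word_verts [b]) A"
    by (rule bij_betw_trans) (use assms in \<open>simp add: labels_def\<close>)
  moreover have "(g (snd p), g (snd q)) \<in> E \<longleftrightarrow> word_adj [b] p q"
    if "p \<in> word_verts [b]" "q \<in> word_verts [b]" for p q
    using that assms by (auto simp: word_adj_def labels_def word_verts_def chain_edge_def)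
  ultimately show ?thesis by (simp add: word_iso_def comp_def)
qed

text \<open>Used twice: to put the first block of a piece in front of the word of the rest, and to
  join the two pieces of a graph.\<close>

lemma word_iso_join:
  assumes f: "word_iso E A bs f" and g: "word_iso E B cs g"
    and disj: "A \<inter> B = {}" and ne: "bs \<noteq> []" "cs \<noteq> []" and sym: "\<And>x y. (x, y) \<in> E \<Longrightarrow> (y, x) \<in> E"
    and cross: "\<And>a b. a \<in> A \<Longrightarrow> b \<in> B \<Longrightarrow>
      (a, b) \<in> E \<longleftrightarrow> a = f (length bs - 1, out_port (last bs)) \<and> b = g (0, 0)"
  shows "word_iso E (A \<union> B) (bs @ cs)
    (\<lambda>(i, x). if i < length bs then f (i, x) else g (i - length bs, x))" (is "word_iso _ _ _ ?h")
proof -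
  let ?n = "length bs"
  let ?V = "{p \<in> word_verts (bs @ cs). fst p < ?n}" and ?W = "{p \<in> word_verts (bs @ cs). \<not> fst p < ?n}"
  have V: "?V = word_verts bs" by (auto simp: word_verts_def nth_append)
  have W: "bij_betw (\<lambda>(i, x). (i - ?n, x)) ?W (word_verts cs)"
    by (rule bij_betwI[where g = "\<lambda>(i, x). (i + ?n, x)"]) (auto simp: word_verts_def nth_append)
  have hV: "bij_betw ?h ?V A"
    using f unfolding V word_iso_def
    by (subst bij_betw_cong[where g = f]) (auto simp: word_verts_def)
  have hW: "bij_betw ?h ?W B"
  proof -
    have "bij_betw (g \<circ> (\<lambda>(i, x). (i - ?n, x))) ?W B"
      using W by (rule bij_betw_trans) (use g in \<open>simp add: word_iso_def\<close>)
    then show ?thesis by (rule bij_betw_cong[THEN iffD1, rotated]) auto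
  qed
  have "bij_betw ?h (?V \<union> ?W) (A \<union> B)"
    using hV hW disj by (rule bij_betw_combine)
  moreover have "?V \<union> ?W = word_verts (bs @ cs)" by auto
  ultimately have bij: "bij_betw ?h (word_verts (bs @ cs)) (A \<union> B)" by simp
  have inA: "f p \<in> A" if "p \<in> word_verts bs" for p using f that by (auto simp: word_iso_def bij_betw_def)
  have inB: "g p \<in> B" if "p \<in> word_verts cs" for p using g that by (auto simp: word_iso_def bij_betw_def)
  have port: "(?n - 1, out_port (last bs)) \<in> word_verts bs" "(0, 0) \<in> word_verts cs"
    using ne by (auto simp: word_verts_def last_conv_nth)
  have mixed: "(f p, g q) \<in> E \<longleftrightarrow> p = (?n - 1, out_port (last bs)) \<and> q = (0, 0)"
    if "p \<in> word_verts bs" "q \<in> word_verts cs" for p q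
  proof -
    have "inj_on f (word_verts bs)" "inj_on g (word_verts cs)"
      using f g by (auto simp: word_iso_def bij_betw_def)
    then show ?thesis using cross[OF inA[OF that(1)] inB[OF that(2)]] port that by (auto dest: inj_onD)
  qed
  have last: "?n - 1 = i \<and> last bs = bs ! i" if "Suc i = ?n" for i
  proof -
    have "?n - 1 = i" using that by simp
    then show ?thesis using ne(1) by (simp add: last_conv_nth)
  qed
  have "(?h p, ?h q) \<in> E \<longleftrightarrow> word_adj (bs @ cs) p q"
    if pq: "p \<in> word_verts (bs @ cs)" "q \<in> word_verts (bs @ cs)" for p q
  proof -
    obtain i x j y where [simp]: "p = (i, x)" "q = (j, y)" by (metis surj_pair)
    have ix: "i < ?n \<Longrightarrow> (i, x) \<in> word_verts bs" "\<not> i < ?n \<Longrightarrow> (i - ?n, x) \<in> word_verts cs"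
      and jy: "j < ?n \<Longrightarrow> (j, y) \<in> word_verts bs" "\<not> j < ?n \<Longrightarrow> (j - ?n, y) \<in> word_verts cs"
      using pq by (auto simp: word_verts_def nth_append split: if_splits)
    consider "i < ?n" "j < ?n" | "i < ?n" "\<not> j < ?n" | "\<not> i < ?n" "j < ?n" | "\<not> i < ?n" "\<not> j < ?n" by blast
    then show ?thesis
    proof cases
      case 1
      have "(f p, f q) \<in> E \<longleftrightarrow> word_adj bs p q" using f ix(1) jy(1) 1 by (simp add: word_iso_def)
      moreover have "word_adj bs p q \<longleftrightarrow> word_adj (bs @ cs) p q"
        using 1 pq ix(1) jy(1) by (simp add: word_adj_def chain_edge_def nth_append)
      ultimately show ?thesis using 1 by simp
    next
      case 2
      have "(f p, g (j - ?n, y)) \<in> E \<longleftrightarrow> word_adj (bs @ cs) p q"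
        using mixed[OF ix(1) jy(2)] 2 pq last[of i]
        by (cases "Suc i = ?n") (auto simp: word_adj_def chain_edge_def nth_append)
      then show ?thesis using 2 by simp
    next
      case 3
      have "(f q, g (i - ?n, x)) \<in> E \<longleftrightarrow> word_adj (bs @ cs) p q"
        using mixed[OF jy(1) ix(2)] 3 pq last[of j]
        by (cases "Suc j = ?n") (auto simp: word_adj_def chain_edge_def nth_append)
      then show ?thesis using 3 sym by auto
    next
      case 4
      have "(g (i - ?n, x), g (j - ?n, y)) \<in> E \<longleftrightarrow> word_adj cs (i - ?n, x) (j - ?n, y)"
        using g ix(2) jy(2) 4 by (simp add: word_iso_def)
      moreover have "\<dots> \<longleftrightarrow> word_adj (bs @ cs) p q"
        using 4 pq ix(2) jy(2) by (auto simp: word_adj_def chain_edge_def nth_append)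
      ultimately show ?thesis using 4 by simp
    qed
  qed
  with bij show ?thesis by (simp add: word_iso_def)
qed

definition word_flip :: "block list \<Rightarrow> nat \<times> nat \<Rightarrow> nat \<times> nat" where
  "word_flip bs p = (length bs - 1 - fst p, flip (bs ! fst p) (snd p))"

lemma word_flip_verts: "p \<in> word_verts bs \<Longrightarrow> word_flip bs p \<in> word_verts (rev bs)"
  by (auto simp: word_verts_def word_flip_def rev_nth flip_less)

lemma word_flip_flip:
  assumes "p \<in> word_verts bs"
  shows "word_flip (rev bs) (word_flip bs p) = p"
  using assms by (cases p) (auto simp: word_verts_def word_flip_def rev_nth flip_flip)

lemma bij_word_flip: "bij_betw (word_flip bs) (word_verts bs) (word_verts (rev bs))"
  by (rule bij_betwI[where g = "word_flip (rev bs)"])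
    (use word_flip_verts[of _ bs] word_flip_verts[of _ "rev bs"] word_flip_flip[of _ bs]
       word_flip_flip[of _ "rev bs"] in auto)

lemma chain_edge_flip:
  assumes "p \<in> word_verts bs" "q \<in> word_verts bs" "chain_edge bs p q"
  shows "chain_edge (rev bs) (word_flip bs q) (word_flip bs p)"
  using assms by (auto simp: chain_edge_def word_flip_def word_verts_def rev_nth Suc_diff_Suc)

lemma word_adj_flip:
  assumes bs: "\<And>b. b \<in> set bs \<Longrightarrow> is_block b" and adj: "word_adj bs p q"
  shows "word_adj (rev bs) (word_flip bs p) (word_flip bs q)"
proof -
  have v: "p \<in> word_verts bs" "q \<in> word_verts bs" using adj by (auto simp: word_adj_def)
  have "fst (word_flip bs p) = fst (word_flip bs q) \<and>
      badj (rev bs ! fst (word_flip bs p)) (snd (word_flip bs p)) (snd (word_flip bs q))"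
    if "fst p = fst q" "badj (bs ! fst p) (snd p) (snd q)"
    using that v badj_flip[OF bs, of "bs ! fst p" "snd p" "snd q"]
    by (auto simp: word_flip_def word_verts_def rev_nth)
  then show ?thesis using adj v word_flip_verts chain_edge_flip
    unfolding word_adj_def by blast
qed

lemma word_adj_flip_iff:
  assumes bs: "\<And>b. b \<in> set bs \<Longrightarrow> is_block b" and v: "p \<in> word_verts bs" "q \<in> word_verts bs"
  shows "word_adj (rev bs) (word_flip bs p) (word_flip bs q) \<longleftrightarrow> word_adj bs p q"
  using word_adj_flip[where bs = bs and p = p and q = q]
    word_adj_flip[where bs = "rev bs" and p = "word_flip bs p" and q = "word_flip bs q"]
    bs word_flip_flip v by auto

text \<open>Words of pieces start at the root. Of the two pieces at a bridge, one has to be reversed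
  before they are joined.\<close>

lemma word_iso_rev:
  assumes f: "word_iso E A bs f" and bs: "\<And>b. b \<in> set bs \<Longrightarrow> is_block b"
  shows "word_iso E A (rev bs) (f \<circ> word_flip (rev bs))"
proof -
  have "bij_betw (word_flip (rev bs)) (word_verts (rev bs)) (word_verts bs)"
    using bij_word_flip[of "rev bs"] by simp
  then have "bij_betw (f \<circ> word_flip (rev bs)) (word_verts (rev bs)) A"
    by (rule bij_betw_trans) (use f in \<open>simp add: word_iso_def\<close>)
  moreover have "((f \<circ> word_flip (rev bs)) p, (f \<circ> word_flip (rev bs)) q) \<in> E \<longleftrightarrow> word_adj (rev bs) p q"
    if "p \<in> word_verts (rev bs)" "q \<in> word_verts (rev bs)" for p q
    using f word_flip_verts[OF that(1)] word_flip_verts[OF that(2)]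
      word_adj_flip_iff[where bs = "rev bs" and p = p and q = q] bs that by (simp add: word_iso_def)
  ultimately show ?thesis by (simp add: word_iso_def)
qed

section \<open>Pieces and graphs are words of blocks\<close>

abbreviation piece_cap :: "nat \<Rightarrow> nat" where
  "piece_cap \<equiv> \<lambda>l. if l = 0 then 2 else 3"

text \<open>Levels change by at most one along an edge, so a vertex above level \<open>m\<close> has
  no neighbours below \<open>m\<close> and keeps its degree. Only \<open>r\<close> needs the
  assumption \<open>deg_r\<close>.\<close>

lemma layered_upper:
  assumes L: "layered E A w lev c" and c: "\<And>l. m < l \<Longrightarrow> c l = 3"
    and r: "{x \<in> A. lev x = m} = {r}" and deg_r: "card {y \<in> A. (r, y) \<in> E \<and> m \<le> lev y} = 2"
  shows "layered E {x \<in> A. m \<le> lev x} r (\<lambda>x. lev x - m) piece_cap"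
proof -
  interpret layered E A w lev c by fact
  have rA: "r \<in> A" "lev r = m" using r by auto
  show ?thesis
  proof unfold_locales
    show "finite {x \<in> A. m \<le> lev x}" using fin by simp
    show "r \<in> {x \<in> A. m \<le> lev x}" "lev r - m = 0" using rA by auto
    show "x = r" if "x \<in> {x \<in> A. m \<le> lev x}" "lev x - m = 0" for x
    proof -
      have "x \<in> {x \<in> A. lev x = m}" using that by auto
      then show ?thesis using r by blast
    qed
    show "\<exists>y\<in>{x \<in> A. m \<le> lev x}. lev y - m = l \<and> (y, x) \<in> E"
      if x: "x \<in> {x \<in> A. m \<le> lev x}" "lev x - m = Suc l" for x l
    proof -
      have "x \<in> A" "lev x = Suc (l + m)" using x by auto
      from parent[OF this] show ?thesis by auto
    qed
    show "lev y - m \<le> Suc (lev x - m)"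
      if "x \<in> {x \<in> A. m \<le> lev x}" "y \<in> {x \<in> A. m \<le> lev x}" "(x, y) \<in> E" for x y
      using lev_step[of x y] that by auto
    show "card {y \<in> {x \<in> A. m \<le> lev x}. (x, y) \<in> E} = piece_cap (lev x - m)"
      if x: "x \<in> {x \<in> A. m \<le> lev x}" for x
    proof (cases "lev x = m")
      case True
      then have "x = r" using x r by blast
      moreover have "{y \<in> {x \<in> A. m \<le> lev x}. (r, y) \<in> E} = {y \<in> A. (r, y) \<in> E \<and> m \<le> lev y}" by auto
      ultimately show ?thesis using deg_r True by simp
    next
      case False
      have "m \<le> lev y" if "y \<in> A" "(x, y) \<in> E" for y
        using lev_step[of y x] that x False adj_sym by force
      then have "{y \<in> {x \<in> A. m \<le> lev x}. (x, y) \<in> E} = {y \<in> A. (x, y) \<in> E}" by auto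
      then show ?thesis using deg[of x] c[of "lev x"] x False by auto
    qed
  qed (auto intro: adj_sym dest: triangle_free simp: adj_irrefl)
qed

text \<open>Here \<open>k\<close> is 2 or 1, according to whether the bridge at \<open>q\<close>
  leads away from \<open>w\<close> or towards \<open>w\<close>.\<close>

lemma layered_lower:
  assumes L: "layered E A w lev piece_cap" and m: "1 \<le> m" and q: "{x \<in> A. lev x = m} = {q}"
    and deg_q: "card {y \<in> A. (q, y) \<in> E \<and> lev y \<le> m} = k" and k: "k \<le> 3"
  shows "layered E {x \<in> A. lev x \<le> m} w lev (\<lambda>l. if l = 0 then 2 else if l = m then k else 3)"
proof -
  interpret layered E A w lev piece_cap by fact
  show ?thesis
  proof unfold_locales
    show "finite {x \<in> A. lev x \<le> m}" using fin by simp
    show "w \<in> {x \<in> A. lev x \<le> m}" "lev w = 0" using root by auto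
    show "x = w" if "x \<in> {x \<in> A. lev x \<le> m}" "lev x = 0" for x using that root_unique by blast
    show "\<exists>y\<in>{x \<in> A. lev x \<le> m}. lev y = l \<and> (y, x) \<in> E"
      if x: "x \<in> {x \<in> A. lev x \<le> m}" "lev x = Suc l" for x l
      using parent[of x l] x by auto
    show "lev y \<le> Suc (lev x)"
      if "x \<in> {x \<in> A. lev x \<le> m}" "y \<in> {x \<in> A. lev x \<le> m}" "(x, y) \<in> E" for x y
      using lev_step[of x y] that by auto
    show "card {y \<in> {x \<in> A. lev x \<le> m}. (x, y) \<in> E} = (if lev x = 0 then 2 else if lev x = m then k else 3)"
      if x: "x \<in> {x \<in> A. lev x \<le> m}" for x
    proof (cases "lev x = m")
      case True
      then have "x = q" using x q by blast
      moreover have "{y \<in> {x \<in> A. lev x \<le> m}. (q, y) \<in> E} = {y \<in> A. (q, y) \<in> E \<and> lev y \<le> m}" by auto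
      ultimately show ?thesis using deg_q True m by simp
    next
      case False
      have "lev y \<le> m" if "y \<in> A" "(x, y) \<in> E" for y
        using lev_step[of x y] that x False by force
      then have "{y \<in> {x \<in> A. lev x \<le> m}. (x, y) \<in> E} = {y \<in> A. (x, y) \<in> E}" by auto
      then show ?thesis using deg[of x] x False by auto
    qed
  qed (use k in \<open>auto intro: adj_sym dest: triangle_free simp: adj_irrefl\<close>)
qed

definition end_word :: "nat list \<Rightarrow> nat \<Rightarrow> nat \<Rightarrow> block list" where
  "end_word ts t i = map Mid ts @ [End t i]"

lemma end_word_size: "word_size (end_word ts t i) = 6 * length ts + 2 * sum_list ts + 7 + 2 * t"
  by (induction ts) (auto simp: end_word_def word_size_def)

lemma end_word_len: "word_len (end_word ts t i) = 4 * length ts + sum_list ts + 3 + t"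
  by (induction ts) (auto simp: end_word_def word_len_def)

text \<open>A middle block contributes its \<open>t\<close>, the end block 5 + t. Hence a piece that
  is a word has excess at least 5, which turns the induction hypothesis of \<open>piece_word\<close>
  into a lower bound.\<close>

lemma end_word_excess: "2 * word_size (end_word ts t i) = 3 * word_len (end_word ts t i) + 5 + t + sum_list ts"
  by (simp add: end_word_size end_word_len)

definition end_word_ok :: "nat list \<Rightarrow> nat \<Rightarrow> nat \<Rightarrow> bool" where
  "end_word_ok ts t i \<longleftrightarrow> set ts \<subseteq> {0, 2, 3} \<and> t < 4 \<and> i < end_count t"

lemma end_word_blocks: "end_word_ok ts t i \<Longrightarrow> b \<in> set (end_word ts t i) \<Longrightarrow> is_block b"
  by (auto simp: end_word_ok_def end_word_def is_block_Mid is_block_End)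

text \<open>The vertex \<open>q\<close> has three neighbours, none on its own level and at least one
  on each adjacent level (\<open>z\<close> guarantees the upper one). So one side has a single
  neighbour. As levels change by at most one along an edge, every path from one side to the other
  uses the edge to that neighbour.\<close>

lemma (in layered) singleton_level:
  assumes q: "{x \<in> A. lev x = m} = {q}" and m: "1 \<le> m" "c m = 3" and z: "z \<in> A" "m < lev z"
  obtains (forward) r where "{x \<in> A. lev x = Suc m} = {r}" "card {y \<in> A. (q, y) \<in> E \<and> lev y \<le> m} = 2"
      "card {y \<in> A. (r, y) \<in> E \<and> Suc m \<le> lev y} = c (Suc m) - 1"
      "\<And>a b. a \<in> A \<Longrightarrow> b \<in> A \<Longrightarrow> lev a \<le> m \<Longrightarrow> m < lev b \<Longrightarrow> (a, b) \<in> E \<longleftrightarrow> a = q \<and> b = r"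
  | (backward) p where "p \<in> A" "lev p = m - 1" "card {y \<in> A. (q, y) \<in> E \<and> lev y \<le> m} = 1"
      "card {y \<in> A. (q, y) \<in> E \<and> m \<le> lev y} = 2"
      "\<And>a b. a \<in> A \<Longrightarrow> b \<in> A \<Longrightarrow> lev a < m \<Longrightarrow> m \<le> lev b \<Longrightarrow> (a, b) \<in> E \<longleftrightarrow> a = p \<and> b = q"
proof -
  have qA: "q \<in> A" "lev q = m" using q by auto
  define bk fw where "bk = {y \<in> A. (q, y) \<in> E \<and> lev y \<le> m}" and "fw = {y \<in> A. (q, y) \<in> E \<and> m \<le> lev y}"
  have nm: "lev y \<noteq> m" if "y \<in> A" "(q, y) \<in> E" for y
  proof
    assume "lev y = m"
    then have "y = q" using q that by blast
    then show False using that adj_irrefl by blast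
  qed
  have finbf: "finite bk" "finite fw" using fin by (auto simp: bk_def fw_def)
  have bf: "card bk + card fw = 3"
  proof -
    have "card (bk \<union> fw) = card bk + card fw"
      using finbf nm by (intro card_Un_disjoint) (auto simp: bk_def fw_def)
    moreover have "{y \<in> A. (q, y) \<in> E} = bk \<union> fw" by (auto simp: bk_def fw_def)
    ultimately show ?thesis using deg[OF qA(1)] qA(2) m by simp
  qed
  have bk_lev: "lev y = m - 1" if "y \<in> bk" for y
  proof -
    have y: "y \<in> A" "(q, y) \<in> E" "lev y \<le> m" using that by (auto simp: bk_def)
    then show ?thesis using lev_step[OF y(1) qA(1) adj_sym[OF y(2)]] nm[OF y(1,2)] qA(2) by simp
  qed
  obtain y0 where "y0 \<in> A" "lev y0 = m - 1" "(y0, q) \<in> E" using parent[of q "m - 1"] qA m by auto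
  then have "y0 \<in> bk" using adj_sym by (auto simp: bk_def)
  then have bk1: "1 \<le> card bk" using finbf by (metis One_nat_def Suc_leI card_gt_0_iff empty_iff)
  have up: "(q, x) \<in> E" if x: "x \<in> A" "lev x = Suc m" for x
  proof -
    from parent[OF x] obtain y where y: "y \<in> A" "lev y = m" "(y, x) \<in> E" by blast
    then have "y = q" using q by blast
    then show ?thesis using y(3) by simp
  qed
  have fw_eq: "fw = {x \<in> A. lev x = Suc m}"
  proof (intro equalityI subsetI)
    fix x assume "x \<in> fw"
    then have x: "x \<in> A" "(q, x) \<in> E" "m \<le> lev x" by (auto simp: fw_def)
    then show "x \<in> {x \<in> A. lev x = Suc m}"
      using lev_step[OF qA(1) x(1,2)] nm[OF x(1,2)] qA(2) by simp
  qed (use up in \<open>auto simp: fw_def\<close>)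
  have fw1: "1 \<le> card fw" using level_size_pos[OF z(1), of "Suc m"] z(2) fw_eq by simp
  consider "card bk = 2" "card fw = 1" | "card bk = 1" "card fw = 2" using bf bk1 fw1 by linarith
  then show thesis
  proof cases
    case 1
    then obtain r where r: "fw = {r}" by (metis card_1_singletonE)
    then have rl: "{x \<in> A. lev x = Suc m} = {r}" "r \<in> A" "lev r = Suc m" "(q, r) \<in> E" using fw_eq up by auto
    have br: "(a, b) \<in> E \<longleftrightarrow> a = q \<and> b = r" if ab: "a \<in> A" "b \<in> A" "lev a \<le> m" "m < lev b" for a b
    proof
      assume "(a, b) \<in> E"
      then have "lev b \<le> Suc (lev a)" using lev_step ab by blast
      then have "lev a = m" "lev b = Suc m" using ab by auto
      then show "a = q \<and> b = r" using q rl(1) ab by blast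
    qed (use rl(4) in simp)
    have "y = q" if "y \<in> A" "(r, y) \<in> E" "\<not> Suc m \<le> lev y" for y
      using br[of y r] rl that adj_sym[OF that(2)] by auto
    then have "{y \<in> A. (r, y) \<in> E} = insert q {y \<in> A. (r, y) \<in> E \<and> Suc m \<le> lev y}"
      using rl(4) qA(1) adj_sym by blast
    moreover have "q \<notin> {y \<in> A. (r, y) \<in> E \<and> Suc m \<le> lev y}" using qA by simp
    ultimately have "Suc (card {y \<in> A. (r, y) \<in> E \<and> Suc m \<le> lev y}) = c (Suc m)"
      using fin deg[OF rl(2)] rl(3) by simp
    then have dr: "card {y \<in> A. (r, y) \<in> E \<and> Suc m \<le> lev y} = c (Suc m) - 1" by simp
    have "card {y \<in> A. (q, y) \<in> E \<and> lev y \<le> m} = 2" using 1 by (simp add: bk_def)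
    with rl(1) show thesis using dr br by (rule forward)
  next
    case 2
    then obtain p where p: "bk = {p}" by (metis card_1_singletonE)
    then have pb: "p \<in> bk" by simp
    show thesis
    proof (rule backward)
      show "p \<in> A" using pb by (simp add: bk_def)
      show "lev p = m - 1" by (rule bk_lev[OF pb])
      show "card {y \<in> A. (q, y) \<in> E \<and> lev y \<le> m} = 1" "card {y \<in> A. (q, y) \<in> E \<and> m \<le> lev y} = 2"
        using 2 by (simp_all add: bk_def fw_def)
      fix a b assume ab: "a \<in> A" "b \<in> A" "lev a < m" "m \<le> lev b"
      show "(a, b) \<in> E \<longleftrightarrow> a = p \<and> b = q"
      proof
        assume E: "(a, b) \<in> E"
        then have "lev b \<le> Suc (lev a)" using lev_step ab by blast
        then have "lev b = m" using ab by simp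
        then have "b = q" using q ab by blast
        moreover from this have "a \<in> bk" using E adj_sym ab unfolding bk_def by auto
        ultimately show "a = p \<and> b = q" using p by blast
      next
        assume "a = p \<and> b = q"
        then show "(a, b) \<in> E" using pb adj_sym by (auto simp: bk_def)
      qed
    qed
  qed
qed

text \<open>Cutting at the first singleton level splits the excess into that of the block and that
  of the rest. The rest is handled by the induction hypothesis, as soon as a lower bound for the
  block shows that its excess is at most 8; the word obtained gives a lower bound for the rest, and
  with it an upper bound for the block.\<close>

theorem piece_word:
  assumes "layered E A w lev piece_cap" "\<And>x. x \<in> A \<Longrightarrow> lev x \<le> e" "\<exists>x\<in>A. lev x = e"
    "2 * card A \<le> 3 * (e + 1) + 8"
  shows "\<exists>ts t i f. end_word_ok ts t i \<and> word_iso E A (end_word ts t i) f \<and> f (0, 0) = w \<and>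
    word_len (end_word ts t i) = e + 1"
  using assms
proof (induction "card A" arbitrary: A w lev e rule: less_induct)
  case (less A w lev e)
  interpret layered E A w lev piece_cap by (rule less.prems)
  note le = less.prems(2)
  show ?case
  proof (cases "\<forall>l. 1 \<le> l \<and> l < e \<longrightarrow> 2 \<le> level_size l")
    case True
    with classify_end[OF refl le less.prems(3) _ less.prems(4)] obtain t i g
      where t: "t < 4" "i < end_count t" "e = t + 2" and g: "labels E A w (End t i) g" by blast
    define f :: "nat \<times> nat \<Rightarrow> 'a" where "f = (\<lambda>p. g (snd p))"
    have "word_iso E A (end_word [] t i) f"
      using word_iso_single[OF g] by (simp add: end_word_def f_def)
    moreover have "end_word_ok [] t i" using t by (simp add: end_word_ok_def)
    moreover have "f (0, 0) = w" using g by (simp add: f_def labels_def)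
    moreover have "word_len (end_word [] t i) = e + 1" using t(3) by (simp add: end_word_len)
    ultimately show ?thesis by blast
  next
    case False
    define m where "m = (LEAST l. 1 \<le> l \<and> l < e \<and> \<not> 2 \<le> level_size l)"
    have "1 \<le> m \<and> m < e \<and> \<not> 2 \<le> level_size m"
      unfolding m_def by (rule LeastI_ex) (use False in blast)
    then have m: "1 \<le> m" "m < e" "\<not> 2 \<le> level_size m" by auto
    have sm: "2 * card A \<le> 3 * e + 11" using less.prems(4) by simp
    have two: "2 \<le> level_size l" if "1 \<le> l" "l < m" for l
      using not_less_Least[of l "\<lambda>l. 1 \<le> l \<and> l < e \<and> \<not> 2 \<le> level_size l"] that m(2)
      unfolding m_def[symmetric] by linarith
    obtain z where z: "z \<in> A" "lev z = e" using less.prems(3) by blast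
    have m2: "2 \<le> m" using m level_size_1 by (cases "m = 1") auto
    have "level_size m = 1" using m level_size_pos[OF z(1), of m] z(2) by simp
    then obtain q where q: "{x \<in> A. lev x = m} = {q}" by (metis card_1_singletonE)
    from q m(1) show ?thesis
    proof (rule singleton_level)
      show "piece_cap m = 3" "z \<in> A" "m < lev z" using m z by auto
    next
      \<comment> \<open>The bridge enters \<open>q\<close> from below, so \<open>q\<close> is the
        root of the rest \<open>?P\<close> and at the same time the dead end of \<open>?B\<close>;
        it is counted twice. Without \<open>q\<close> the block costs at least 4 and the rest at
        least 5, more than 8.\<close>
      assume dq: "card {y \<in> A. (q, y) \<in> E \<and> lev y \<le> m} = 1" "card {y \<in> A. (q, y) \<in> E \<and> m \<le> lev y} = 2"
      let ?B = "{x \<in> A. lev x \<le> m}" and ?P = "{x \<in> A. m \<le> lev x}"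
      have LP: "layered E ?P q (\<lambda>x. lev x - m) piece_cap"
        by (rule layered_upper[OF less.prems(1) _ q dq(2)]) simp
      have LB: "layered E ?B w lev (\<lambda>l. if l = 0 then 2 else if l = m then 1 else 3)"
        by (rule layered_lower[OF less.prems(1) m(1) q dq(1)]) simp
      have lv: "{x \<in> ?B. lev x = l} = {x \<in> A. lev x = l}" if "l \<le> m" for l using that by auto
      have cB: "3 * m + 6 \<le> 2 * card ?B"
      proof (rule ccontr)
        assume "\<not> ?thesis"
        moreover have "card {x \<in> ?B. lev x = m} = 1" using lv q by simp
        ultimately show False
          using layered.no_dead_end[OF LB refl m2] lv two by simp
      qed
      have "card A = card ?B + card {x \<in> A. m < lev x}"
        by (subst card_Un_disjoint[symmetric]) (use fin in \<open>auto intro: arg_cong[of _ _ card]\<close>)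
      moreover have "card ?P = card {q} + card {x \<in> A. m < lev x}"
        unfolding q[symmetric]
        by (subst card_Un_disjoint[symmetric]) (use fin in \<open>auto intro: arg_cong[of _ _ card]\<close>)
      ultimately have cA: "card A + 1 = card ?B + card ?P" by simp
      define e' where "e' = e - m"
      have ee: "e = e' + m" using m by (simp add: e'_def)
      have "2 * card ?P \<le> 3 * e' + 11" using cA cB sm ee by linarith
      then have cP: "2 * card ?P \<le> 3 * (e' + 1) + 8" by simp
      have lt: "card ?P < card A" using cA cB m2 by linarith
      have le': "lev x - m \<le> e'" if "x \<in> ?P" for x using le[of x] that ee by simp
      have ex': "\<exists>x\<in>?P. lev x - m = e'" using z ee by (intro bexI[of _ z]) auto
      obtain ts t i f where w: "word_iso E ?P (end_word ts t i) f" "word_len (end_word ts t i) = e' + 1"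
        using less.hyps[OF lt LP le' ex' cP] by blast
      then have "3 * e' + 8 \<le> 2 * card ?P"
        using end_word_excess[of ts t i] word_iso_card[OF w(1)] by simp
      then show ?thesis using cA cB sm ee by linarith
    next
      fix r
      assume r: "{x \<in> A. lev x = Suc m} = {r}" and dq: "card {y \<in> A. (q, y) \<in> E \<and> lev y \<le> m} = 2"
        and dr: "card {y \<in> A. (r, y) \<in> E \<and> Suc m \<le> lev y} = piece_cap (Suc m) - 1"
        and bridge: "\<And>a b. a \<in> A \<Longrightarrow> b \<in> A \<Longrightarrow> lev a \<le> m \<Longrightarrow> m < lev b \<Longrightarrow> (a, b) \<in> E \<longleftrightarrow> a = q \<and> b = r"
      have rA: "r \<in> A" "lev r = Suc m" "{x \<in> A. lev x = Suc m} = {r}" using r by auto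
      let ?B = "{x \<in> A. lev x \<le> m}" and ?P = "{x \<in> A. Suc m \<le> lev x}"
      have cross: "(a, b) \<in> E \<longleftrightarrow> a = q \<and> b = r" if "a \<in> ?B" "b \<in> ?P" for a b
        using bridge that by simp
      have LP: "layered E ?P r (\<lambda>x. lev x - Suc m) piece_cap"
        by (rule layered_upper[OF less.prems(1) _ rA(3)]) (use dr in simp_all)
      have LB: "layered E ?B w lev (\<lambda>l. if l = 0 then 2 else if l = m then 2 else 3)"
        by (rule layered_lower[OF less.prems(1) m(1) q dq]) simp
      have lv: "{x \<in> ?B. lev x = l} = {x \<in> A. lev x = l}" if "l \<le> m" for l using that by auto
      have classB: "\<exists>t g. t \<in> {0, 2, 3} \<and> m = t + 3 \<and> labels E ?B w (Mid t) g \<and> g (out_port (Mid t)) = q"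
        if "2 * card ?B \<le> 3 * (m + 1) + 3"
        by (rule layered.classify_mid[OF LB refl m2]) (use lv q two that in auto)
      \<comment> \<open>A block of negative excess would fall under the classification, which
        contains no such block.\<close>
      have cB: "3 * (m + 1) \<le> 2 * card ?B"
      proof (rule ccontr)
        assume n: "\<not> ?thesis"
        then obtain t g where t: "m = t + 3" "labels E ?B w (Mid t) g" using classB by auto
        then have "card ?B = block_size (Mid t)"
          using bij_betw_same_card[of g "{..<block_size (Mid t)}" ?B] by (simp add: labels_def)
        then show False using n t(1) by simp
      qed
      have cA: "card A = card ?B + card ?P"
        by (subst card_Un_disjoint[symmetric]) (use fin in \<open>auto intro: arg_cong[of _ _ card]\<close>)
      define e' where "e' = e - Suc m"
      have ee: "e = e' + Suc m" using m by (simp add: e'_def)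
      have cB': "3 * m + 3 \<le> 2 * card ?B" using cB by simp
      have "2 * card ?P \<le> 3 * e' + 11" using cA cB' sm ee by linarith
      then have cP: "2 * card ?P \<le> 3 * (e' + 1) + 8" by simp
      have lt: "card ?P < card A" using cA cB' by linarith
      have le': "lev x - Suc m \<le> e'" if "x \<in> ?P" for x using le[of x] that ee by simp
      have ex': "\<exists>x\<in>?P. lev x - Suc m = e'" using z ee by (intro bexI[of _ z]) auto
      obtain ts t i f where
        w: "end_word_ok ts t i" "word_iso E ?P (end_word ts t i) f" "f (0, 0) = r"
          "word_len (end_word ts t i) = e' + 1"
        using less.hyps[OF lt LP le' ex' cP] by blast
      then have "3 * e' + 8 \<le> 2 * card ?P"
        using end_word_excess[of ts t i] word_iso_card[OF w(2)] by simp
      \<comment> \<open>The rest has used at least 5 of the 8 units, so the block falls under the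
        classification.\<close>
      then have "2 * card ?B \<le> 3 * m + 6" using cA sm ee by linarith
      then have "2 * card ?B \<le> 3 * (m + 1) + 3" by simp
      with classB obtain s g where s: "s \<in> {0, 2, 3}" "m = s + 3"
        and g: "labels E ?B w (Mid s) g" "g (out_port (Mid s)) = q" by blast
      let ?h = "\<lambda>(j, x). if j < length [Mid s] then (\<lambda>p. g (snd p)) (j, x) else f (j - length [Mid s], x)"
      have "word_iso E (?B \<union> ?P) ([Mid s] @ end_word ts t i) ?h"
      proof (rule word_iso_join[OF word_iso_single[OF g(1)] w(2)])
        show "(a, b) \<in> E \<longleftrightarrow> a = g (snd (length [Mid s] - 1, out_port (last [Mid s]))) \<and> b = f (0, 0)"
          if "a \<in> ?B" "b \<in> ?P" for a b using cross[OF that] g(2) w(3) by simp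
        show "\<And>x y. (x, y) \<in> E \<Longrightarrow> (y, x) \<in> E" by (rule adj_sym)
      qed (auto simp: end_word_def)
      moreover have "?B \<union> ?P = A" by auto
      moreover have "[Mid s] @ end_word ts t i = end_word (s # ts) t i" by (simp add: end_word_def)
      ultimately have iso: "word_iso E A (end_word (s # ts) t i) ?h" by simp
      have "end_word_ok (s # ts) t i" using w(1) s(1) by (auto simp: end_word_ok_def)
      moreover have "?h (0, 0) = w" using g(1) by (simp add: labels_def)
      moreover have "word_len (end_word (s # ts) t i) = e + 1"
        using w(4) s(2) ee by (simp add: end_word_len)
      ultimately show ?thesis using iso by blast
    qed
  qed
qed

text \<open>A piece of excess less than 5 would satisfy the bound of \<open>piece_word\<close> and
  be a word, whose excess is at least 5.\<close>

corollary piece_lower_bound: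
  assumes "layered E A w lev piece_cap" "\<And>x. x \<in> A \<Longrightarrow> lev x \<le> e" "\<exists>x\<in>A. lev x = e"
  shows "3 * (e + 1) + 5 \<le> 2 * card A"
proof (rule ccontr)
  assume n: "\<not> ?thesis"
  then obtain ts t i f where "word_iso E A (end_word ts t i) f" "word_len (end_word ts t i) = e + 1"
    using piece_word[OF assms] by auto
  then show False using n end_word_excess[of ts t i] word_iso_card by fastforce
qed

section \<open>From pieces to whole graphs\<close>

definition full_word :: "nat \<times> nat \<Rightarrow> nat list \<Rightarrow> nat \<times> nat \<Rightarrow> block list" where
  "full_word a ms b = End (fst a) (snd a) # map Mid ms @ [End (fst b) (snd b)]"

definition full_word_ok :: "nat \<times> nat \<Rightarrow> nat list \<Rightarrow> nat \<times> nat \<Rightarrow> bool" where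
  "full_word_ok a ms b \<longleftrightarrow> set ms \<subseteq> {0, 2, 3} \<and> fst a < 4 \<and> snd a < end_count (fst a) \<and>
     fst b < 4 \<and> snd b < end_count (fst b)"

lemma full_word_blocks: "full_word_ok a ms b \<Longrightarrow> x \<in> set (full_word a ms b) \<Longrightarrow> is_block x"
  by (auto simp: full_word_ok_def full_word_def is_block_Mid is_block_End)

lemma rev_full_word: "rev (full_word a ms b) = full_word b (rev ms) a"
  by (simp add: full_word_def rev_map)

lemma full_word_size:
  "word_size (full_word a ms b) = 6 * length ms + 2 * sum_list ms + 14 + 2 * fst a + 2 * fst b"
  by (induction ms) (auto simp: full_word_def word_size_def)

lemma full_word_len:
  "word_len (full_word a ms b) = 4 * length ms + sum_list ms + 6 + fst a + fst b"
  by (induction ms) (auto simp: full_word_def word_len_def)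

text \<open>The source of all lower bounds for distances. Potentials are integers because they are
  often negated levels.\<close>

lemma relpow_potential:
  fixes \<phi> :: "'v \<Rightarrow> int"
  assumes "\<And>x y. (x, y) \<in> E \<Longrightarrow> \<phi> y \<le> \<phi> x + 1" "(x, y) \<in> E ^^ k"
  shows "\<phi> y \<le> \<phi> x + int k"
  using assms(2)
proof (induction k arbitrary: y)
  case (Suc k)
  then obtain z where "(x, z) \<in> E ^^ k" "(z, y) \<in> E" by auto
  with Suc.IH[of z] assms(1)[of z y] show ?case by simp
qed simp

definition bfs :: "('v \<times> 'v) set \<Rightarrow> 'v \<Rightarrow> 'v \<Rightarrow> nat" where
  "bfs F w x = (LEAST k. (w, x) \<in> F ^^ k)"

context
  fixes F :: "('v \<times> 'v) set" and A w
  assumes F: "F \<subseteq> A \<times> A" and reach: "\<forall>x\<in>A. (w, x) \<in> F\<^sup>*" and w: "w \<in> A"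
begin

lemma bfs_relpow: "x \<in> A \<Longrightarrow> (w, x) \<in> F ^^ bfs F w x"
  unfolding bfs_def using reach by (auto simp: rtrancl_is_UN_relpow intro: LeastI)

lemma bfs_le: "(w, x) \<in> F ^^ k \<Longrightarrow> bfs F w x \<le> k"
  unfolding bfs_def by (rule Least_le)

lemma bfs_root: "bfs F w w = 0"
  using bfs_le[of w 0] by simp

lemma bfs_root_unique: "x \<in> A \<Longrightarrow> bfs F w x = 0 \<Longrightarrow> x = w"
  using bfs_relpow[of x] by simp

lemma bfs_step: "(x, y) \<in> F \<Longrightarrow> bfs F w y \<le> Suc (bfs F w x)"
  using bfs_le[of y "Suc (bfs F w x)"] bfs_relpow[of x] F by auto

lemma bfs_parent:
  assumes "x \<in> A" "bfs F w x = Suc l"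
  shows "\<exists>y\<in>A. bfs F w y = l \<and> (y, x) \<in> F"
proof -
  obtain y where y: "(w, y) \<in> F ^^ l" "(y, x) \<in> F" using bfs_relpow[OF assms(1)] assms(2) by auto
  then have "bfs F w y \<le> l" "l \<le> bfs F w y" using bfs_le bfs_step assms(2) by fastforce+
  then show ?thesis using y F by auto
qed

end

text \<open>Every neighbour of the root has two neighbours on level 2. If that level had only two
  vertices, levels 0 to 2 would form a K_{3,3}, with no edge leading to level 3.\<close>

lemma (in layered) ball2_ge_7:
  assumes c: "c = (\<lambda>_. 3)" and far: "\<exists>x\<in>A. 3 \<le> lev x"
  shows "7 \<le> card {x \<in> A. lev x \<le> 2}"
proof -
  define N1 where "N1 = {x \<in> A. lev x = 1}"
  define N2 where "N2 = {x \<in> A. lev x = 2}"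
  have c1: "card N1 = 3" using level_size_1 c by (simp add: N1_def)
  have fN: "finite N1" "finite N2" using fin by (auto simp: N1_def N2_def)
  have wN1: "(w, x) \<in> E" if "x \<in> N1" for x
    using that parent[of x 0] root_unique by (auto simp: N1_def)
  have nb1: "y \<in> N2 \<or> y = w" if "x \<in> N1" "y \<in> A" "(x, y) \<in> E" for x y
  proof -
    have "lev y \<le> 2" using that lev_step[of x y] by (auto simp: N1_def)
    moreover have "y \<notin> N1" using triangle_free[OF wN1[OF that(1)] that(3)] wN1 by blast
    ultimately have "lev y = 2 \<or> lev y = 0" using that(2) by (auto simp: N1_def)
    then show ?thesis using root_unique[of y] that(2) by (auto simp: N2_def)
  qed
  have two: "card {y \<in> N2. (x, y) \<in> E} = 2" if x: "x \<in> N1" for x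
  proof -
    have "{y \<in> A. (x, y) \<in> E} = insert w {y \<in> N2. (x, y) \<in> E}"
      using nb1[OF x] adj_sym[OF wN1[OF x]] root(1) by (auto simp: N2_def)
    moreover have "w \<notin> N2" using root by (simp add: N2_def)
    moreover have "x \<in> A" using x by (simp add: N1_def)
    ultimately show ?thesis using deg[of x] fN c by simp
  qed
  have "3 \<le> card N2"
  proof (rule ccontr)
    assume "\<not> 3 \<le> card N2"
    then have le2: "card N2 \<le> 2" by simp
    have full: "{y \<in> N2. (x, y) \<in> E} = N2" if "x \<in> N1" for x
      by (rule card_seteq) (use fN two[OF that] le2 in auto)
    have nb2: "{x \<in> A. (y, x) \<in> E} = N1" if "y \<in> N2" for y
    proof -
      have "N1 \<subseteq> {x \<in> A. (y, x) \<in> E}" using full that adj_sym by (auto simp: N1_def)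
      moreover have "card {x \<in> A. (y, x) \<in> E} = card N1"
        using deg[of y] that c c1 by (simp add: N2_def)
      ultimately show ?thesis using card_subset_eq[of "{x \<in> A. (y, x) \<in> E}" N1] fin by simp
    qed
    obtain x where x: "x \<in> A" "3 \<le> lev x" using far by blast
    then have "1 \<le> level_size 3" by (intro level_size_pos) auto
    then obtain z where "z \<in> A" "lev z = Suc 2"
      by (metis (mono_tags, lifting) One_nat_def card.empty ex_in_conv le_zero_eq mem_Collect_eq nat.simps(3)
        numeral_3_eq_3 numeral_2_eq_2)
    with parent[OF this] obtain y where "y \<in> N2" "(y, z) \<in> E" by (auto simp: N2_def)
    then have "z \<in> N1" using nb2 \<open>z \<in> A\<close> by blast
    then show False using \<open>lev z = Suc 2\<close> by (simp add: N1_def)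
  qed
  moreover have "card (insert w (N1 \<union> N2)) = Suc (card N1 + card N2)"
  proof -
    have "w \<notin> N1 \<union> N2" using root by (auto simp: N1_def N2_def)
    moreover have "N1 \<inter> N2 = {}" by (auto simp: N1_def N2_def)
    ultimately show ?thesis using fN by (simp add: card_Un_disjoint)
  qed
  moreover have "insert w (N1 \<union> N2) \<subseteq> {x \<in> A. lev x \<le> 2}" using root by (auto simp: N1_def N2_def)
  then have "card (insert w (N1 \<union> N2)) \<le> card {x \<in> A. lev x \<le> 2}" using fin by (intro card_mono) auto
  ultimately show ?thesis using c1 by linarith
qed

text \<open>If no level from 3 to \<open>d - 3\<close> were a singleton, there would be at least 7 +
  2 (d - 5) + 7 vertices, and \<open>4 * d + 8 \<le> 3 * d + 16\<close> fails for
  \<open>d \<ge> 9\<close>. In both cases of \<open>singleton_level\<close> the upper end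
  \<open>r\<close> of the bridge is alone on its level; the lower end \<open>p\<close> need not
  be.\<close>

lemma (in layered) exists_bridge:
  assumes c: "c = (\<lambda>_. 3)" and v: "v \<in> A" "lev v = d" and ecc: "\<And>x. x \<in> A \<Longrightarrow> lev x \<le> d"
    and hi: "7 \<le> card {x \<in> A. d - 2 \<le> lev x}" and d: "9 \<le> d" and small: "2 * card A \<le> 3 * d + 16"
  obtains j p r where "j + 1 \<le> d" "p \<in> A" "lev p = j" "{x \<in> A. lev x = j + 1} = {r}"
    "card {y \<in> A. (r, y) \<in> E \<and> j + 1 \<le> lev y} = 2"
    "\<And>a b. a \<in> A \<Longrightarrow> b \<in> A \<Longrightarrow> lev a \<le> j \<Longrightarrow> j < lev b \<Longrightarrow> (a, b) \<in> E \<longleftrightarrow> a = p \<and> b = r"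
proof -
  have cls: "card {x \<in> A. a \<le> lev x \<and> lev x < b} = (\<Sum>l\<in>{a..<b}. level_size l)" for a b
  proof -
    have "{x \<in> A. a \<le> lev x \<and> lev x < b} = (\<Union>l\<in>{a..<b}. {x \<in> A. lev x = l})" by auto
    also have "card \<dots> = (\<Sum>l\<in>{a..<b}. level_size l)"
      by (rule card_UN_disjoint) (use fin in auto)
    finally show ?thesis .
  qed
  have "{x \<in> A. lev x \<le> 2} = {x \<in> A. 0 \<le> lev x \<and> lev x < 3}" by auto
  then have lo: "7 \<le> (\<Sum>l\<in>{0..<3}. level_size l)"
  proof -
    have "\<exists>x\<in>A. 3 \<le> lev x" using v d by (intro bexI[of _ v]) auto
    from ball2_ge_7[OF c this] show ?thesis unfolding \<open>{x \<in> A. lev x \<le> 2} = _\<close> cls .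
  qed
  have "{x \<in> A. d - 2 \<le> lev x} = {x \<in> A. d - 2 \<le> lev x \<and> lev x < d + 1}"
    using ecc by (auto simp: less_Suc_eq_le)
  then have hi: "7 \<le> (\<Sum>l\<in>{d - 2..<d + 1}. level_size l)" using hi unfolding cls[symmetric] by simp
  have "\<exists>i. 3 \<le> i \<and> i < d - 2 \<and> level_size i = 1"
  proof (rule ccontr)
    assume n: "\<nexists>i. 3 \<le> i \<and> i < d - 2 \<and> level_size i = 1"
    have "2 \<le> level_size l" if "3 \<le> l" "l < d - 2" for l
    proof -
      have "1 \<le> level_size l" using level_size_pos[OF v(1), of l] v(2) that by simp
      moreover have "level_size l \<noteq> 1" using n that by blast
      ultimately show ?thesis by simp
    qed
    then have "(\<Sum>l\<in>{3..<d - 2}. 2) \<le> (\<Sum>l\<in>{3..<d - 2}. level_size l)" by (intro sum_mono) auto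
    moreover have "(\<Sum>l\<in>{0..<d + 1}. level_size l) = (\<Sum>l\<in>{0..<3}. level_size l) +
        (\<Sum>l\<in>{3..<d - 2}. level_size l) + (\<Sum>l\<in>{d - 2..<d + 1}. level_size l)"
      using d by (subst (1) sum.atLeastLessThan_concat[symmetric, of 0 3 "d + 1"], simp, simp,
        subst sum.atLeastLessThan_concat[symmetric, of 3 "d - 2" "d + 1"], simp, simp, simp)
    moreover have "card A = (\<Sum>l\<in>{0..<d + 1}. level_size l)" using card_levels[OF ecc] by simp
    ultimately have "7 + (\<Sum>l\<in>{3..<d - 2}. 2) + 7 \<le> card A" using lo hi by linarith
    then have "2 * d + 4 \<le> card A" using d by simp
    then show False using small d by linarith
  qed
  then obtain i where i: "3 \<le> i" "i < d - 2" "level_size i = 1" by blast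
  then obtain q where q: "{x \<in> A. lev x = i} = {q}" by (metis card_1_singletonE)
  then have qA: "q \<in> A" "lev q = i" by auto
  have "1 \<le> i" using i by simp
  from q this show thesis
  proof (rule singleton_level)
    show "c i = 3" "v \<in> A" "i < lev v" using c v i by auto
  next
    fix r
    assume r: "{x \<in> A. lev x = Suc i} = {r}" "card {y \<in> A. (r, y) \<in> E \<and> Suc i \<le> lev y} = c (Suc i) - 1"
      and br: "\<And>a b. a \<in> A \<Longrightarrow> b \<in> A \<Longrightarrow> lev a \<le> i \<Longrightarrow> i < lev b \<Longrightarrow> (a, b) \<in> E \<longleftrightarrow> a = q \<and> b = r"
    show thesis by (rule that[of i q r]) (use i qA r br c in auto)
  next
    fix p
    assume p: "p \<in> A" "lev p = i - 1" "card {y \<in> A. (q, y) \<in> E \<and> i \<le> lev y} = 2"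
      and br: "\<And>a b. a \<in> A \<Longrightarrow> b \<in> A \<Longrightarrow> lev a < i \<Longrightarrow> i \<le> lev b \<Longrightarrow> (a, b) \<in> E \<longleftrightarrow> a = p \<and> b = q"
    show thesis by (rule that[of "i - 1" p q]) (use i p q br in auto)
  qed
qed

locale cubic_graph =
  fixes E :: "('v \<times> 'v) set" and V :: "'v set"
  assumes fin: "finite V" and sub: "E \<subseteq> V \<times> V"
    and adj_sym: "\<And>x y. (x, y) \<in> E \<Longrightarrow> (y, x) \<in> E"
    and adj_irrefl: "\<And>x. (x, x) \<notin> E"
    and triangle_free: "\<And>x y z. (x, y) \<in> E \<Longrightarrow> (y, z) \<in> E \<Longrightarrow> (x, z) \<notin> E"
    and deg: "\<And>x. x \<in> V \<Longrightarrow> card {y. (x, y) \<in> E} = 3"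
begin

lemma layered_bfs:
  assumes "z \<in> V" and "\<forall>x\<in>V. (z, x) \<in> E\<^sup>*"
  shows "layered E V z (bfs E z) (\<lambda>_. 3)"
proof
  note B = bfs_root[OF sub assms(2,1)] bfs_root_unique[OF sub assms(2,1)]
    bfs_step[OF sub assms(2,1)] bfs_parent[OF sub assms(2,1)]
  show "finite V" "z \<in> V" "bfs E z z = 0" by (fact fin assms(1) B(1))+
  show "x = z" if "x \<in> V" "bfs E z x = 0" for x using B(2) that .
  show "\<exists>y\<in>V. bfs E z y = l \<and> (y, x) \<in> E" if "x \<in> V" "bfs E z x = Suc l" for x l using B(4) that .
  show "bfs E z y \<le> Suc (bfs E z x)" if "(x, y) \<in> E" for x y using B(3)[OF that] .
  show "card {y \<in> V. (x, y) \<in> E} = 3" if "x \<in> V" for x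
  proof -
    have "{y \<in> V. (x, y) \<in> E} = {y. (x, y) \<in> E}" using sub by auto
    then show ?thesis using deg[OF that] by simp
  qed
qed (auto intro: adj_sym dest: triangle_free simp: adj_irrefl)

text \<open>The levels from \<open>u\<close> serve for the upper piece, whose root \<open>r\<close>
  is alone on its level. The lower piece has its root at \<open>p\<close>, so distances from
  \<open>p\<close> have to be taken instead, and its eccentricity \<open>e\<close> has to be
  compared with \<open>j\<close>.\<close>

theorem graph_word:
  assumes reach: "\<And>x. x \<in> V \<Longrightarrow> \<forall>y\<in>V. (x, y) \<in> E\<^sup>*"
    and diam: "\<And>x y. x \<in> V \<Longrightarrow> y \<in> V \<Longrightarrow> bfs E x y \<le> d"
    and uv: "u \<in> V" "v \<in> V" "bfs E u v = d"
    and d: "9 \<le> d" and small: "2 * card V \<le> 3 * d + 16"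
  shows "\<exists>a ms b f. full_word_ok a ms b \<and> word_iso E V (full_word a ms b) f \<and>
    word_len (full_word a ms b) = d + 1"
proof -
  let ?l = "bfs E u"
  note B = bfs_root[OF sub reach[OF uv(1)] uv(1)] bfs_root_unique[OF sub reach[OF uv(1)] uv(1)]
    bfs_step[OF sub reach[OF uv(1)] uv(1)] bfs_parent[OF sub reach[OF uv(1)] uv(1)]
  have ecc: "?l x \<le> d" if "x \<in> V" for x using diam uv that by blast
  \<comment> \<open>By the triangle inequality the ball of radius 2 around \<open>v\<close> lies in
    the three highest levels, which therefore have at least 7 vertices.\<close>
  have low: "int d - int (?l x) \<le> int (bfs E v x)" if x: "x \<in> V" for x
  proof -
    have "- int (?l z) \<le> - int (?l y) + 1" if "(y, z) \<in> E" for y z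
      using B(3)[OF adj_sym[OF that]] by simp
    from relpow_potential[where \<phi> = "\<lambda>x. - int (?l x)", OF this bfs_relpow[OF sub reach[OF uv(2)] uv(2) x]] uv(3)
    show ?thesis by simp
  qed
  have "\<exists>x\<in>V. 3 \<le> bfs E v x" using low[OF uv(1)] B(1) uv(1) d by (intro bexI[of _ u]) auto
  from layered.ball2_ge_7[OF layered_bfs[OF uv(2) reach[OF uv(2)]] refl this]
  have "7 \<le> card {x \<in> V. bfs E v x \<le> 2}" .
  also have "\<dots> \<le> card {x \<in> V. d - 2 \<le> ?l x}"
    by (rule card_mono) (use fin low in force)+
  finally have hi: "7 \<le> card {x \<in> V. d - 2 \<le> ?l x}" .
  obtain j p r where j: "j + 1 \<le> d" and pr: "p \<in> V" "?l p = j" "{x \<in> V. ?l x = j + 1} = {r}"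
    and dr: "card {y \<in> V. (r, y) \<in> E \<and> j + 1 \<le> ?l y} = 2"
    and cross: "\<And>a b. a \<in> V \<Longrightarrow> b \<in> V \<Longrightarrow> ?l a \<le> j \<Longrightarrow> j < ?l b \<Longrightarrow> (a, b) \<in> E \<longleftrightarrow> a = p \<and> b = r"
    using layered.exists_bridge[OF layered_bfs[OF uv(1) reach[OF uv(1)]] refl uv(2,3) ecc hi d small] by blast
  have rV: "r \<in> V" using pr(3) by auto
  have rl: "?l r = j + 1" using pr(3) by auto
  let ?P = "{x \<in> V. ?l x \<le> j}" and ?Q = "{x \<in> V. j + 1 \<le> ?l x}"
  have VPQ: "V = ?P \<union> ?Q" "?P \<inter> ?Q = {}" by auto
  have cV: "card V = card ?P + card ?Q"
    by (subst card_Un_disjoint[symmetric]) (use fin in \<open>auto intro: arg_cong[of _ _ card]\<close>)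
  have prE: "(p, r) \<in> E" "(r, p) \<in> E" using cross[of p r] pr rV rl adj_sym by auto
  have deg_P: "card {y \<in> ?P. (x, y) \<in> E} = (if x = p then 2 else 3)" if x: "x \<in> ?P" for x
  proof -
    have out: "x = p \<and> y = r" if "(x, y) \<in> E" "y \<notin> ?P" for y
      using cross[of x y] x that sub by (auto simp: not_le)
    have d3: "card {y. (x, y) \<in> E} = 3" using deg x by blast
    show ?thesis
    proof (cases "x = p")
      case True
      have "{y. (x, y) \<in> E} = insert r {y \<in> ?P. (x, y) \<in> E}" using out prE(1) True by blast
      moreover have "r \<notin> {y \<in> ?P. (x, y) \<in> E}" using rl by simp
      ultimately have "card {y. (x, y) \<in> E} = Suc (card {y \<in> ?P. (x, y) \<in> E})" using fin by simp
      then show ?thesis using d3 True by simp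
    next
      case False
      then have "{y. (x, y) \<in> E} = {y \<in> ?P. (x, y) \<in> E}" using out by blast
      then show ?thesis using d3 False by simp
    qed
  qed
  define F where "F = E \<inter> ?P \<times> ?P"
  have Fsub: "F \<subseteq> ?P \<times> ?P" by (auto simp: F_def)
  have Fsym: "sym F" using adj_sym by (auto simp: F_def intro: symI)
  have up: "(x, u) \<in> F\<^sup>*" if "x \<in> ?P" for x
    using that
  proof (induction "?l x" arbitrary: x)
    case 0
    then show ?case using B(2)[of x] by auto
  next
    case (Suc k)
    from B(4)[of x k] Suc obtain y where y: "y \<in> V" "?l y = k" "(y, x) \<in> E" by auto
    then have "y \<in> ?P" "(x, y) \<in> F" using Suc adj_sym by (auto simp: F_def)
    then show ?case using Suc.hyps(1)[of y] y by (auto intro: converse_rtrancl_into_rtrancl)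
  qed
  have pP: "p \<in> ?P" using pr by simp
  have Freach: "\<forall>x\<in>?P. (p, x) \<in> F\<^sup>*"
  proof
    fix x assume "x \<in> ?P"
    then have "(u, x) \<in> F\<^sup>*" using up[of x] Fsym by (meson sym_rtrancl symD)
    with up[OF pP] show "(p, x) \<in> F\<^sup>*" by (rule rtrancl_trans)
  qed
  let ?\<mu> = "bfs F p"
  note M = bfs_root[OF Fsub Freach pP] bfs_root_unique[OF Fsub Freach pP]
    bfs_step[OF Fsub Freach pP] bfs_parent[OF Fsub Freach pP]
  define e where "e = Max (?\<mu> ` ?P)"
  have fP: "finite ?P" using fin by simp
  have \<mu>le: "?\<mu> x \<le> e" if "x \<in> ?P" for x unfolding e_def using fP that by (intro Max_ge) auto
  have "e \<in> ?\<mu> ` ?P" unfolding e_def using fP pP by (intro Max_in) auto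
  then obtain z where z: "z \<in> ?P" "?\<mu> z = e" by auto
  have LP: "layered E ?P p ?\<mu> piece_cap"
  proof unfold_locales
    show "finite ?P" "p \<in> ?P" "?\<mu> p = 0" by (fact fP pP M(1))+
    show "x \<in> ?P \<Longrightarrow> ?\<mu> x = 0 \<Longrightarrow> x = p" for x by (fact M(2))
    show "\<exists>y\<in>?P. ?\<mu> y = l \<and> (y, x) \<in> E" if "x \<in> ?P" "?\<mu> x = Suc l" for x l
      using M(4)[OF that] by (auto simp: F_def)
    show "?\<mu> y \<le> Suc (?\<mu> x)" if "x \<in> ?P" "y \<in> ?P" "(x, y) \<in> E" for x y
      using M(3)[of x y] that by (simp add: F_def)
    show "card {y \<in> ?P. (x, y) \<in> E} = piece_cap (?\<mu> x)" if x: "x \<in> ?P" for x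
      using deg_P[OF x] M(1) M(2)[OF x] by auto
  qed (auto intro: adj_sym dest: triangle_free simp: adj_irrefl)
  have LQ: "layered E ?Q r (\<lambda>x. ?l x - (j + 1)) piece_cap"
    by (rule layered_upper[OF layered_bfs[OF uv(1) reach[OF uv(1)]] _ pr(3) dr]) simp
  have Qle: "?l x - (j + 1) \<le> d - (j + 1)" if "x \<in> ?Q" for x using ecc[of x] that by simp
  have Qex: "\<exists>x\<in>?Q. ?l x - (j + 1) = d - (j + 1)" using uv j by (intro bexI[of _ v]) auto
  have "j \<le> e"
  proof -
    have uP: "u \<in> ?P" using uv B(1) by simp
    have "int (?l y) \<ge> int (?l x) - 1" if "(x, y) \<in> F" for x y
      using B(3)[of y x] that adj_sym by (auto simp: F_def)
    then have "- int (?l y) \<le> - int (?l x) + 1" if "(x, y) \<in> F" for x y using that by force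
    from relpow_potential[OF this bfs_relpow[OF Fsub Freach pP uP]]
    have "- int (?l u) \<le> - int (?l p) + int (?\<mu> u)" .
    then show ?thesis using B(1) pr(2) \<mu>le[OF uP] by simp
  qed
  moreover have "e \<le> j"
  proof -
    \<comment> \<open>Minus the distance from \<open>p\<close> below the bridge, and 1 at
      \<open>r\<close>. A path from \<open>z\<close> to \<open>v\<close> has to climb
      \<open>e\<close> steps to \<open>p\<close>, then the \<open>d - j\<close> steps from
      \<open>p\<close> to \<open>v\<close>; the diameter \<open>d\<close> thus forces
      \<open>e \<le> j\<close>.\<close>
    define \<phi> where "\<phi> x = (if ?l x \<le> j then - int (?\<mu> x) else int (?l x) - int j)" for x
    have \<phi>: "\<phi> y \<le> \<phi> x + 1" if xy: "(x, y) \<in> E" for x y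
    proof -
      have V: "x \<in> V" "y \<in> V" using xy sub by auto
      consider "?l x \<le> j" "?l y \<le> j" | "?l x \<le> j" "j < ?l y" | "j < ?l x" "?l y \<le> j" | "j < ?l x" "j < ?l y"
        by linarith
      then show ?thesis
      proof cases
        case 1
        then have "(y, x) \<in> F" using xy adj_sym V by (auto simp: F_def)
        then show ?thesis using M(3)[of y x] 1 by (simp add: \<phi>_def)
      next
        case 2
        then have "x = p" "y = r" using cross[of x y] xy V by blast+
        then show ?thesis using M(1) rl pr by (simp add: \<phi>_def)
      next
        case 3
        then show ?thesis by (simp add: \<phi>_def)
      next
        case 4
        then show ?thesis using B(3)[OF xy] by (simp add: \<phi>_def)
      qed
    qed
    have zV: "z \<in> V" "?l z \<le> j" using z by auto
    from relpow_potential[OF \<phi> bfs_relpow[OF sub reach[OF zV(1)] zV(1) uv(2)]]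
    have "\<phi> v \<le> \<phi> z + int (bfs E z v)" .
    moreover have "bfs E z v \<le> d" using diam zV uv by blast
    ultimately show ?thesis using zV uv(3) j z(2) by (simp add: \<phi>_def)
  qed
  ultimately have ej: "e = j" by simp
  have lbP: "3 * (j + 1) + 5 \<le> 2 * card ?P"
    using piece_lower_bound[OF LP \<mu>le] z ej by blast
  have lbQ: "3 * (d - (j + 1) + 1) + 5 \<le> 2 * card ?Q"
    using piece_lower_bound[OF LQ Qle Qex] by blast
  obtain k where k: "d = j + 1 + k" using j by (metis le_Suc_ex)
  \<comment> \<open>The two excesses add up to at most 13 and the other one is at least 5.\<close>
  have "2 * card ?P \<le> 3 * (j + 1) + 8" using lbQ cV small k by simp
  then obtain ts t i f where f: "end_word_ok ts t i" "word_iso E ?P (end_word ts t i) f" "f (0, 0) = p"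
    "word_len (end_word ts t i) = j + 1"
    using piece_word[OF LP \<mu>le] z ej by blast
  have "2 * card ?Q \<le> 3 * (d - (j + 1) + 1) + 8" using lbP cV small k by simp
  then obtain ts' t' i' g where g: "end_word_ok ts' t' i'" "word_iso E ?Q (end_word ts' t' i') g"
    "g (0, 0) = r" "word_len (end_word ts' t' i') = d - (j + 1) + 1"
    using piece_word[OF LQ Qle Qex] by blast
  let ?w = "end_word ts t i" and ?w' = "end_word ts' t' i'"
  \<comment> \<open>The reversal moves the root \<open>p\<close> of the lower piece to the out-port
    of the last block, where the bridge to \<open>r\<close> starts.\<close>
  have fr: "word_iso E ?P (rev ?w) (f \<circ> word_flip (rev ?w))"
    by (rule word_iso_rev[OF f(2)]) (rule end_word_blocks[OF f(1)])
  have ne: "?w \<noteq> []" "?w' \<noteq> []" by (auto simp: end_word_def)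
  let ?h = "\<lambda>(i, x). if i < length (rev ?w)
      then (f \<circ> word_flip (rev ?w)) (i, x) else g (i - length (rev ?w), x)"
  have iso: "word_iso E (?P \<union> ?Q) (rev ?w @ ?w') ?h"
  proof (rule word_iso_join[OF fr g(2) VPQ(2)])
    show "(a, b) \<in> E \<longleftrightarrow> a = (f \<circ> word_flip (rev ?w)) (length (rev ?w) - 1, out_port (last (rev ?w))) \<and> b = g (0, 0)"
      if "a \<in> ?P" "b \<in> ?Q" for a b
    proof -
      have "word_flip (rev ?w) (length (rev ?w) - 1, out_port (last (rev ?w))) = (0, 0)"
        using ne by (simp add: word_flip_def last_conv_nth)
      then show ?thesis using cross[of a b] that f(3) g(3) by simp
    qed
  qed (use ne adj_sym in auto)
  have w: "rev ?w @ ?w' = full_word (t, i) (rev ts @ ts') (t', i')"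
    by (simp add: end_word_def full_word_def rev_map)
  have "word_iso E V (full_word (t, i) (rev ts @ ts') (t', i')) ?h"
    using iso by (simp only: w VPQ(1)[symmetric])
  moreover have "full_word_ok (t, i) (rev ts @ ts') (t', i')"
    using f(1) g(1) by (auto simp: end_word_ok_def full_word_ok_def)
  moreover have "word_len (full_word (t, i) (rev ts @ ts') (t', i')) = d + 1"
    using f(4) g(4) k by (simp add: end_word_len full_word_len)
  ultimately show ?thesis by blast
qed

end

section \<open>A graph determines its word up to reversal\<close>

definition word_arcs :: "block list \<Rightarrow> ((nat \<times> nat) \<times> (nat \<times> nat)) set" where
  "word_arcs bs = {(p, q). word_adj bs p q}"

definition non_bridges :: "('v \<times> 'v) set \<Rightarrow> ('v \<times> 'v) set" where
  "non_bridges R = {(x, y) \<in> R. (x, y) \<in> (R - {(x, y), (y, x)})\<^sup>*}"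

lemma rtrancl_map_prod:
  assumes "(x, y) \<in> R\<^sup>*" "map_prod f f ` R \<subseteq> S"
  shows "(f x, f y) \<in> S\<^sup>*"
  using assms(1)
proof induction
  case (step y z)
  then have "(f y, f z) \<in> S" using assms(2) by force
  with step.IH show ?case by (rule rtrancl_into_rtrancl)
qed simp

lemma non_bridges_map:
  assumes R: "R \<subseteq> V \<times> V" and f: "inj_on f V" and S: "map_prod f f ` R \<subseteq> S"
  shows "map_prod f f ` non_bridges R \<subseteq> non_bridges S"
proof (clarsimp simp: non_bridges_def)
  fix x y assume xy: "(x, y) \<in> R" "(x, y) \<in> (R - {(x, y), (y, x)})\<^sup>*"
  have "map_prod f f ` (R - {(x, y), (y, x)}) \<subseteq> S - {(f x, f y), (f y, f x)}"
    using R f S xy(1) by (auto dest: inj_onD)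
  with xy(2) have "(f x, f y) \<in> (S - {(f x, f y), (f y, f x)})\<^sup>*" by (rule rtrancl_map_prod)
  then show "(f x, f y) \<in> S \<and> (f x, f y) \<in> (S - {(f x, f y), (f y, f x)})\<^sup>*"
    using S xy(1) by force
qed

lemma closed_set_rtrancl:
  assumes "(x, y) \<in> R\<^sup>*" "x \<in> X" "\<And>a b. (a, b) \<in> R \<Longrightarrow> a \<in> X \<Longrightarrow> b \<in> X"
  shows "y \<in> X"
  using assms(1,2) by induction (auto intro: assms(3))

text \<open>An edge between blocks \<open>i\<close> and \<open>Suc i\<close> is the only one between
  the blocks up to \<open>i\<close> and the later ones, so without it no path leaves its side. An
  edge inside a block has a detour in that block.\<close>

lemma word_non_bridges:
  assumes bs: "\<And>b. b \<in> set bs \<Longrightarrow> is_block b"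
  shows "non_bridges (word_arcs bs) = {(p, q) \<in> word_arcs bs. fst p = fst q}"
proof (intro equalityI subsetI)
  fix e assume "e \<in> non_bridges (word_arcs bs)"
  then obtain p q where e: "e = (p, q)" and pq: "(p, q) \<in> word_arcs bs"
    "(p, q) \<in> (word_arcs bs - {(p, q), (q, p)})\<^sup>*" by (auto simp: non_bridges_def)
  have "fst p = fst q"
  proof (rule ccontr)
    assume ne: "fst p \<noteq> fst q"
    define i where "i = min (fst p) (fst q)"
    let ?X = "{x. fst x \<le> i \<longleftrightarrow> fst p \<le> i}"
    have "q \<in> ?X"
    proof (rule closed_set_rtrancl[OF pq(2)])
      fix a b assume ab: "(a, b) \<in> word_arcs bs - {(p, q), (q, p)}" "a \<in> ?X"
      have "fst a \<le> i \<longleftrightarrow> fst b \<le> i"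
      proof (rule ccontr)
        assume n: "\<not> (fst a \<le> i \<longleftrightarrow> fst b \<le> i)"
        have "chain_edge bs a b \<or> chain_edge bs b a" using ab(1) n by (auto simp: word_arcs_def word_adj_def)
        then have 1: "chain_edge bs a b \<and> fst a = i \<or> chain_edge bs b a \<and> fst b = i"
          using n by (auto simp: chain_edge_def)
        have 2: "chain_edge bs p q \<and> fst p = i \<or> chain_edge bs q p \<and> fst q = i"
          using pq(1) ne by (auto simp: word_arcs_def word_adj_def chain_edge_def i_def)
        have "(a, b) = (p, q) \<or> (a, b) = (q, p)"
          using 1 2 by (cases a; cases b; cases p; cases q) (auto simp: chain_edge_def)
        then show False using ab(1) by auto
      qed
      then show "b \<in> ?X" using ab(2) by auto
    qed simp
    then show False using ne by (auto simp: i_def min_def split: if_splits)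
  qed
  then show "e \<in> {(p, q) \<in> word_arcs bs. fst p = fst q}" using e pq by simp
next
  fix e assume "e \<in> {(p, q) \<in> word_arcs bs. fst p = fst q}"
  then obtain i x y where e: "e = ((i, x), (i, y))" and a: "word_adj bs (i, x) (i, y)"
    by (auto simp: word_arcs_def)
  have i: "i < length bs" using a by (auto simp: word_adj_def word_verts_def)
  let ?b = "bs ! i"
  have b: "is_block ?b" using bs i by simp
  have xy: "badj ?b x y" using a by (auto simp: word_adj_def chain_edge_def)
  have "map_prod (Pair i) (Pair i) ` ({(u, v). badj ?b u v} - {(x, y), (y, x)}) \<subseteq>
    word_arcs bs - {((i, x), (i, y)), ((i, y), (i, x))}"
    using i badj_less[OF b] by (auto simp: word_arcs_def word_adj_def word_verts_def)
  from rtrancl_map_prod[OF badj_not_bridge[OF b xy] this] a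
  show "e \<in> non_bridges (word_arcs bs)" by (simp add: e non_bridges_def word_arcs_def)
qed

lemma word_block_connected:
  assumes bs: "\<And>b. b \<in> set bs \<Longrightarrow> is_block b" and v: "p \<in> word_verts bs" "q \<in> word_verts bs" "fst p = fst q"
  shows "(p, q) \<in> {(p, q) \<in> word_arcs bs. fst p = fst q}\<^sup>*"
proof -
  obtain i x y where [simp]: "p = (i, x)" "q = (i, y)" using v(3) by (metis prod.collapse)
  let ?b = "bs ! i" and ?R = "{(p, q) \<in> word_arcs bs. fst p = fst q}"
  have i: "i < length bs" "x < block_size ?b" "y < block_size ?b" using v by (auto simp: word_verts_def)
  have b: "is_block ?b" using bs i by simp
  have sub: "map_prod (Pair i) (Pair i) ` {(u, v). badj ?b u v} \<subseteq> ?R"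
    using i badj_less[OF b] by (auto simp: word_arcs_def word_adj_def word_verts_def)
  have "sym ?R" by (auto simp: sym_def word_arcs_def word_adj_sym)
  then have "((i, 0), (i, y)) \<in> ?R\<^sup>*"
    using rtrancl_map_prod[OF badj_connected[OF b i(3)] sub] by (meson sym_rtrancl symD)
  with rtrancl_map_prod[OF badj_connected[OF b i(2)] sub] show ?thesis by (simp add: rtrancl_trans)
qed

text \<open>Injectivity forbids turning back, so all steps equal the first one,
  \<open>\<delta>\<close>; the range then determines the initial value.\<close>

lemma unit_step_injection:
  fixes \<sigma> :: "nat \<Rightarrow> nat"
  assumes inj: "inj_on \<sigma> {..<n}" and range: "\<And>i. i < n \<Longrightarrow> \<sigma> i < n"
    and step: "\<And>i. Suc i < n \<Longrightarrow> \<sigma> (Suc i) = Suc (\<sigma> i) \<or> \<sigma> i = Suc (\<sigma> (Suc i))"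
  shows "(\<forall>i<n. \<sigma> i = i) \<or> (\<forall>i<n. \<sigma> i = n - 1 - i)"
proof (cases "Suc 0 < n")
  case False
  then have "n = 0 \<or> n = 1" by linarith
  then show ?thesis using range by auto
next
  case True
  define \<delta> where "\<delta> = int (\<sigma> 1) - int (\<sigma> 0)"
  have lin: "int (\<sigma> (Suc i)) = int (\<sigma> i) + \<delta> \<and> int (\<sigma> (Suc i)) = int (\<sigma> 0) + \<delta> * int (Suc i)" if "Suc i < n" for i
    using that
  proof (induction i)
    case (Suc i)
    have "\<sigma> (Suc (Suc i)) \<noteq> \<sigma> i" using inj_onD[OF inj, of "Suc (Suc i)" i] Suc.prems by auto
    then have "int (\<sigma> (Suc (Suc i))) = int (\<sigma> (Suc i)) + \<delta>"
      using step[of i] step[OF Suc.prems] Suc by auto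
    then show ?case using Suc by (simp add: algebra_simps)
  qed (simp add: \<delta>_def)
  have lin: "int (\<sigma> i) = int (\<sigma> 0) + \<delta> * int i" if "i < n" for i
    using lin[of "i - 1"] that by (cases i) auto
  have "\<delta> = 1 \<or> \<delta> = - 1" using step[OF True] by (auto simp: \<delta>_def)
  then show ?thesis
  proof
    assume \<delta>: "\<delta> = 1"
    then have "\<sigma> 0 = 0" using lin[of "n - 1"] range[of "n - 1"] True by simp
    then show ?thesis using lin \<delta> by simp
  next
    assume \<delta>: "\<delta> = - 1"
    then have "\<sigma> 0 = n - 1" using lin[of "n - 1"] range[of 0] True by simp
    then have "\<sigma> i = n - 1 - i" if "i < n" for i using lin[OF that] \<delta> that by simp
    then show ?thesis by blast
  qed
qed

locale word_pair_iso =
  fixes bs cs :: "block list" and f :: "nat \<times> nat \<Rightarrow> nat \<times> nat"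
  assumes bs: "\<And>b. b \<in> set bs \<Longrightarrow> is_block b" and cs: "\<And>b. b \<in> set cs \<Longrightarrow> is_block b"
    and bij: "bij_betw f (word_verts bs) (word_verts cs)"
    and adj: "\<And>p q. p \<in> word_verts bs \<Longrightarrow> q \<in> word_verts bs \<Longrightarrow> word_adj cs (f p) (f q) = word_adj bs p q"
begin

lemma f_verts: "p \<in> word_verts bs \<Longrightarrow> f p \<in> word_verts cs"
  using bij by (auto simp: bij_betw_def)

lemma same_block:
  assumes "p \<in> word_verts bs" "q \<in> word_verts bs" "fst p = fst q"
  shows "fst (f p) = fst (f q)"
proof -
  have arcs: "word_arcs bs \<subseteq> word_verts bs \<times> word_verts bs" by (auto simp: word_arcs_def word_adj_def)
  have "map_prod f f ` word_arcs bs \<subseteq> word_arcs cs"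
  proof (rule image_subsetI)
    fix e assume e: "e \<in> word_arcs bs"
    obtain p q where pq: "e = (p, q)" by (cases e)
    then have "p \<in> word_verts bs" "q \<in> word_verts bs" using e arcs by auto
    then show "map_prod f f e \<in> word_arcs cs" using adj[of p q] e pq by (simp add: word_arcs_def)
  qed
  then have "map_prod f f ` non_bridges (word_arcs bs) \<subseteq> non_bridges (word_arcs cs)"
    by (rule non_bridges_map[OF arcs bij_betw_imp_inj_on[OF bij]])
  then have "map_prod f f ` {(p, q) \<in> word_arcs bs. fst p = fst q} \<subseteq> {(p, q) \<in> word_arcs cs. fst p = fst q}"
    by (simp only: word_non_bridges[where bs = bs, OF bs] word_non_bridges[where bs = cs, OF cs])
  from rtrancl_map_prod[OF word_block_connected[OF bs assms] this]
  have "(f p, f q) \<in> {(p, q) \<in> word_arcs cs. fst p = fst q}\<^sup>*" .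
  from closed_set_rtrancl[OF this, of "{x. fst x = fst (f p)}"] show ?thesis by auto
qed

text \<open>Makes the situation symmetric, so that every statement about \<open>f\<close> also
  yields its converse.\<close>

lemma inverse: "word_pair_iso cs bs (inv_into (word_verts bs) f)"
proof
  let ?g = "inv_into (word_verts bs) f"
  show g: "bij_betw ?g (word_verts cs) (word_verts bs)" by (rule bij_betw_inv_into[OF bij])
  show "word_adj bs (?g p) (?g q) = word_adj cs p q" if "p \<in> word_verts cs" "q \<in> word_verts cs" for p q
  proof -
    have "?g p \<in> word_verts bs" "?g q \<in> word_verts bs" using g that by (auto simp: bij_betw_def)
    then show ?thesis using adj[of "?g p" "?g q"] bij_betw_inv_into_right[OF bij] that by simp
  qed
qed (use bs cs in auto)

definition \<sigma> :: "nat \<Rightarrow> nat" where "\<sigma> i = fst (f (i, 0))"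

lemma root_vert: "i < length bs \<Longrightarrow> (i, 0) \<in> word_verts bs"
  by (simp add: word_verts_def)

lemma fst_f: "p \<in> word_verts bs \<Longrightarrow> fst (f p) = \<sigma> (fst p)"
  using same_block[of p "(fst p, 0)"] root_vert by (auto simp: \<sigma>_def word_verts_def)

lemma \<sigma>_less: "i < length bs \<Longrightarrow> \<sigma> i < length cs"
  using f_verts[OF root_vert[of i]] by (auto simp: \<sigma>_def word_verts_def)

lemma same_block_converse:
  assumes "p \<in> word_verts bs" "q \<in> word_verts bs" "fst (f p) = fst (f q)"
  shows "fst p = fst q"
proof -
  interpret i: word_pair_iso cs bs "inv_into (word_verts bs) f" by (rule inverse)
  show ?thesis using i.same_block[OF f_verts[OF assms(1)] f_verts[OF assms(2)] assms(3)]
      bij_betw_inv_into_left[OF bij] assms by simp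
qed

lemma \<sigma>_inj: "inj_on \<sigma> {..<length bs}"
proof (rule inj_onI)
  fix i j assume "i \<in> {..<length bs}" "j \<in> {..<length bs}" "\<sigma> i = \<sigma> j"
  then show "i = j"
    using same_block_converse[OF root_vert root_vert, of i j] by (simp add: \<sigma>_def)
qed

lemma length_le: "length bs \<le> length cs"
proof -
  have "card (\<sigma> ` {..<length bs}) \<le> card {..<length cs}" by (intro card_mono) (auto intro: \<sigma>_less)
  then show ?thesis using card_image[OF \<sigma>_inj] by simp
qed

lemma block_eq:
  assumes i: "i < length bs"
  shows "cs ! \<sigma> i = bs ! i"
proof -
  let ?b = "bs ! i" and ?c = "cs ! \<sigma> i"
  let ?g = "\<lambda>x. snd (f (i, x))"
  have b: "is_block ?b" "is_block ?c" using bs cs i \<sigma>_less by simp_all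
  have v: "(i, x) \<in> word_verts bs" if "x < block_size ?b" for x using i that by (simp add: word_verts_def)
  have fg: "f (i, x) = (\<sigma> i, ?g x)" if "x < block_size ?b" for x
    using fst_f[OF v[OF that]] by (metis fst_conv prod.collapse)
  have gl: "?g x < block_size ?c" if "x < block_size ?b" for x
    using f_verts[OF v[OF that]] fg[OF that] by (auto simp: word_verts_def)
  have inj: "inj_on ?g {..<block_size ?b}"
  proof (rule inj_onI)
    fix x y assume xy: "x \<in> {..<block_size ?b}" "y \<in> {..<block_size ?b}" "?g x = ?g y"
    then have "f (i, x) = f (i, y)" using fg[of x] fg[of y] by (metis lessThan_iff)
    then have "(i, x) = (i, y)" using inj_onD[OF bij_betw_imp_inj_on[OF bij]] v xy by blast
    then show "x = y" by simp
  qed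
  have surj: "?g ` {..<block_size ?b} = {..<block_size ?c}"
  proof (intro equalityI subsetI)
    fix y assume y: "y \<in> {..<block_size ?c}"
    then have "(\<sigma> i, y) \<in> word_verts cs" using \<sigma>_less[OF i] by (simp add: word_verts_def)
    then have "(\<sigma> i, y) \<in> f ` word_verts bs" using bij by (simp add: bij_betw_def)
    then obtain p where p: "p \<in> word_verts bs" "f p = (\<sigma> i, y)" by (metis imageE)
    then have "fst p = i" using same_block_converse[OF p(1) v[of 0]] by (simp add: \<sigma>_def)
    then have "p = (i, snd p)" "snd p < block_size ?b" using p(1) by (auto simp: word_verts_def)
    then show "y \<in> ?g ` {..<block_size ?b}" using p(2) by (metis image_eqI lessThan_iff snd_conv)
  qed (use gl in auto)
  have "?b = ?c"
  proof (rule block_iso_eq[OF b, of ?g])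
    show "bij_betw ?g {..<block_size ?b} {..<block_size ?c}" using inj surj by (simp add: bij_betw_def)
    fix x y assume xy: "x < block_size ?b" "y < block_size ?b"
    have "word_adj bs (i, x) (i, y) = badj ?b x y" using v xy by (simp add: word_adj_def chain_edge_def)
    moreover have "word_adj cs (f (i, x)) (f (i, y)) = badj ?c (?g x) (?g y)"
      using f_verts v xy fst_f[OF v[OF xy(1)]] fst_f[OF v[OF xy(2)]]
      by (simp add: word_adj_def chain_edge_def)
    ultimately show "badj ?c (?g x) (?g y) = badj ?b x y" using adj v xy by simp
  qed
  then show ?thesis by simp
qed

text \<open>The bridge between two consecutive blocks is mapped to an edge between different blocks,
  hence between neighbouring ones.\<close>

lemma \<sigma>_step:
  assumes "Suc i < length bs"
  shows "\<sigma> (Suc i) = Suc (\<sigma> i) \<or> \<sigma> i = Suc (\<sigma> (Suc i))"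
proof -
  let ?p = "(i, out_port (bs ! i))" and ?q = "(Suc i, 0)"
  have v: "?p \<in> word_verts bs" "?q \<in> word_verts bs" using assms by (auto simp: word_verts_def)
  then have "word_adj bs ?p ?q" by (simp add: word_adj_def chain_edge_def)
  then have a: "word_adj cs (f ?p) (f ?q)" using adj v by simp
  have "\<sigma> i \<noteq> \<sigma> (Suc i)" using inj_onD[OF \<sigma>_inj, of i "Suc i"] assms by auto
  then show ?thesis using a fst_f[OF v(1)] fst_f[OF v(2)] by (auto simp: word_adj_def chain_edge_def)
qed

text \<open>An isomorphism preserves non-bridges, so it maps blocks onto equal blocks, at positions
  given by \<open>\<sigma>\<close>. Being injective with unit steps, \<open>\<sigma>\<close> is the
  identity or the reversal.\<close>

theorem words_eq: "cs = bs \<or> cs = rev bs"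
proof -
  interpret i: word_pair_iso cs bs "inv_into (word_verts bs) f" by (rule inverse)
  have n: "length cs = length bs" using length_le i.length_le by simp
  from unit_step_injection[OF \<sigma>_inj _ \<sigma>_step] \<sigma>_less n
  have "(\<forall>i<length bs. \<sigma> i = i) \<or> (\<forall>i<length bs. \<sigma> i = length bs - 1 - i)" by auto
  then show ?thesis
  proof
    assume "\<forall>i<length bs. \<sigma> i = i"
    then have "cs = bs" using n block_eq by (intro nth_equalityI) auto
    then show ?thesis ..
  next
    assume s: "\<forall>i<length bs. \<sigma> i = length bs - 1 - i"
    have "rev cs = bs"
      using n block_eq s by (intro nth_equalityI) (auto simp: rev_nth)
    then show ?thesis by auto
  qed
qed

end

section \<open>Distances, girth and diameter\<close>

context cubic_graph
begin

lemma bfs_less: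
  assumes "x \<in> V" "y \<in> V" "\<forall>z\<in>V. (x, z) \<in> E\<^sup>*"
  shows "(x, y) \<in> E ^^ bfs E x y"
  using bfs_relpow[OF sub assms(3,1,2)] .

end

lemma (in pair_wf_digraph) awalk_relpow:
  "(\<exists>p. awalk u p v \<and> length p = k) \<longleftrightarrow> u \<in> pverts G \<and> (u, v) \<in> parcs G ^^ k"
proof (induction k arbitrary: u)
  case 0
  then show ?case by (auto simp: awalk_Nil_iff)
next
  case (Suc k)
  have "(\<exists>p. awalk u p v \<and> length p = Suc k) \<longleftrightarrow>
      (\<exists>x. (u, x) \<in> parcs G \<and> (\<exists>p. awalk x p v \<and> length p = k))"
    by (auto simp: length_Suc_conv awalk_Cons_iff) (metis awalk_Cons_iff fst_conv snd_conv with_proj_simps(2,4,5) length_Cons)+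
  also have "\<dots> \<longleftrightarrow> u \<in> pverts G \<and> (\<exists>x. (u, x) \<in> parcs G \<and> (x, v) \<in> parcs G ^^ k)"
    unfolding Suc.IH by (auto dest: in_arcsD1 in_arcsD2)
  also have "(\<exists>x. (u, x) \<in> parcs G \<and> (x, v) \<in> parcs G ^^ k) \<longleftrightarrow> (u, v) \<in> parcs G ^^ Suc k"
    by (meson relpow_Suc_D2 relpow_Suc_I2)
  finally show ?case .
qed

lemma (in pair_wf_digraph) distance_reachable:
  assumes "u \<in> pverts G" "(u, v) \<in> (parcs G)\<^sup>*"
  shows "distance G u v = ereal (real (bfs (parcs G) u v))"
proof -
  have cost: "awalk_cost (\<lambda>_. 1) p = real (length p)" for p :: "('a \<times> 'a) list"
    by (induction p) auto
  have "\<exists>k. (u, v) \<in> parcs G ^^ k" using assms(2) by (auto simp: rtrancl_is_UN_relpow)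
  then have "(u, v) \<in> parcs G ^^ bfs (parcs G) u v" unfolding bfs_def by (rule LeastI_ex)
  then obtain p where p: "awalk u p v" "length p = bfs (parcs G) u v"
    using awalk_relpow assms(1) by blast
  show ?thesis unfolding distance_def
  proof (rule antisym)
    show "\<mu> (\<lambda>_. 1) u v \<le> ereal (real (bfs (parcs G) u v))"
      using min_cost_le_walk_cost[OF p(1), of "\<lambda>_. 1"] p(2) by (simp add: cost)
    show "ereal (real (bfs (parcs G) u v)) \<le> \<mu> (\<lambda>_. 1) u v"
      unfolding \<mu>_def
    proof (rule INF_greatest)
      fix q assume "q \<in> {p. awalk u p v}"
      then have "(u, v) \<in> parcs G ^^ length q" using awalk_relpow by blast
      then have "bfs (parcs G) u v \<le> length q" unfolding bfs_def by (rule Least_le)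
      then show "ereal (real (bfs (parcs G) u v)) \<le> ereal (awalk_cost (\<lambda>_. 1) q)" by (simp add: cost)
    qed
  qed
qed

lemma (in pair_wf_digraph) distance_unreachable:
  assumes "(u, v) \<notin> (parcs G)\<^sup>*"
  shows "distance G u v = \<infinity>"
proof -
  have "{p. awalk u p v} = {}"
    using awalk_relpow assms relpow_imp_rtrancl by blast
  then show ?thesis by (simp add: distance_def \<mu>_def top_ereal_def)
qed

lemma (in pair_wf_digraph) diameter_eqD:
  assumes d: "diameter G = ereal (real d)" and "0 < d"
  shows "\<And>x y. x \<in> pverts G \<Longrightarrow> y \<in> pverts G \<Longrightarrow> (x, y) \<in> (parcs G)\<^sup>*"
    and "\<And>x y. x \<in> pverts G \<Longrightarrow> y \<in> pverts G \<Longrightarrow> bfs (parcs G) x y \<le> d"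
    and "\<exists>x\<in>pverts G. \<exists>y\<in>pverts G. bfs (parcs G) x y = d"
proof -
  have le: "distance G x y \<le> ereal (real d)" if "x \<in> pverts G" "y \<in> pverts G" for x y
    unfolding d[symmetric] diameter_def using that by (meson SUP_upper2 order_refl)
  show reach: "(x, y) \<in> (parcs G)\<^sup>*" if "x \<in> pverts G" "y \<in> pverts G" for x y
    using le[OF that] distance_unreachable[of x y] by force
  show bfs: "bfs (parcs G) x y \<le> d" if "x \<in> pverts G" "y \<in> pverts G" for x y
    using le[OF that] distance_reachable[OF that(1) reach[OF that]] by simp
  show "\<exists>x\<in>pverts G. \<exists>y\<in>pverts G. bfs (parcs G) x y = d"
  proof (rule ccontr)
    assume n: "\<not> ?thesis"
    \<comment> \<open>Distances are natural numbers: if \<open>d\<close> is not attained,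
      \<open>d - 1\<close> is an upper bound.\<close>
    have "distance G x y \<le> ereal (real (d - 1))" if "x \<in> pverts G" "y \<in> pverts G" for x y
    proof -
      have "bfs (parcs G) x y \<le> d - 1" using bfs[OF that] n that by fastforce
      then show ?thesis using distance_reachable[OF that(1) reach[OF that]] by simp
    qed
    then have "diameter G \<le> ereal (real (d - 1))" unfolding diameter_def by (intro SUP_least)
    then show False using d \<open>0 < d\<close> by simp
  qed
qed

lemma (in pair_wf_digraph) diameter_eqI:
  assumes "\<And>x y. x \<in> pverts G \<Longrightarrow> y \<in> pverts G \<Longrightarrow> (x, y) \<in> (parcs G)\<^sup>*"
    and "\<And>x y. x \<in> pverts G \<Longrightarrow> y \<in> pverts G \<Longrightarrow> bfs (parcs G) x y \<le> d"
    and uv: "u \<in> pverts G" "v \<in> pverts G" "bfs (parcs G) u v = d"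
  shows "diameter G = ereal (real d)"
  unfolding diameter_def
proof (rule antisym)
  show "(SUP u\<in>pverts G. SUP v\<in>pverts G. distance G u v) \<le> ereal (real d)"
    by (intro SUP_least) (use assms distance_reachable in auto)
  have "ereal (real d) \<le> distance G u v" using distance_reachable assms by simp
  then show "ereal (real d) \<le> (SUP u\<in>pverts G. SUP v\<in>pverts G. distance G u v)"
    using uv(1,2) by (meson SUP_upper2)
qed

lemma (in pair_wf_digraph) girth_4_triangle_free:
  assumes g: "girth G = enat 4" and irr: "\<And>x. (x, x) \<notin> parcs G"
    and e: "(x, y) \<in> parcs G" "(y, z) \<in> parcs G"
  shows "(z, x) \<notin> parcs G"
proof
  assume zx: "(z, x) \<in> parcs G"
  have "x \<noteq> y" "y \<noteq> z" "z \<noteq> x" using irr e zx by auto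
  then have "cycle [(x, y), (y, z), (z, x)]"
    using e zx in_arcsD1 in_arcsD2 by (auto simp: cycle_def awalk_def intro!: exI[of _ x])
  then have "girth G \<le> enat 3"
    unfolding girth_def by (intro INF_lower2[of "[(x, y), (y, z), (z, x)]"]) auto
  then show False using g by simp
qed

lemma (in pair_wf_digraph) girth_4I:
  assumes tf: "\<And>x y z. (x, y) \<in> parcs G \<Longrightarrow> (y, z) \<in> parcs G \<Longrightarrow> (z, x) \<notin> parcs G"
    and c: "(x, y) \<in> parcs G" "(y, z) \<in> parcs G" "(z, t) \<in> parcs G" "(t, x) \<in> parcs G"
    and ne: "distinct [x, y, z, t]"
  shows "girth G = enat 4"
  unfolding girth_def
proof (rule antisym)
  have "cycle [(x, y), (y, z), (z, t), (t, x)]"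
    using c ne in_arcsD1 by (auto simp: cycle_def awalk_def intro!: exI[of _ x])
  then show "(INF c\<in>{c. cycle c \<and> 3 \<le> length c}. enat (length c)) \<le> enat 4"
    by (intro INF_lower2[of "[(x, y), (y, z), (z, t), (t, x)]"]) auto
  show "enat 4 \<le> (INF c\<in>{c. cycle c \<and> 3 \<le> length c}. enat (length c))"
  proof (rule INF_greatest)
    fix p assume p: "p \<in> {c. cycle c \<and> 3 \<le> length c}"
    have "length p \<noteq> 3"
    proof
      assume "length p = 3"
      then obtain e1 e2 e3 where [simp]: "p = [e1, e2, e3]"
        by (auto simp: numeral_3_eq_3 length_Suc_conv)
      obtain u where u: "awalk u p u" using p by (auto simp: cycle_def)
      then have "(fst e1, snd e1) \<in> parcs G" "(snd e1, snd e2) \<in> parcs G" "(snd e2, fst e1) \<in> parcs G"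
        by (auto simp: awalk_def) (metis prod.collapse)+
      then show False using tf by blast
    qed
    then show "enat 4 \<le> enat (length p)" using p by simp
  qed
qed

lemma pair_graph_wf:
  assumes "pair_graph G"
  shows "pair_wf_digraph G"
proof -
  interpret pair_graph G by (rule assms)
  show ?thesis by (rule pair_wf_digraph)
qed

lemma kgd_graph_cubic:
  assumes "kgd_graph 3 4 d G" "0 < d"
  shows "cubic_graph (parcs G) (pverts G)"
proof -
  have G: "pair_graph G" "regular 3 G" "girth G = enat 4" using assms by (auto simp: kgd_graph_def numeral_eq_enat)
  interpret pair_graph G by fact
  have irr: "(x, x) \<notin> parcs G" for x using no_loops' by auto
  show ?thesis
  proof
    show "finite (pverts G)" by simp
    show "parcs G \<subseteq> pverts G \<times> pverts G" using in_arcsD1 in_arcsD2 by auto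
    show sym: "(x, y) \<in> parcs G \<Longrightarrow> (y, x) \<in> parcs G" for x y by (rule arcs_symmetric)
    show "(x, x) \<notin> parcs G" for x by (fact irr)
    show "(x, y) \<in> parcs G \<Longrightarrow> (y, z) \<in> parcs G \<Longrightarrow> (x, z) \<notin> parcs G" for x y z
      using girth_4_triangle_free[OF G(3) irr] sym by blast
    show "card {y. (x, y) \<in> parcs G} = 3" if "x \<in> pverts G" for x
    proof -
      have "out_arcs G x = Pair x ` {y. (x, y) \<in> parcs G}" by auto
      then have "card (out_arcs G x) = card {y. (x, y) \<in> parcs G}" by (simp add: card_image inj_on_def)
      then show ?thesis using G(2) that by (simp add: regular_def out_degree_def)
    qed
  qed
qed

lemma cubic_kgd_graph:
  assumes C: "cubic_graph (parcs G) (pverts G)"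
    and reach: "\<And>x y. x \<in> pverts G \<Longrightarrow> y \<in> pverts G \<Longrightarrow> (x, y) \<in> (parcs G)\<^sup>*"
    and diam: "\<And>x y. x \<in> pverts G \<Longrightarrow> y \<in> pverts G \<Longrightarrow> bfs (parcs G) x y \<le> d"
    and uv: "u \<in> pverts G" "v \<in> pverts G" "bfs (parcs G) u v = d"
    and c: "(x, y) \<in> parcs G" "(y, z) \<in> parcs G" "(z, t) \<in> parcs G" "(t, x) \<in> parcs G" "distinct [x, y, z, t]"
  shows "kgd_graph 3 4 d G"
proof -
  interpret C: cubic_graph "parcs G" "pverts G" by (rule C)
  have "pair_graph G"
  proof (unfold_locales)
    show "finite (pverts G)" by (rule C.fin)
    show "finite (parcs G)" using C.fin C.sub by (meson finite_SigmaI finite_subset)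
    show "fst e \<in> pverts G" "snd e \<in> pverts G" if "e \<in> parcs G" for e using that C.sub by auto
    show "fst e \<noteq> snd e" if "e \<in> parcs G" for e using that C.adj_irrefl by (metis prod.collapse)
    show "symmetric (with_proj G)" using C.adj_sym by (auto simp: symmetric_def intro: symI)
  qed
  then interpret pair_graph G .
  have "regular 3 G"
    unfolding regular_def
  proof
    fix x assume x: "x \<in> pverts G"
    have "out_arcs G x = Pair x ` {y. (x, y) \<in> parcs G}" by auto
    then have "card (out_arcs G x) = card {y. (x, y) \<in> parcs G}" by (simp add: card_image inj_on_def)
    then show "out_degree (with_proj G) x = 3" using C.deg[OF x] by (simp add: out_degree_def)
  qed
  moreover have "girth G = enat 4"
    by (rule girth_4I[OF _ c]) (use C.triangle_free C.adj_sym in blast)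
  moreover have "diameter G = ereal (real d)"
    by (rule diameter_eqI[OF reach diam uv])
  ultimately show ?thesis using \<open>pair_graph G\<close> by (simp add: kgd_graph_def numeral_eq_enat)
qed

section \<open>The graph of a word\<close>

text \<open>Cages are graphs on the natural numbers, so the pairs of block position and label are
  encoded.\<close>

definition word_graph :: "block list \<Rightarrow> nat pair_pre_digraph" where
  "word_graph bs = \<lparr>pverts = prod_encode ` word_verts bs,
     parcs = map_prod prod_encode prod_encode ` word_arcs bs\<rparr>"

lemma prod_encode_arc_iff:
  "(prod_encode p, prod_encode q) \<in> parcs (word_graph bs) \<longleftrightarrow> word_adj bs p q"
  by (auto simp: word_graph_def word_arcs_def)

lemma word_graph_iso: "word_iso (parcs (word_graph bs)) (pverts (word_graph bs)) bs prod_encode"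
  by (simp add: word_iso_def prod_encode_arc_iff)
    (simp add: word_graph_def inj_on_imp_bij_betw inj_prod_encode)

lemma word_iso_unique:
  assumes f: "word_iso E V bs f" and g: "word_iso E V cs g"
    and bs: "\<And>b. b \<in> set bs \<Longrightarrow> is_block b" and cs: "\<And>b. b \<in> set cs \<Longrightarrow> is_block b"
  shows "cs = bs \<or> cs = rev bs"
proof -
  let ?h = "inv_into (word_verts cs) g"
  have gb: "bij_betw g (word_verts cs) V" and fb: "bij_betw f (word_verts bs) V"
    using f g by (auto simp: word_iso_def)
  have hb: "bij_betw ?h V (word_verts cs)" by (rule bij_betw_inv_into[OF gb])
  have "word_pair_iso bs cs (?h \<circ> f)"
  proof
    show "bij_betw (?h \<circ> f) (word_verts bs) (word_verts cs)" using fb hb by (rule bij_betw_trans)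
    fix p q assume pq: "p \<in> word_verts bs" "q \<in> word_verts bs"
    have V: "f p \<in> V" "f q \<in> V" using pq fb by (auto simp: bij_betw_def)
    then have "?h (f p) \<in> word_verts cs" "?h (f q) \<in> word_verts cs" using hb by (auto simp: bij_betw_def)
    moreover have "g (?h (f p)) = f p" "g (?h (f q)) = f q"
      using V bij_betw_inv_into_right[OF gb] by auto
    ultimately show "word_adj cs ((?h \<circ> f) p) ((?h \<circ> f) q) = word_adj bs p q"
      using f g pq unfolding word_iso_def by (metis comp_apply)
  qed (use bs cs in auto)
  then show ?thesis by (rule word_pair_iso.words_eq)
qed

lemma word_iso_digraph_iso:
  assumes G: "pair_wf_digraph G" and g: "word_iso (parcs G) (pverts G) bs g"
    and W: "pair_wf_digraph (word_graph bs)"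
  shows "digraph_iso (with_proj (word_graph bs)) (with_proj G)"
proof -
  interpret pair_wf_digraph G by fact
  let ?f = "g \<circ> prod_decode"
  have gb: "bij_betw g (word_verts bs) (pverts G)" using g by (simp add: word_iso_def)
  have "inj_on ?f (pverts (word_graph bs))"
    using bij_betw_imp_inj_on[OF gb] by (auto simp: word_graph_def inj_on_def)
  moreover have "pverts G = ?f ` pverts (word_graph bs)"
    using gb by (simp add: word_graph_def image_image bij_betw_def)
  moreover have "parcs G = map_prod ?f ?f ` parcs (word_graph bs)"
  proof -
    have "map_prod ?f ?f ` parcs (word_graph bs) = map_prod g g ` word_arcs bs"
      by (simp add: word_graph_def image_image map_prod_def case_prod_unfold)
    moreover have "parcs G = map_prod g g ` word_arcs bs"
    proof (intro equalityI subsetI)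
      fix e assume e: "e \<in> parcs G"
      obtain x y where xy: "e = (x, y)" by (cases e)
      then have "x \<in> pverts G" "y \<in> pverts G" using e in_arcsD1 in_arcsD2 by auto
      then have "x \<in> g ` word_verts bs" "y \<in> g ` word_verts bs" using gb by (simp_all add: bij_betw_def)
      then obtain p q where pq: "p \<in> word_verts bs" "q \<in> word_verts bs" "x = g p" "y = g q"
        by blast
      then have "word_adj bs p q" using g e xy by (simp add: word_iso_def)
      then show "e \<in> map_prod g g ` word_arcs bs" using pq xy by (force simp: word_arcs_def)
    next
      fix e assume "e \<in> map_prod g g ` word_arcs bs"
      then obtain p q where "word_adj bs p q" "e = (g p, g q)" by (auto simp: word_arcs_def)
      moreover from this have "p \<in> word_verts bs" "q \<in> word_verts bs" by (auto simp: word_adj_def)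
      ultimately show "e \<in> parcs G" using g by (simp add: word_iso_def)
    qed
    ultimately show ?thesis by simp
  qed
  ultimately show ?thesis unfolding digraph_iso_pair_iff[OF W] by blast
qed

lemma digraph_iso_word_iso:
  assumes W: "pair_wf_digraph (word_graph bs)" and iso: "digraph_iso (with_proj (word_graph bs)) (with_proj G)"
  shows "\<exists>f. word_iso (parcs G) (pverts G) bs f"
proof -
  let ?W = "word_graph bs"
  obtain f where f: "inj_on f (pverts ?W)" "pverts G = f ` pverts ?W" "parcs G = map_prod f f ` parcs ?W"
    using iffD1[OF digraph_iso_pair_iff[OF W] iso] by (elim exE conjE)
  have e: "bij_betw prod_encode (word_verts bs) (pverts ?W)" using word_graph_iso by (simp add: word_iso_def)
  have "bij_betw (f \<circ> prod_encode) (word_verts bs) (pverts G)"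
    by (rule bij_betw_trans[OF e]) (simp add: bij_betw_def f)
  moreover have "((f \<circ> prod_encode) p, (f \<circ> prod_encode) q) \<in> parcs G \<longleftrightarrow> word_adj bs p q"
    if "p \<in> word_verts bs" "q \<in> word_verts bs" for p q
  proof -
    interpret pair_wf_digraph ?W by (rule W)
    have V: "prod_encode p \<in> pverts ?W" "prod_encode q \<in> pverts ?W" using that e by (auto simp: bij_betw_def)
    have "((f \<circ> prod_encode) p, (f \<circ> prod_encode) q) \<in> parcs G \<longleftrightarrow> (prod_encode p, prod_encode q) \<in> parcs ?W"
    proof
      assume "((f \<circ> prod_encode) p, (f \<circ> prod_encode) q) \<in> parcs G"
      then obtain x y where xy: "(x, y) \<in> parcs ?W" "f x = f (prod_encode p)" "f y = f (prod_encode q)"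
        unfolding f(3) by auto
      have "x = prod_encode p" "y = prod_encode q"
        using inj_onD[OF f(1)] xy V in_arcsD1 in_arcsD2 by blast+
      then show "(prod_encode p, prod_encode q) \<in> parcs ?W" using xy by simp
    qed (auto simp: f(3))
    then show ?thesis by (simp add: prod_encode_arc_iff)
  qed
  ultimately show ?thesis by (auto simp: word_iso_def)
qed

section \<open>Degrees, connectedness and diameter of word graphs\<close>

lemma word_adj_fst: "word_adj bs p q \<Longrightarrow> fst p = fst q \<or> fst p = Suc (fst q) \<or> fst q = Suc (fst p)"
  by (auto simp: word_adj_def chain_edge_def)

lemma word_adj_cross_unique:
  assumes "word_adj bs p q" "word_adj bs p' q'" "fst p \<noteq> fst q" "fst p = fst p'" "fst q = fst q'"
  shows "p = p' \<and> q = q'"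
proof -
  have "chain_edge bs p q \<or> chain_edge bs q p" "chain_edge bs p' q' \<or> chain_edge bs q' p'"
    using assms by (auto simp: word_adj_def)
  then show ?thesis
    using assms(3-5) by (elim disjE) (simp_all add: chain_edge_def prod_eq_iff)
qed

lemma word_adj_irrefl:
  assumes "\<And>b. b \<in> set bs \<Longrightarrow> is_block b"
  shows "\<not> word_adj bs p p"
  using assms badj_irrefl by (auto simp: word_adj_def chain_edge_def word_verts_def)

text \<open>Three mutually adjacent vertices cannot lie in three different blocks. If two lie in one
  block and the third in another, two edges join the same two blocks, contrary to
  \<open>word_adj_cross_unique\<close>.\<close>

lemma word_adj_triangle_free:
  assumes bs: "\<And>b. b \<in> set bs \<Longrightarrow> is_block b" and pq: "word_adj bs p q" and qr: "word_adj bs q r"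
  shows "\<not> word_adj bs p r"
proof
  assume pr: "word_adj bs p r"
  note irr = word_adj_irrefl[where bs = bs, OF bs]
  consider "fst p = fst q" "fst q = fst r" | "fst p = fst q" "fst q \<noteq> fst r" | "fst p = fst r" "fst q \<noteq> fst r"
    | "fst q = fst r" "fst p \<noteq> fst q"
    using word_adj_fst[OF pq] word_adj_fst[OF qr] word_adj_fst[OF pr] by linarith
  then show False
  proof cases
    case 1
    have "fst p < length bs" using pq by (auto simp: word_adj_def word_verts_def)
    then have b: "is_block (bs ! fst p)" using bs by simp
    show ?thesis using badj_triangle_free[OF b, of "snd p" "snd q" "snd r"] pq qr pr 1
      by (auto simp: word_adj_def chain_edge_def)
  next
    case 2
    then show ?thesis using word_adj_cross_unique[OF pr qr] pq irr by auto
  next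
    case 3
    then show ?thesis using word_adj_cross_unique[OF pq, of r q] qr word_adj_sym pr irr by auto
  next
    case 4
    then show ?thesis using word_adj_cross_unique[OF pq pr] qr irr by auto
  qed
qed

lemma full_word_nth:
  "length (full_word a ms b) = length ms + 2"
  "full_word a ms b ! 0 = End (fst a) (snd a)"
  "full_word a ms b ! Suc (length ms) = End (fst b) (snd b)"
  "0 < i \<Longrightarrow> i \<le> length ms \<Longrightarrow> full_word a ms b ! i = Mid (ms ! (i - 1))"
  by (auto simp: full_word_def nth_append nth_Cons')

text \<open>A port has two neighbours in its block and one across a bridge. In an end block
  \<open>0\<close> is also the out-port, but of the two possible bridges (\<open>?L\<close> and
  \<open>?R\<close>) only the one towards the inside of the word exists.\<close>

lemma full_word_degree:
  assumes ok: "full_word_ok a ms b" and p: "p \<in> word_verts (full_word a ms b)"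
  shows "card {q. word_adj (full_word a ms b) p q} = 3"
proof -
  let ?w = "full_word a ms b"
  obtain i x where px: "p = (i, x)" by (cases p)
  have i: "i < length ms + 2" "x < block_size (?w ! i)" using p px by (auto simp: word_verts_def full_word_nth)
  have bl: "is_block (?w ! i)" using full_word_blocks[OF ok] i(1) by (simp add: full_word_nth)
  let ?N = "Pair i ` {y. badj (?w ! i) x y}"
  let ?L = "if x = 0 \<and> 0 < i then {(i - 1, out_port (?w ! (i - 1)))} else {}"
  let ?R = "if x = out_port (?w ! i) \<and> i < Suc (length ms) then {(Suc i, 0)} else {}"
  have len: "length ?w = length ms + 2" by (rule full_word_nth)
  have pv: "(i, x) \<in> word_verts ?w" using p px by simp
  have eq: "{q. word_adj ?w p q} = ?N \<union> (?L \<union> ?R)"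
  proof (intro equalityI subsetI)
    fix q assume q: "q \<in> {q. word_adj ?w p q}"
    then have qv: "q \<in> word_verts ?w" by (simp add: word_adj_def)
    obtain j y where [simp]: "q = (j, y)" by (cases q)
    from q consider "j = i" "badj (?w ! i) x y" | "chain_edge ?w p q" | "chain_edge ?w q p"
      using px by (auto simp: word_adj_def)
    then show "q \<in> ?N \<union> (?L \<union> ?R)"
    proof cases
      case 2
      then have "j = Suc i" "x = out_port (?w ! i)" "y = 0" using px by (simp_all add: chain_edge_def)
      moreover from this have "i < Suc (length ms)" using qv len by (simp add: word_verts_def)
      ultimately show ?thesis by simp
    next
      case 3
      then have "i = Suc j" "y = out_port (?w ! j)" "x = 0" using px by (simp_all add: chain_edge_def)
      then show ?thesis by simp
    qed simp
  next
    fix q assume "q \<in> ?N \<union> (?L \<union> ?R)"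
    then consider y where "q = (i, y)" "badj (?w ! i) x y"
      | "x = 0" "0 < i" "q = (i - 1, out_port (?w ! (i - 1)))"
      | "x = out_port (?w ! i)" "i < Suc (length ms)" "q = (Suc i, 0)"
      by (auto split: if_splits)
    then have "word_adj ?w (i, x) q"
    proof cases
      case 1
      then have "q \<in> word_verts ?w" using badj_less[OF bl] i(1) len by (simp add: word_verts_def)
      then show ?thesis using 1 pv by (simp add: word_adj_def)
    next
      case 2
      then have "q \<in> word_verts ?w" using i(1) len by (simp add: word_verts_def)
      moreover have "chain_edge ?w q (i, x)" using 2 by (simp add: chain_edge_def)
      ultimately show ?thesis using pv by (simp add: word_adj_def)
    next
      case 3
      then have "q \<in> word_verts ?w" using len by (simp add: word_verts_def)
      moreover have "chain_edge ?w (i, x) q" using 3 by (simp add: chain_edge_def)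
      ultimately show ?thesis using pv by (simp add: word_adj_def)
    qed
    then show "q \<in> {q. word_adj ?w p q}" using px by simp
  qed
  have "{y. badj (?w ! i) x y} \<subseteq> {..<block_size (?w ! i)}" using badj_less[OF bl] by auto
  then have fN: "finite ?N" using finite_subset by blast
  have d: "?N \<inter> (?L \<union> ?R) = {}" "?L \<inter> ?R = {}" by auto
  have "card {q. word_adj ?w p q} = card ?N + (card ?L + card ?R)"
    unfolding eq using fN d by (subst card_Un_disjoint) (auto simp: card_Un_disjoint)
  also have "card ?N = (if x = 0 \<or> x = out_port (?w ! i) then 2 else 3)"
    using badj_degree[OF bl i(2)] by (simp add: card_image inj_on_def)
  finally have c: "card {q. word_adj ?w p q} = (if x = 0 \<or> x = out_port (?w ! i) then 2 else 3) + (card ?L + card ?R)" .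
  consider "i = 0" | "i = Suc (length ms)" | "0 < i" "i \<le> length ms" using i(1) by linarith
  then show ?thesis
  proof cases
    case 1
    then have "out_port (?w ! i) = 0" by (simp add: full_word_nth)
    then show ?thesis using c 1 i(2) by (cases "x = 0") simp_all
  next
    case 2
    then have "out_port (?w ! i) = 0" by (simp add: full_word_nth)
    then show ?thesis using c 2 by (cases "x = 0") simp_all
  next
    case 3
    then have "out_port (?w ! i) \<noteq> 0" by (simp add: full_word_nth)
    then show ?thesis using c 3 by (cases "x = 0"; cases "x = out_port (?w ! i)") simp_all
  qed
qed

lemma word_connected:
  assumes bs: "\<And>b. b \<in> set bs \<Longrightarrow> is_block b" and "p \<in> word_verts bs"
  shows "(p, (0, 0)) \<in> (word_arcs bs)\<^sup>*"
  using assms(2)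
proof (induction "fst p" arbitrary: p rule: less_induct)
  case less
  have n: "fst p < length bs" using less.prems by (auto simp: word_verts_def)
  have r: "(fst p, 0) \<in> word_verts bs" using n by (simp add: word_verts_def)
  let ?S = "{(p, q) \<in> word_arcs bs. fst p = fst q}"
  have "(p, (fst p, 0)) \<in> ?S\<^sup>*"
    using word_block_connected[where bs = bs, OF bs less.prems r] by simp
  moreover have "?S\<^sup>* \<subseteq> (word_arcs bs)\<^sup>*" by (rule rtrancl_mono) auto
  ultimately have 1: "(p, (fst p, 0)) \<in> (word_arcs bs)\<^sup>*" by (rule rev_subsetD)
  show ?case
  proof (cases "fst p = 0")
    case True
    then show ?thesis using 1 by simp
  next
    case False
    let ?q = "(fst p - 1, out_port (bs ! (fst p - 1)))"
    have q: "?q \<in> word_verts bs" using n False by (auto simp: word_verts_def)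
    then have "((fst p, 0), ?q) \<in> word_arcs bs"
      using r False by (auto simp: word_arcs_def word_adj_def chain_edge_def)
    moreover have "(?q, (0, 0)) \<in> (word_arcs bs)\<^sup>*" using less.hyps[of ?q] q False by simp
    ultimately show ?thesis using 1 by (meson converse_rtrancl_into_rtrancl rtrancl_trans)
  qed
qed

lemma word_connected_all:
  assumes bs: "\<And>b. b \<in> set bs \<Longrightarrow> is_block b" and "p \<in> word_verts bs" "q \<in> word_verts bs"
  shows "(p, q) \<in> (word_arcs bs)\<^sup>*"
proof -
  have "sym (word_arcs bs)" by (auto simp: sym_def word_arcs_def word_adj_sym)
  then have "((0, 0), q) \<in> (word_arcs bs)\<^sup>*"
    using word_connected[where bs = bs and p = q, OF bs assms(3)] by (meson sym_rtrancl symD)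
  with word_connected[where bs = bs and p = p, OF bs assms(2)] show ?thesis by (rule rtrancl_trans)
qed

text \<open>A vertex gets its distance from the far side of the first block; the first block is
  traversed from its far side towards its port, the others from their in-port.\<close>

definition word_height :: "block list \<Rightarrow> nat \<times> nat \<Rightarrow> int" where
  "word_height bs p = (\<Sum>k<fst p. int (block_len (bs ! k))) +
     (if fst p = 0 then int (block_len (bs ! 0)) - 1 - int (height (bs ! 0) (snd p))
      else int (height (bs ! fst p) (snd p)))"

lemma word_height_step:
  assumes ok: "full_word_ok a ms b" and adj: "word_adj (full_word a ms b) p q"
  shows "word_height (full_word a ms b) q \<le> word_height (full_word a ms b) p + 1"
proof -
  let ?w = "full_word a ms b"
  have bl: "is_block (?w ! i)" if "i < length ms + 2" for i
    using full_word_blocks[OF ok] that by (simp add: full_word_nth)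
  have chain: "word_height ?w q = word_height ?w p + 1"
    if c: "chain_edge ?w p q" "p \<in> word_verts ?w" "q \<in> word_verts ?w" for p q
  proof -
    obtain i where i: "p = (i, out_port (?w ! i))" "q = (Suc i, 0)" "i < Suc (length ms)"
      using c by (cases p; cases q) (auto simp: chain_edge_def word_verts_def full_word_nth)
    have h0: "height (?w ! Suc i) 0 = 0" using height_0[OF bl[of "Suc i"]] i(3) by simp
    show ?thesis
    proof (cases "i = 0")
      case True
      have "out_port (?w ! 0) = 0" "height (?w ! 0) 0 = 0"
        using height_0[OF bl[of 0]] by (simp_all add: full_word_nth)
      then show ?thesis using i h0 True by (simp add: word_height_def)
    next
      case False
      then have "?w ! i = Mid (ms ! (i - 1))" using i(3) by (simp add: full_word_nth)
      then have "Suc (height (?w ! i) (out_port (?w ! i))) = block_len (?w ! i)"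
        using height_out_port bl[of i] i(3) by (metis add_2_eq_Suc' less_SucI)
      then show ?thesis using i h0 False by (simp add: word_height_def)
    qed
  qed
  have v: "p \<in> word_verts ?w" "q \<in> word_verts ?w" using adj by (auto simp: word_adj_def)
  consider "fst p = fst q" "badj (?w ! fst p) (snd p) (snd q)" | "chain_edge ?w p q" | "chain_edge ?w q p"
    using adj by (auto simp: word_adj_def)
  then show ?thesis
  proof cases
    case 1
    have "fst p < length ms + 2" using v by (auto simp: word_verts_def full_word_nth)
    from bl[OF this] have "height (?w ! fst p) (snd q) \<le> Suc (height (?w ! fst p) (snd p))"
      "height (?w ! fst p) (snd p) \<le> Suc (height (?w ! fst p) (snd q))"
      using height_step 1 bk_adj_sym by blast+
    then show ?thesis using 1 by (cases "fst q = 0") (simp_all add: word_height_def)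
  next
    case 2
    then show ?thesis using chain v by simp
  next
    case 3
    then show ?thesis using chain[of q p] v by simp
  qed
qed

lemma word_height_ends:
  assumes ok: "full_word_ok a ms b"
  shows "\<exists>u\<in>word_verts (full_word a ms b). \<exists>v\<in>word_verts (full_word a ms b).
    word_height (full_word a ms b) v - word_height (full_word a ms b) u = int (word_len (full_word a ms b)) - 1"
proof -
  let ?w = "full_word a ms b"
  have be: "is_block (End (fst a) (snd a))" "is_block (End (fst b) (snd b))"
    using ok by (simp_all add: full_word_ok_def is_block_End)
  obtain x where x: "x < block_size (End (fst a) (snd a))" "Suc (height (End (fst a) (snd a)) x) = block_len (End (fst a) (snd a))"
    using height_End[OF be(1)] by blast
  obtain y where y: "y < block_size (End (fst b) (snd b))" "Suc (height (End (fst b) (snd b)) y) = block_len (End (fst b) (snd b))"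
    using height_End[OF be(2)] by blast
  let ?u = "(0, x)" and ?v = "(Suc (length ms), y)"
  have 1: "?u \<in> word_verts ?w" "?v \<in> word_verts ?w"
    using x(1) y(1) by (simp_all add: word_verts_def full_word_nth)
  have 2: "word_height ?w ?u = 0" using x(2) by (simp add: word_height_def full_word_nth)
  have "int (word_len ?w) = (\<Sum>k<length ms + 2. int (block_len (?w ! k)))"
    by (simp add: word_len_def sum_list_sum_nth atLeast0LessThan full_word_nth)
  also have "\<dots> = (\<Sum>k<Suc (length ms). int (block_len (?w ! k))) + int (block_len (End (fst b) (snd b)))"
    by (simp add: full_word_nth)
  finally have "word_height ?w ?v = int (word_len ?w) - 1"
    using y(2) by (simp add: word_height_def full_word_nth)
  then show ?thesis using 1 2 by (metis diff_zero)
qed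

lemma word_graph_cubic:
  assumes ok: "full_word_ok a ms b"
  shows "cubic_graph (parcs (word_graph (full_word a ms b))) (pverts (word_graph (full_word a ms b)))"
proof
  let ?w = "full_word a ms b"
  let ?E = "parcs (word_graph ?w)" and ?V = "pverts (word_graph ?w)"
  note bl = full_word_blocks[OF ok]
  have E: "(x, y) \<in> ?E \<longleftrightarrow> word_adj ?w (prod_decode x) (prod_decode y)" for x y
    using prod_encode_arc_iff[of "prod_decode x" "prod_decode y" ?w] by simp
  have V: "x \<in> ?V \<longleftrightarrow> prod_decode x \<in> word_verts ?w" for x
    by (auto simp: word_graph_def) (metis image_eqI prod_decode_inverse)
  show "finite ?V" by (simp add: word_graph_def)
  show "?E \<subseteq> ?V \<times> ?V" by (auto simp: E V word_adj_def)
  show "(x, y) \<in> ?E \<Longrightarrow> (y, x) \<in> ?E" for x y using word_adj_sym by (simp add: E)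
  show "(x, x) \<notin> ?E" for x using word_adj_irrefl[where bs = ?w, OF bl] by (simp add: E)
  show "(x, y) \<in> ?E \<Longrightarrow> (y, z) \<in> ?E \<Longrightarrow> (x, z) \<notin> ?E" for x y z
    using word_adj_triangle_free[where bs = ?w, OF bl] by (simp add: E)
  show "card {y. (x, y) \<in> ?E} = 3" if "x \<in> ?V" for x
  proof -
    have "{y. (x, y) \<in> ?E} = prod_encode ` {q. word_adj ?w (prod_decode x) q}"
      by (auto simp: E) (metis image_eqI mem_Collect_eq prod_decode_inverse)
    then have "card {y. (x, y) \<in> ?E} = card {q. word_adj ?w (prod_decode x) q}"
      by (simp add: card_image inj_prod_encode)
    then show ?thesis using full_word_degree[OF ok] that V by simp
  qed
qed

text \<open>The potential \<open>word_height\<close> shows only that the diameter \<open>D\<close>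
  is at least \<open>d\<close>. But the order bound for \<open>d\<close> implies the one for
  \<open>D\<close>, so \<open>graph_word\<close> yields a word of length \<open>D + 1\<close> for
  the same graph. By uniqueness it is the given word or its reversal, of length
  \<open>d + 1\<close>.\<close>

lemma word_graph_kgd:
  assumes ok: "full_word_ok a ms b" and ms: "ms \<noteq> []"
    and len: "word_len (full_word a ms b) = d + 1" and d: "9 \<le> d"
    and small: "2 * word_size (full_word a ms b) \<le> 3 * d + 16"
  shows "kgd_graph 3 4 d (word_graph (full_word a ms b))"
proof -
  let ?w = "full_word a ms b"
  let ?G = "word_graph ?w"
  let ?E = "parcs ?G" and ?V = "pverts ?G"
  note bl = full_word_blocks[OF ok]
  interpret cubic_graph ?E ?V by (rule word_graph_cubic[OF ok])
  have reach: "(x, y) \<in> ?E\<^sup>*" if "x \<in> ?V" "y \<in> ?V" for x y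
  proof -
    have "x \<in> prod_encode ` word_verts ?w" "y \<in> prod_encode ` word_verts ?w"
      using that by (simp_all add: word_graph_def)
    then obtain p q where p: "p \<in> word_verts ?w" "q \<in> word_verts ?w" "x = prod_encode p" "y = prod_encode q"
      by blast
    have "(p, q) \<in> (word_arcs ?w)\<^sup>*" by (rule word_connected_all[where bs = ?w, OF bl p(1,2)])
    then show ?thesis unfolding p(3,4) by (rule rtrancl_map_prod) (simp add: word_graph_def)
  qed
  have reach': "\<forall>y\<in>?V. (x, y) \<in> ?E\<^sup>*" if "x \<in> ?V" for x using reach that by blast
  obtain u v where uv: "u \<in> word_verts ?w" "v \<in> word_verts ?w"
    "word_height ?w v - word_height ?w u = int (word_len ?w) - 1"
    using word_height_ends[OF ok] by blast
  let ?\<phi> = "\<lambda>x. word_height ?w (prod_decode x)"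
  have \<phi>: "?\<phi> y \<le> ?\<phi> x + 1" if "(x, y) \<in> ?E" for x y
    using word_height_step[OF ok, of "prod_decode x" "prod_decode y"] that
      prod_encode_arc_iff[of "prod_decode x" "prod_decode y" ?w] by simp
  have uV: "prod_encode u \<in> ?V" "prod_encode v \<in> ?V" using uv by (auto simp: word_graph_def)
  have dle: "d \<le> bfs ?E (prod_encode u) (prod_encode v)"
    using relpow_potential[where \<phi> = ?\<phi>, OF \<phi> bfs_less[OF uV reach'[OF uV(1)]]] uv(3) len by simp
  define D where "D = Max ((\<lambda>(x, y). bfs ?E x y) ` (?V \<times> ?V))"
  have fin2: "finite ((\<lambda>(x, y). bfs ?E x y) ` (?V \<times> ?V))" using fin by simp
  have leD: "bfs ?E x y \<le> D" if "x \<in> ?V" "y \<in> ?V" for x y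
    unfolding D_def using fin2 that by (intro Max_ge) auto
  have "D \<in> (\<lambda>(x, y). bfs ?E x y) ` (?V \<times> ?V)" unfolding D_def using fin2 uV by (intro Max_in) auto
  then obtain x y where xy: "x \<in> ?V" "y \<in> ?V" "bfs ?E x y = D" by auto
  have dD: "d \<le> D" using dle leD[OF uV] by simp
  have cV: "card ?V = word_size ?w" using word_iso_card[OF word_graph_iso] .
  have D9: "9 \<le> D" using d dD by simp
  have sm: "2 * card ?V \<le> 3 * D + 16" using small cV dD by linarith
  obtain a' ms' b' f where w': "full_word_ok a' ms' b'" "word_iso ?E ?V (full_word a' ms' b') f"
    "word_len (full_word a' ms' b') = D + 1"
    using graph_word[OF reach' leD xy D9 sm] by blast
  have "full_word a' ms' b' = ?w \<or> full_word a' ms' b' = rev ?w"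
    using word_iso_unique[OF word_graph_iso w'(2)] bl full_word_blocks[OF w'(1)] by blast
  then have "word_len (full_word a' ms' b') = word_len ?w"
    by (auto simp: word_len_def rev_map[symmetric])
  then have DD: "D = d" using w'(3) len by simp
  \<comment> \<open>The middle block next to the first end block supplies the 4-cycle.\<close>
  have m: "?w ! 1 = Mid (ms ! 0)" using ms by (simp add: full_word_nth Suc_le_eq)
  have v1: "(1, j) \<in> word_verts ?w" if "j < 6" for j
  proof -
    have "j < block_size (?w ! 1)" using that unfolding m by simp
    then show ?thesis by (simp add: word_verts_def full_word_nth(1))
  qed
  have bm: "is_block (Mid (ms ! 0))" using bl[of "?w ! 1"] m by (simp add: full_word_nth)
  note c4 = Mid_four_cycle[OF bm]
  have arc: "(prod_encode (1, i), prod_encode (1, j)) \<in> ?E"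
    if "badj (Mid (ms ! 0)) i j" "i < 6" "j < 6" for i j
    using that v1 m by (simp add: prod_encode_arc_iff word_adj_def)
  show ?thesis
  proof (rule cubic_kgd_graph[OF word_graph_cubic[OF ok] reach])
    show "bfs ?E x y \<le> d" if "x \<in> ?V" "y \<in> ?V" for x y using leD that DD by simp
    show "x \<in> ?V" "y \<in> ?V" "bfs ?E x y = d" using xy DD by simp_all
    show "(prod_encode (1, 1), prod_encode (1, 3)) \<in> ?E" "(prod_encode (1, 3), prod_encode (1, 2)) \<in> ?E"
      "(prod_encode (1, 2), prod_encode (1, 4)) \<in> ?E" "(prod_encode (1, 4), prod_encode (1, 1)) \<in> ?E"
      using arc c4 by simp_all
    show "distinct [prod_encode (1, 1), prod_encode (1, 3), prod_encode (1, 2), prod_encode (1, 4)]" by simp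
  qed
qed

lemma kgd_graph_word:
  assumes G: "kgd_graph 3 4 d G" and d: "9 \<le> d" and small: "2 * card (pverts G) \<le> 3 * d + 16"
  shows "\<exists>a ms b f. full_word_ok a ms b \<and> word_iso (parcs G) (pverts G) (full_word a ms b) f \<and>
    word_len (full_word a ms b) = d + 1"
proof -
  have d0: "0 < d" using d by simp
  note C = kgd_graph_cubic[OF G d0]
  have "pair_wf_digraph G" and diam: "diameter G = ereal (real d)"
    using G by (simp_all add: kgd_graph_def pair_graph_wf)
  note D = pair_wf_digraph.diameter_eqD[OF this d0]
  obtain u v where uv: "u \<in> pverts G" "v \<in> pverts G" "bfs (parcs G) u v = d" using D(3) by blast
  have reach: "\<forall>y\<in>pverts G. (x, y) \<in> (parcs G)\<^sup>*" if "x \<in> pverts G" for x using D(1) that by blast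
  show ?thesis using cubic_graph.graph_word[OF C reach D(2) uv d small] by blast
qed

section \<open>Counting words up to reversal\<close>

type_synonym word_code = "(nat \<times> nat) \<times> nat list \<times> (nat \<times> nat)"

definition word_of :: "word_code \<Rightarrow> block list" where
  "word_of = (\<lambda>(a, ms, b). full_word a ms b)"

definition reverse_code :: "word_code \<Rightarrow> word_code" where
  "reverse_code = (\<lambda>(a, ms, b). (b, rev ms, a))"

definition ends :: "nat \<Rightarrow> (nat \<times> nat) set" where
  "ends t = {t} \<times> {..<end_count t}"

definition mids :: "nat \<Rightarrow> nat \<Rightarrow> nat list set" where
  "mids k s = {ms. set ms \<subseteq> {0, 2, 3} \<and> length ms = k \<and> sum_list ms = s}"

text \<open>Here \<open>k\<close> is the number of middle blocks and \<open>x\<close> the excess of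
  the word above the minimum 10.\<close>

definition codes :: "nat \<Rightarrow> nat \<Rightarrow> word_code set" where
  "codes k x = {(a, ms, b). full_word_ok a ms b \<and> length ms = k \<and> fst a + fst b + sum_list ms = x}"

section \<open>Numbers of words and of palindromic words\<close>

lemma mids_0: "mids k 0 = {replicate k 0}"
  by (auto simp: mids_def sum_list_eq_0_iff intro!: replicate_eqI)

lemma mids_1: "mids k 1 = {}"
proof -
  have "sum_list ms \<noteq> 1" if "set ms \<subseteq> {0, 2, 3}" for ms :: "nat list"
    using that by (induction ms) auto
  then show ?thesis by (auto simp: mids_def)
qed

definition single_mid :: "nat \<Rightarrow> nat \<Rightarrow> nat \<Rightarrow> nat list" where
  "single_mid k s j = (replicate k 0)[j := s]"

text \<open>Nonzero entries are at least 2, so after one of them at most 1 is left, too little for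
  another.\<close>

lemma mids_single:
  assumes "s \<in> {2, 3}"
  shows "mids k s = single_mid k s ` {..<k}"
proof (intro equalityI subsetI)
  fix ms assume "ms \<in> mids k s"
  then have "set ms \<subseteq> {0, 2, 3}" "length ms = k" "sum_list ms = s" by (auto simp: mids_def)
  then show "ms \<in> single_mid k s ` {..<k}"
  proof (induction ms arbitrary: k)
    case Nil
    then show ?case using assms by auto
  next
    case (Cons m ms)
    then obtain k' where k: "k = Suc k'" "length ms = k'" by auto
    show ?case
    proof (cases "m = 0")
      case True
      have "ms \<in> single_mid k' s ` {..<k'}" by (rule Cons.IH) (use Cons.prems k True in auto)
      then obtain j where "j < k'" "ms = single_mid k' s j" by auto
      then have "m # ms = single_mid k s (Suc j)" using True k by (simp add: single_mid_def)
      then show ?thesis using \<open>j < k'\<close> k by blast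
    next
      case False
      have "sum_list ms \<in> {0, 1}" using False Cons.prems assms by auto
      moreover have "sum_list ms \<noteq> 1" using mids_1[of k'] Cons.prems k by (auto simp: mids_def)
      ultimately have "ms \<in> mids k' 0" using Cons.prems k by (auto simp: mids_def)
      then have "ms = replicate k' 0" "m = s" using Cons.prems mids_0 by auto
      then have "m # ms = single_mid k s 0" using k by (simp add: single_mid_def)
      then show ?thesis using k by blast
    qed
  qed
next
  fix ms assume "ms \<in> single_mid k s ` {..<k}"
  then obtain j where j: "j < k" "ms = single_mid k s j" by auto
  have "sum_list (single_mid k s j) = s"
    using j(1) by (simp add: single_mid_def sum_list_update)
  moreover have "set (single_mid k s j) \<subseteq> {0, 2, 3}"
    using set_update_subset_insert[of "replicate k 0" j s] assms by (auto simp: single_mid_def)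
  ultimately show "ms \<in> mids k s" using j by (simp add: mids_def single_mid_def)
qed

lemma inj_single_mid:
  assumes "s \<noteq> 0"
  shows "inj_on (single_mid k s) {..<k}"
proof (rule inj_onI)
  fix i j assume ij: "i \<in> {..<k}" "j \<in> {..<k}" "single_mid k s i = single_mid k s j"
  then have "single_mid k s j ! i = s" by (metis length_replicate lessThan_iff nth_list_update_eq single_mid_def)
  then show "i = j" using ij assms by (cases "i = j") (auto simp: single_mid_def)
qed

lemma rev_single_mid: "j < k \<Longrightarrow> rev (single_mid k s j) = single_mid k s (k - 1 - j)"
  by (simp add: single_mid_def rev_update)

lemma card_mids:
  "card (mids k 0) = 1" "card (mids k 1) = 0" "s \<in> {2, 3} \<Longrightarrow> card (mids k s) = k"
proof -
  show "card (mids k 0) = 1" "card (mids k 1) = 0" unfolding mids_0 mids_1 by simp_all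
  assume s: "s \<in> {2, 3}"
  then have "s \<noteq> 0" by auto
  then show "card (mids k s) = k" unfolding mids_single[OF s] by (simp add: card_image inj_single_mid)
qed

lemma finite_mids: "s \<le> 3 \<Longrightarrow> finite (mids k s)"
proof -
  assume "s \<le> 3"
  then consider "s = 0" | "s = 1" | "s \<in> {2, 3}" by fastforce
  then show "finite (mids k s)" by cases (auto simp: mids_0 mids_1[unfolded One_nat_def] mids_single)
qed

text \<open>A single nonzero entry has to be in the middle, which exists only for odd
  \<open>k\<close>.\<close>

lemma card_palindromic_mids:
  "card {ms \<in> mids k 0. rev ms = ms} = 1"
  "card {ms \<in> mids k 1. rev ms = ms} = 0"
  "s \<in> {2, 3} \<Longrightarrow> card {ms \<in> mids k s. rev ms = ms} = k mod 2"
proof -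
  have "{ms \<in> mids k 0. rev ms = ms} = {replicate k 0}" by (auto simp: mids_0)
  then show "card {ms \<in> mids k 0. rev ms = ms} = 1" by simp
  show "card {ms \<in> mids k 1. rev ms = ms} = 0" unfolding mids_1 by simp
  assume s: "s \<in> {2, 3}"
  have inj: "inj_on (single_mid k s) {..<k}" using s by (intro inj_single_mid) auto
  have "{ms \<in> mids k s. rev ms = ms} = single_mid k s ` {j. j < k \<and> 2 * j + 1 = k}"
  proof (intro equalityI subsetI)
    fix ms assume "ms \<in> {ms \<in> mids k s. rev ms = ms}"
    then obtain j where j: "j < k" "ms = single_mid k s j" "rev ms = ms" using mids_single[OF s] by auto
    then have "single_mid k s (k - 1 - j) = single_mid k s j" using rev_single_mid by simp
    then have "k - 1 - j = j" using inj_onD[OF inj, of "k - 1 - j" j] j by auto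
    then have "2 * j + 1 = k" using j(1) by simp
    then show "ms \<in> single_mid k s ` {j. j < k \<and> 2 * j + 1 = k}" using j by blast
  next
    fix ms assume "ms \<in> single_mid k s ` {j. j < k \<and> 2 * j + 1 = k}"
    then obtain j where j: "j < k" "2 * j + 1 = k" "ms = single_mid k s j" by auto
    then have "k - 1 - j = j" by simp
    then show "ms \<in> {ms \<in> mids k s. rev ms = ms}" using j rev_single_mid mids_single[OF s] by auto
  qed
  moreover have "inj_on (single_mid k s) {j. j < k \<and> 2 * j + 1 = k}"
    using inj by (rule inj_on_subset) auto
  moreover have "{j. j < k \<and> 2 * j + 1 = k} = (if odd k then {k div 2} else {})" by auto presburger+
  ultimately show "card {ms \<in> mids k s. rev ms = ms} = k mod 2"
    by (simp add: card_image odd_iff_mod_2_eq_one)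
qed

lemma codes_eq:
  assumes "x \<le> 3"
  shows "codes k x = (\<Union>t1\<in>{..x}. \<Union>t2\<in>{..x - t1}. ends t1 \<times> mids k (x - t1 - t2) \<times> ends t2)"
  using assms by (fastforce simp: codes_def ends_def mids_def full_word_ok_def)

lemma finite_codes:
  assumes "x \<le> 3"
  shows "finite (codes k x)"
  unfolding codes_eq[OF assms] by (intro finite_UN_I finite_cartesian_product)
    (use assms finite_mids in \<open>auto simp: ends_def\<close>)

lemma card_codes_sum:
  assumes "x \<le> 3"
  shows "card (codes k x) =
    (\<Sum>t1\<in>{..x}. \<Sum>t2\<in>{..x - t1}. end_count t1 * (card (mids k (x - t1 - t2)) * end_count t2))"
proof -
  let ?B = "\<lambda>t1 t2. ends t1 \<times> mids k (x - t1 - t2) \<times> ends t2"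
  have fin: "finite (?B t1 t2)" for t1 t2
    using finite_mids[of "x - t1 - t2" k] assms by (auto simp: ends_def)
  have "card (codes k x) = (\<Sum>t1\<in>{..x}. card (\<Union>t2\<in>{..x - t1}. ?B t1 t2))"
    unfolding codes_eq[OF assms] by (rule card_UN_disjoint) (use fin in \<open>auto simp: ends_def\<close>)
  also have "\<dots> = (\<Sum>t1\<in>{..x}. \<Sum>t2\<in>{..x - t1}. card (?B t1 t2))"
    by (intro sum.cong refl card_UN_disjoint) (use fin in \<open>auto simp: ends_def\<close>)
  finally show ?thesis by (simp add: card_cartesian_product ends_def)
qed

text \<open>With all middle blocks of excess 0, the pairs of ends number 4 + 4, 7 + 16 + 7 and 7 +
  28 + 28 + 7 for \<open>x\<close> = 1, 2, 3. One \<open>Mid 2\<close> adds \<open>k\<close> words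
  for \<open>x = 2\<close> and \<open>8 * k\<close> for \<open>x = 3\<close>; one
  \<open>Mid 3\<close> adds another \<open>k\<close>.\<close>

lemma card_codes:
  "card (codes k 0) = 1" "card (codes k 1) = 8" "card (codes k 2) = 30 + k" "card (codes k 3) = 70 + 9 * k"
  using card_mids(1,2)[of k] card_mids(3)[of 2 k] card_mids(3)[of 3 k]
  by (simp_all add: card_codes_sum end_count_def numeral_eq_Suc)

lemma fixed_codes_eq:
  assumes "x \<le> 3"
  shows "{w \<in> codes k x. reverse_code w = w} =
    (\<Union>t\<in>{..x div 2}. (\<lambda>(a, ms). (a, ms, a)) ` (ends t \<times> {ms \<in> mids k (x - 2 * t). rev ms = ms}))"
proof (intro equalityI subsetI)
  fix w assume "w \<in> {w \<in> codes k x. reverse_code w = w}"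
  then have wc: "w \<in> codes k x" "reverse_code w = w" by simp_all
  obtain a ms b where w: "w = (a, ms, b)" by (metis prod_cases3)
  have ok: "full_word_ok a ms b" "length ms = k" "fst a + fst b + sum_list ms = x"
    using wc(1) by (simp_all add: codes_def w)
  have "b = a \<and> rev ms = ms \<and> a = b"
    using wc(2) unfolding w reverse_code_def prod.case prod.inject .
  then have eq: "b = a" "rev ms = ms" by blast+
  have "fst a \<le> x div 2" "sum_list ms = x - 2 * fst a" using ok(3) eq(1) by simp_all
  moreover have "a \<in> ends (fst a)" using ok(1) by (cases a) (simp add: ends_def full_word_ok_def)
  ultimately show "w \<in> (\<Union>t\<in>{..x div 2}. (\<lambda>(a, ms). (a, ms, a)) ` (ends t \<times> {ms \<in> mids k (x - 2 * t). rev ms = ms}))"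
    using ok(1,2) eq unfolding w
    by (intro UN_I[of "fst a"] image_eqI[of _ _ "(a, ms)"]) (simp_all add: mids_def full_word_ok_def)
next
  fix w assume "w \<in> (\<Union>t\<in>{..x div 2}. (\<lambda>(a, ms). (a, ms, a)) ` (ends t \<times> {ms \<in> mids k (x - 2 * t). rev ms = ms}))"
  then obtain t p where t: "t \<le> x div 2" and p: "p \<in> ends t \<times> {ms \<in> mids k (x - 2 * t). rev ms = ms}"
    "w = (\<lambda>(a, ms). (a, ms, a)) p" by blast
  obtain a ms where "p = (a, ms)" by (cases p)
  then have a: "a \<in> ends t" and ms: "ms \<in> mids k (x - 2 * t)" "rev ms = ms" and w: "w = (a, ms, a)"
    using p by simp_all
  have "fst a = t" "snd a < end_count t" using a by (auto simp: ends_def)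
  moreover have "2 * t \<le> x" "t < 4" using t assms by simp_all
  ultimately show "w \<in> {w \<in> codes k x. reverse_code w = w}"
    using ms unfolding w by (simp add: codes_def mids_def full_word_ok_def reverse_code_def)
qed

lemma card_fixed_codes_sum:
  assumes "x \<le> 3"
  shows "card {w \<in> codes k x. reverse_code w = w} =
    (\<Sum>t\<in>{..x div 2}. end_count t * card {ms \<in> mids k (x - 2 * t). rev ms = ms})"
proof -
  let ?f = "\<lambda>(a, ms). (a, ms, a)"
  let ?B = "\<lambda>t. ends t \<times> {ms \<in> mids k (x - 2 * t). rev ms = ms}"
  have fin: "finite (?f ` ?B t)" for t
    using finite_mids[of "x - 2 * t" k] assms by (auto simp: ends_def)
  have "card {w \<in> codes k x. reverse_code w = w} = (\<Sum>t\<in>{..x div 2}. card (?f ` ?B t))"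
    unfolding fixed_codes_eq[OF assms] by (rule card_UN_disjoint) (use fin in \<open>auto simp: ends_def\<close>)
  also have "\<dots> = (\<Sum>t\<in>{..x div 2}. card (?B t))"
    by (intro sum.cong refl card_image) (auto simp: inj_on_def)
  finally show ?thesis by (simp add: card_cartesian_product ends_def)
qed

text \<open>A palindrome has equal ends, and their excesses add up to an even number. For
  \<open>x = 2\<close> there are 4 with ends of excess 1, all others having a central middle block
  of excess \<open>x\<close>; for \<open>x = 3\<close> ends of excess 1 would need a middle block of
  excess 1.\<close>

lemma card_fixed_codes:
  "card {w \<in> codes k 0. reverse_code w = w} = 1" "card {w \<in> codes k 1. reverse_code w = w} = 0"
  "card {w \<in> codes k 2. reverse_code w = w} = 4 + k mod 2" "card {w \<in> codes k 3. reverse_code w = w} = k mod 2"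
proof -
  note pal = card_palindromic_mids(1,2)[of k] card_palindromic_mids(3)[of 2 k] card_palindromic_mids(3)[of 3 k]
  show "card {w \<in> codes k 0. reverse_code w = w} = 1" "card {w \<in> codes k 1. reverse_code w = w} = 0"
    "card {w \<in> codes k 2. reverse_code w = w} = 4 + k mod 2"
    using pal by (simp_all add: card_fixed_codes_sum end_count_def numeral_eq_Suc)
  have "{..(3::nat) div 2} = {0, 1}" by auto
  then show "card {w \<in> codes k 3. reverse_code w = w} = k mod 2"
    using pal by (simp add: card_fixed_codes_sum end_count_def)
qed

text \<open>Fixed points get weight 2 and the other points weight 1, so that every orbit has total
  weight 2.\<close>

lemma card_orbits_involution:
  assumes fin: "finite W" and r: "\<And>w. w \<in> W \<Longrightarrow> r w \<in> W" "\<And>w. w \<in> W \<Longrightarrow> r (r w) = w"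
  shows "2 * card ((\<lambda>w. {w, r w}) ` W) = card W + card {w \<in> W. r w = w}"
proof -
  let ?O = "(\<lambda>w. {w, r w}) ` W"
  let ?g = "\<lambda>w. 1 + of_bool (r w = w) :: nat"
  have "(\<Sum>w\<in>W. of_bool (r w = w)) = card {w \<in> W. r w = w}"
    using fin by (simp add: Int_def)
  then have "card W + card {w \<in> W. r w = w} = (\<Sum>w\<in>W. ?g w)"
    by (simp only: sum.distrib sum_constant of_nat_id mult_1_right)
  also have "\<dots> = (\<Sum>c\<in>?O. \<Sum>w\<in>{w \<in> W. {w, r w} = c}. ?g w)"
    by (rule sum.image_gen[OF fin])
  also have "\<dots> = (\<Sum>c\<in>?O. 2)"
  proof (rule sum.cong[OF refl])
    fix c assume "c \<in> ?O"
    then obtain v where v: "v \<in> W" "c = {v, r v}" by blast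
    have "{w \<in> W. {w, r w} = c} = {v, r v}"
      using v r by (auto simp: doubleton_eq_iff)
    then show "(\<Sum>w\<in>{w \<in> W. {w, r w} = c}. ?g w) = 2"
      using r(2)[OF v(1)] by (cases "r v = v") auto
  qed
  finally show ?thesis by simp
qed

lemma card_image_same_kernel:
  assumes "\<And>x y. x \<in> A \<Longrightarrow> y \<in> A \<Longrightarrow> f x = f y \<longleftrightarrow> g x = g y"
  shows "card (f ` A) = card (g ` A)"
proof -
  define h where "h c = g (SOME x. x \<in> A \<and> f x = c)" for c
  have h: "h (f x) = g x" if "x \<in> A" for x
  proof -
    have "(SOME y. y \<in> A \<and> f y = f x) \<in> A \<and> f (SOME y. y \<in> A \<and> f y = f x) = f x"
      by (rule someI[of _ x]) (use that in simp)
    then have "g (SOME y. y \<in> A \<and> f y = f x) = g x" using assms that by blast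
    then show ?thesis by (simp only: h_def)
  qed
  have "inj_on h (f ` A)" using h assms by (auto simp: inj_on_def)
  moreover have "h ` f ` A = g ` A" using h by (force simp: image_iff)
  ultimately show ?thesis by (metis card_image)
qed

lemma reverse_codes: "c \<in> codes k x \<Longrightarrow> reverse_code c \<in> codes k x"
  by (auto simp: codes_def reverse_code_def full_word_ok_def)

lemma reverse_reverse_code [simp]: "reverse_code (reverse_code c) = c"
  by (auto simp: reverse_code_def split: prod.splits)

lemma word_of_reverse: "word_of (reverse_code c) = rev (word_of c)"
  by (simp add: word_of_def reverse_code_def rev_full_word split: prod.splits)

lemma inj_word_of: "word_of c = word_of c' \<Longrightarrow> c = c'"
proof -
  assume eq: "word_of c = word_of c'"
  obtain a ms b a' ms' b' where [simp]: "c = (a, ms, b)" "c' = (a', ms', b')" by (metis prod_cases3)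
  have "inj Mid" by (auto simp: inj_def)
  then have "ms = ms'" using eq by (auto simp: word_of_def full_word_def inj_map_eq_map)
  then show ?thesis using eq by (simp add: word_of_def full_word_def prod_eq_iff)
qed

lemma codes_words:
  assumes "c \<in> codes k x"
  shows "b \<in> set (word_of c) \<Longrightarrow> is_block b"
    and "word_size (word_of c) = 14 + 6 * k + 2 * x" and "word_len (word_of c) = 4 * k + 6 + x"
  using assms full_word_blocks
  by (auto simp: codes_def word_of_def full_word_size full_word_len)

text \<open>Twice the order of a word in \<open>codes k x\<close> is \<open>3 * d + 13 + x\<close>,
  so \<open>x \<le> 3\<close> is the order bound of the classification. The condition
  \<open>1 \<le> k\<close> corresponds to \<open>d \<ge> 9\<close> and provides a middle
  block.\<close>

locale cage_parameters =
  fixes d k x :: nat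
  assumes d: "d = 4 * k + 5 + x" and k: "1 \<le> k" and x: "x \<le> 3"
begin

text \<open>The length of the word determines its excess \<open>y\<close> modulo 4, and the order
  bound gives \<open>y \<le> 3\<close>; so \<open>y = x\<close>, and the number of middle blocks is
  \<open>k\<close>.\<close>

lemma small_graph_code:
  assumes "kgd_graph 3 4 d G" "2 * card (pverts G) \<le> 3 * d + 16"
  shows "\<exists>c\<in>codes k x. \<exists>f. word_iso (parcs G) (pverts G) (word_of c) f"
proof -
  have "9 \<le> d" using d k by simp
  from kgd_graph_word[OF assms(1) this assms(2)] obtain a ms b f where
    w: "full_word_ok a ms b" "word_iso (parcs G) (pverts G) (full_word a ms b) f"
      "word_len (full_word a ms b) = d + 1" by blast
  define y where "y = fst a + fst b + sum_list ms"
  have "4 * length ms + y + 5 = 4 * k + 5 + x" using w(3) d by (simp add: full_word_len y_def)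
  moreover have "y \<le> 3"
    using assms(2) word_iso_card[OF w(2)] w(3) by (simp add: full_word_size full_word_len y_def)
  moreover from calculation have len: "length ms = k" using x by linarith
  ultimately have "y = x" by simp
  then have "(a, ms, b) \<in> codes k x" using w(1) len by (simp add: codes_def y_def)
  then show ?thesis using w(2) by (intro bexI[of _ "(a, ms, b)"]) (auto simp: word_of_def)
qed

lemma code_graph:
  assumes c: "c \<in> codes k x"
  shows "kgd_graph 3 4 d (word_graph (word_of c))"
proof -
  obtain a ms b where [simp]: "c = (a, ms, b)" by (metis prod_cases3)
  have "kgd_graph 3 4 d (word_graph (full_word a ms b))"
  proof (rule word_graph_kgd)
    show "full_word_ok a ms b" "ms \<noteq> []" using c k by (auto simp: codes_def)
    show "word_len (full_word a ms b) = d + 1" using codes_words(3)[OF c] d by (simp add: word_of_def)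
    show "9 \<le> d" using d k by simp
    show "2 * word_size (full_word a ms b) \<le> 3 * d + 16"
      using codes_words(2)[OF c] d x by (simp add: word_of_def)
  qed
  then show ?thesis by (simp add: word_of_def)
qed

lemma code_graph_card:
  assumes "c \<in> codes k x"
  shows "card (pverts (word_graph (word_of c))) = 14 + 6 * k + 2 * x"
  using word_iso_card[OF word_graph_iso] codes_words(2)[OF assms] by simp

text \<open>A smaller graph would satisfy the order bound too, hence come from a word in
  \<open>codes k x\<close>, and all of these have the same order.\<close>

lemma graph_card_ge:
  assumes "kgd_graph 3 4 d G"
  shows "14 + 6 * k + 2 * x \<le> card (pverts G)"
proof (rule ccontr)
  assume n: "\<not> ?thesis"
  have "3 * d = 12 * k + 15 + 3 * x" using d by simp
  with n x have "2 * card (pverts G) \<le> 3 * d + 16" by linarith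
  from small_graph_code[OF assms this] obtain c f where
    c: "c \<in> codes k x" "word_iso (parcs G) (pverts G) (word_of c) f" by blast
  show False using n codes_words(2)[OF c(1)] word_iso_card[OF c(2)] by simp
qed

lemma code_cage: "c \<in> codes k x \<Longrightarrow> kgd_cage 3 4 d (word_graph (word_of c))"
  unfolding kgd_cage_def
proof (intro conjI allI impI)
  assume c: "c \<in> codes k x"
  show "kgd_graph 3 4 d (word_graph (word_of c))" by (rule code_graph[OF c])
  show "card (pverts (word_graph (word_of c))) \<le> card (pverts H)" if "kgd_graph 3 4 d H" for H :: "nat pair_pre_digraph"
    using graph_card_ge[OF that] code_graph_card[OF c] by simp
qed

lemma codes_nonempty: "codes k x \<noteq> {}"
proof -
  have "(((x, 0), replicate k 0, (0, 0)) :: word_code) \<in> codes k x"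
    using x by (auto simp: codes_def full_word_ok_def end_count_def nth_Cons' )
  then show ?thesis by blast
qed

lemma cage_code:
  assumes "kgd_cage 3 4 d G"
  shows "\<exists>c\<in>codes k x. \<exists>f. word_iso (parcs G) (pverts G) (word_of c) f"
proof (rule small_graph_code)
  show "kgd_graph 3 4 d G" using assms by (simp add: kgd_cage_def)
  obtain c where c: "c \<in> codes k x" using codes_nonempty by blast
  have "card (pverts G) \<le> 14 + 6 * k + 2 * x"
    using assms code_graph[OF c] code_graph_card[OF c] unfolding kgd_cage_def by metis
  then show "2 * card (pverts G) \<le> 3 * d + 16" using d x by simp
qed

lemma code_graph_wf: "c \<in> codes k x \<Longrightarrow> pair_wf_digraph (word_graph (word_of c))"
  using code_graph by (simp add: kgd_graph_def pair_graph_wf)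

lemma code_graph_iso_iff:
  assumes c: "c \<in> codes k x" "c' \<in> codes k x"
  shows "digraph_iso (with_proj (word_graph (word_of c))) (with_proj (word_graph (word_of c'))) \<longleftrightarrow>
    c' = c \<or> c' = reverse_code c"
proof
  let ?G = "word_graph (word_of c)" and ?G' = "word_graph (word_of c')"
  assume "digraph_iso (with_proj ?G) (with_proj ?G')"
  then obtain f where "word_iso (parcs ?G') (pverts ?G') (word_of c) f"
    using digraph_iso_word_iso[OF code_graph_wf[OF c(1)]] by blast
  then have "word_of c' = word_of c \<or> word_of c' = rev (word_of c)"
    by (rule word_iso_unique[OF _ word_graph_iso]) (use codes_words(1) c in blast)+
  then show "c' = c \<or> c' = reverse_code c"
    using inj_word_of word_of_reverse by metis
next
  let ?G = "word_graph (word_of c)" and ?G' = "word_graph (word_of c')"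
  assume "c' = c \<or> c' = reverse_code c"
  then have "c = c' \<or> word_of c = rev (word_of c')" using word_of_reverse by (metis rev_rev_ident)
  then have "\<exists>f. word_iso (parcs ?G') (pverts ?G') (word_of c) f"
    using word_graph_iso word_iso_rev[OF word_graph_iso, of "word_of c'"] codes_words(1)[OF c(2)] by metis
  then show "digraph_iso (with_proj ?G) (with_proj ?G')"
    using word_iso_digraph_iso code_graph_wf c by blast
qed

theorem num_cages: "2 * num_kgd_cages 3 4 d = card (codes k x) + card {c \<in> codes k x. reverse_code c = c}"
proof -
  define \<G> :: "nat pair_pre_digraph set" where "\<G> = {G. kgd_cage 3 4 d G}"
  let ?r = "graph_iso_on \<G>"
  let ?cls = "\<lambda>c. ?r `` {word_graph (word_of c)}"
  have wf: "pair_wf_digraph G" if "G \<in> \<G>" for G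
    using that by (simp add: \<G>_def kgd_cage_def kgd_graph_def pair_graph_wf)
  have eq: "equiv \<G> ?r" by (rule equiv_graph_iso_on) (rule wf)
  have inG: "word_graph (word_of c) \<in> \<G>" if "c \<in> codes k x" for c
    using code_cage[OF that] by (simp add: \<G>_def)
  have "\<G> // ?r = ?cls ` codes k x"
  proof (intro equalityI subsetI)
    fix X assume "X \<in> \<G> // ?r"
    then obtain G where G: "G \<in> \<G>" "X = ?r `` {G}" by (auto elim: quotientE)
    then have "kgd_cage 3 4 d G" by (simp add: \<G>_def)
    from cage_code[OF this] obtain c f where
      c: "c \<in> codes k x" "word_iso (parcs G) (pverts G) (word_of c) f" by blast
    have "digraph_iso (with_proj (word_graph (word_of c))) (with_proj G)"
      by (rule word_iso_digraph_iso[OF wf[OF G(1)] c(2) code_graph_wf[OF c(1)]])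
    then have "(word_graph (word_of c), G) \<in> ?r" using G(1) inG[OF c(1)] by (simp add: graph_iso_on_def)
    then have "?cls c = X" using equiv_class_eq[OF eq] G(2) by simp
    then show "X \<in> ?cls ` codes k x" using c(1) by blast
  qed (use inG in \<open>auto intro: quotientI\<close>)
  then have "num_kgd_cages 3 4 d = card (?cls ` codes k x)" by (simp add: num_kgd_cages_def \<G>_def)
  also have "\<dots> = card ((\<lambda>c. {c, reverse_code c}) ` codes k x)"
  proof (rule card_image_same_kernel)
    fix c c' assume c: "c \<in> codes k x" "c' \<in> codes k x"
    have "?cls c = ?cls c' \<longleftrightarrow> (word_graph (word_of c), word_graph (word_of c')) \<in> ?r"
      by (rule eq_equiv_class_iff[OF eq inG[OF c(1)] inG[OF c(2)]])
    also have "\<dots> \<longleftrightarrow> c' = c \<or> c' = reverse_code c"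
      using code_graph_iso_iff[OF c] inG c by (simp add: graph_iso_on_def)
    also have "\<dots> \<longleftrightarrow> {c, reverse_code c} = {c', reverse_code c'}"
      by (auto simp: doubleton_eq_iff)
    finally show "?cls c = ?cls c' \<longleftrightarrow> {c, reverse_code c} = {c', reverse_code c'}" .
  qed
  finally show ?thesis
    using card_orbits_involution[of "codes k x" reverse_code] finite_codes[OF x] reverse_codes by simp
qed

end

theorem proposition7:
  fixes d :: nat
  assumes "d \<ge> 9"
  shows "num_kgd_cages 3 4 d =
    (if d mod 4 = 1 then 1
     else if d mod 4 = 2 then 4
     else if d mod 4 = 3 then 17 + d div 8
     else 27 + d + (d - 4) div 8)"
proof -
  \<comment> \<open>The solution of \<open>d = 4 * k + 5 + x\<close>, since \<open>d - 5\<close> and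
    \<open>d - 1\<close> agree modulo 4.\<close>
  define k x where "k = (d - 5) div 4" and "x = (d - 1) mod 4"
  interpret cage_parameters d k x
  proof
    obtain j where j: "d = j + 5" using that[of "d - 5"] assms by simp
    have "d - 1 = j + 4" using j by simp
    then have "x = j mod 4" unfolding x_def by (simp only: mod_add_self2)
    then show "d = 4 * k + 5 + x" unfolding k_def j by simp
    show "1 \<le> k" using assms unfolding k_def by simp
    show "x \<le> 3" unfolding x_def by simp
  qed
  consider "x = 0" | "x = 1" | "x = 2" | "x = 3" using x by linarith
  then show ?thesis
  proof cases
    case 1
    then have "num_kgd_cages 3 4 d = 1" using num_cages card_codes card_fixed_codes by simp
    moreover have "d = 1 + 4 * (k + 1)" using d 1 by simp
    then have "d mod 4 = 1" by simp
    ultimately show ?thesis by simp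
  next
    case 2
    then have "num_kgd_cages 3 4 d = 4" using num_cages card_codes card_fixed_codes by simp
    moreover have "d = 2 + 4 * (k + 1)" using d 2 by simp
    then have "d mod 4 = 2" by simp
    ultimately show ?thesis by simp
  next
    case 3
    \<comment> \<open>Half of \<open>k + k mod 2\<close> is \<open>(k + 1) div 2\<close>, which is
      \<open>d div 8\<close> for \<open>d = 4 * (k + 1) + 3\<close>. The parity of \<open>k\<close>
      is split to resolve the roundings.\<close>
    then have N: "2 * num_kgd_cages 3 4 d = 34 + k + k mod 2" using num_cages card_codes card_fixed_codes by simp
    have dk: "d = 3 + 4 * (k + 1)" using d 3 by simp
    then have "d mod 4 = 3" by simp
    moreover have "num_kgd_cages 3 4 d = 17 + d div 8"
    proof (cases "even k")
      case True
      then obtain q where q: "k = 2 * q" by (elim evenE)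
      then have "d = 7 + 8 * q" using dk by simp
      then show ?thesis using N q by simp
    next
      case False
      then obtain q where q: "k = 2 * q + 1" by (elim oddE)
      then have "d = 3 + 8 * (q + 1)" using dk by simp
      then show ?thesis using N q by simp
    qed
    ultimately show ?thesis by simp
  next
    case 4
    \<comment> \<open>The half is \<open>35 + 4 * k\<close> plus \<open>(k + 1) div 2\<close>; for
      \<open>d = 4 * (k + 2)\<close> these are \<open>27 + d\<close> and
      \<open>(d - 4) div 8\<close>.\<close>
    then have N: "2 * num_kgd_cages 3 4 d = 70 + 9 * k + k mod 2" using num_cages card_codes card_fixed_codes by simp
    have dk: "d = 4 * (k + 2)" using d 4 by simp
    then have "d mod 4 = 0" by simp
    moreover have "num_kgd_cages 3 4 d = 27 + d + (d - 4) div 8"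
    proof (cases "even k")
      case True
      then obtain q where q: "k = 2 * q" by (elim evenE)
      then have "d - 4 = 4 + 8 * q" "d = 8 * q + 8" using dk by simp_all
      then show ?thesis using N q by simp
    next
      case False
      then obtain q where q: "k = 2 * q + 1" by (elim oddE)
      then have "d - 4 = 8 * (q + 1)" "d = 8 * q + 12" using dk by simp_all
      then show ?thesis using N q by simp
    qed
    ultimately show ?thesis by simp
  qed
qed

end
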